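(* Let $f$ be a function belonging to $L^\infty(\Omega)$ such that for every $\omega\subset\subset\Omega$ there exists $c_\omega>0$ such that $f\ge c_\omega$ in $\omega$. Let $\{\omega_n\}$ be an increasing sequence of compactly contained subsets of $\Omega$ such that their union is $\Omega$, and let $u_n$ be the distributional solution of $$-\mathrm{div}(M(x)\nabla u_n)=\frac{f(x)\,\chi_{\omega_n}}{u_n^{n}}\ \text{ in }\Omega,\qquad u_n=0\ \text{ on }\partial\Omega.$$ Then $\{u_n\}$ is bounded in $L^\infty(\Omega)$, so that it converges, up to subsequences, to a bounded function $u$, which is identically equal to $1$ almost everywhere in $\Omega$. Moreover, the sequence $\{f(x)\chi_{\omega_n}/u_n^{n}\}$ is unbounded in $L^1(\Omega)$, and there is no limit equation for $u$.
   Context: $\Omega$ is an open and bounded subset of $\mathbb{R}^N$, $N\ge1$. $A\subset\subset B$ means that $A$ is compactly contained in $B$. $\chi_A$ is the characteristic function of $A$. $M(x)$ is a matrix such that, for some constants $0<\alpha\le\beta$, for almost every $x\in\Omega$ and every $\xi\in\mathbb{R}^N$: $M(x)\xi\cdot\xi\ge\alpha|\xi|^2$ and $|M(x)|\le\beta$. Let $\gamma>0$ and let $h\in L^\infty(\Omega)$ be nonnegative and not identically zero. A distributional solution of $-\mathrm{div}(M(x)\nabla u)=h/u^\gamma$ in $\Omega$, $u>0$ in $\Omega$, $u=0$ on $\partial\Omega$, is a function $u\in W^{1,1}_{loc}(\Omega)$, with $u\in W^{1,1}_0(\Omega)$ if $\gamma<1$ and $u^{\frac{\gamma+1}{2}}\in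 W^{1,1}_0(\Omega)$ if $\gamma\ge1$, such that for every $\omega\subset\subset\Omega$ there exists $c_{\omega,\gamma}>0$ with $u\ge c_{\omega,\gamma}$ in $\omega$, and $\int_\Omega M(x)\nabla u\cdot\nabla\varphi=\int_\Omega\frac{h\,\varphi}{u^\gamma}$ for all $\varphi\in C^1_c(\Omega)$ (the $C^1$ functions with compact support in $\Omega$). In the claim $\gamma=n$ and $h=f\chi_{\omega_n}$. For $\gamma>1$, the solution meant is the one produced by the standard existence argument: the pointwise limit of the increasing sequence of solutions $u_m$, $m\in\mathbb{N}$, of $-\mathrm{div}(M(x)\nabla u_m)=\frac{h}{(u_m+\frac1m)^\gamma}$ in $\Omega$, $u_m>0$ in $\Omega$, $u_m=0$ on $\partial\Omega$; it belongs to $W^{1,2}_{loc}(\Omega)\cap L^\infty(\Omega)$. "Limit equation" is used informally, for an equation satisfied by $u$ that is obtained by letting $n$ tend to infinity in the equations satisfied by $u_n$.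
   Formalization: For n=1 (γ=1), u_1 is also taken to be the limit of the increasing approximating scheme, as the context does for γ>1: on a plane domain with a re-entrant corner a distributional solution u_1 in W^{1,1}_0 can be unbounded, so the L^∞ bound would fail. *)

theory Defs
  imports "HOL-Analysis.Analysis"
begin

definition compactly_contained :: "'a::metric_space set \<Rightarrow> 'a set \<Rightarrow> bool"
  (infix "\<subset>\<subset>" 50) where
  "A \<subset>\<subset> B \<longleftrightarrow> compact (closure A) \<and> closure A \<subseteq> B"

section \<open>Function spaces\<close>

definition ess_bounded_by ::
    "(real ^ 'n) set \<Rightarrow> real \<Rightarrow> (real ^ 'n \<Rightarrow> real) \<Rightarrow> bool" where
  "ess_bounded_by \<Omega> C g \<longleftrightarrow>
     g \<in> borel_measurable (lebesgue_on \<Omega>) \<and> (AE x in lebesgue_on \<Omega>. \<bar>g x\<bar> \<le> C)"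

definition in_Linf :: "(real ^ 'n) set \<Rightarrow> (real ^ 'n \<Rightarrow> real) \<Rightarrow> bool" where
  "in_Linf \<Omega> g \<longleftrightarrow> (\<exists>C. ess_bounded_by \<Omega> C g)"

definition in_Lp ::
    "real \<Rightarrow> (real ^ 'n) set \<Rightarrow> (real ^ 'n \<Rightarrow> 'b::euclidean_space) \<Rightarrow> bool" where
  "in_Lp p \<Omega> g \<longleftrightarrow>
     g \<in> borel_measurable (lebesgue_on \<Omega>) \<and>
     integrable (lebesgue_on \<Omega>) (\<lambda>x. norm (g x) powr p)"

definition locally_integrable ::
    "(real ^ 'n) set \<Rightarrow> (real ^ 'n \<Rightarrow> 'b::euclidean_space) \<Rightarrow> bool" where
  "locally_integrable \<Omega> g \<longleftrightarrow> (\<forall>K. compact K \<and> K \<subseteq> \<Omega> \<longrightarrow> integrable (lebesgue_on K) g)"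

text \<open>A function of class \<open>C\<^sup>1\<close> with compact support in an open set \<open>\<Omega>\<close>, extended
  by \<open>0\<close> to the whole space, together with its gradient \<open>D\<close>.\<close>

definition C1c :: "(real ^ 'n) set \<Rightarrow> (real ^ 'n \<Rightarrow> real) \<Rightarrow> (real ^ 'n \<Rightarrow> real ^ 'n) \<Rightarrow> bool" where
  "C1c \<Omega> \<phi> D \<longleftrightarrow>
     (\<forall>x. GDERIV \<phi> x :> D x) \<and> continuous_on UNIV D \<and>
     (\<exists>K. compact K \<and> K \<subseteq> \<Omega> \<and> (\<forall>x. x \<notin> K \<longrightarrow> \<phi> x = 0))"

text \<open>\<open>W11_loc \<Omega> u G\<close>: \<open>u\<close> belongs to \<open>W\<^sup>1\<^sup>,\<^sup>1\<^sub>l\<^sub>o\<^sub>c(\<Omega>)\<close> and has the weak gradient \<open>G\<close>.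
  All Sobolev predicates carry the gradient as an argument; it is determined up to null sets.\<close>

definition W11_loc :: "(real ^ 'n) set \<Rightarrow> (real ^ 'n \<Rightarrow> real) \<Rightarrow> (real ^ 'n \<Rightarrow> real ^ 'n) \<Rightarrow> bool" where
  "W11_loc \<Omega> u G \<longleftrightarrow>
     locally_integrable \<Omega> u \<and> locally_integrable \<Omega> G \<and>
     (\<forall>\<phi> D. C1c \<Omega> \<phi> D \<longrightarrow>
        (\<integral>x. u x *\<^sub>R D x \<partial>lebesgue_on \<Omega>) = - (\<integral>x. \<phi> x *\<^sub>R G x \<partial>lebesgue_on \<Omega>))"

definition W1p :: 
    "real \<Rightarrow> (real ^ 'n) set \<Rightarrow> (real ^ 'n \<Rightarrow> real) \<Rightarrow> (real ^ 'n \<Rightarrow> real ^ 'n) \<Rightarrow> bool" where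
  "W1p p \<Omega> u G \<longleftrightarrow> W11_loc \<Omega> u G \<and> in_Lp p \<Omega> u \<and> in_Lp p \<Omega> G"

text \<open>\<open>W\<^sup>1\<^sup>,\<^sup>p\<^sub>0(\<Omega>)\<close>: the closure of \<open>C\<^sup>1\<^sub>c(\<Omega>)\<close> in the norm of \<open>W\<^sup>1\<^sup>,\<^sup>p(\<Omega>)\<close>.\<close>

definition W1p0 ::
    "real \<Rightarrow> (real ^ 'n) set \<Rightarrow> (real ^ 'n \<Rightarrow> real) \<Rightarrow> (real ^ 'n \<Rightarrow> real ^ 'n) \<Rightarrow> bool" where
  "W1p0 p \<Omega> u G \<longleftrightarrow>
     W1p p \<Omega> u G \<and>
     (\<exists>\<phi> D. (\<forall>k::nat. C1c \<Omega> (\<phi> k) (D k)) \<and>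
        (\<lambda>k. \<integral>x. \<bar>\<phi> k x - u x\<bar> powr p \<partial>lebesgue_on \<Omega>) \<longlonglongrightarrow> 0 \<and>
        (\<lambda>k. \<integral>x. norm (D k x - G x) powr p \<partial>lebesgue_on \<Omega>) \<longlonglongrightarrow> 0)"

section \<open>The singular problem\<close>

text \<open>\<open>|M(x)|\<close> is the operator norm; \<open>M\<close> is not assumed to be symmetric.\<close>

definition elliptic_matrix ::
    "(real ^ 'n) set \<Rightarrow> real \<Rightarrow> real \<Rightarrow> (real ^ 'n \<Rightarrow> real ^ 'n ^ 'n) \<Rightarrow> bool" where
  "elliptic_matrix \<Omega> \<alpha> \<beta> M \<longleftrightarrow>
     0 < \<alpha> \<and> \<alpha> \<le> \<beta> \<and> M \<in> borel_measurable (lebesgue_on \<Omega>) \<and>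
     (AE x in lebesgue_on \<Omega>.
        (\<forall>\<xi>. (M x *v \<xi>) \<bullet> \<xi> \<ge> \<alpha> * (norm \<xi>)\<^sup>2) \<and> onorm (\<lambda>\<xi>. M x *v \<xi>) \<le> \<beta>)"

definition admissible_datum :: "(real ^ 'n) set \<Rightarrow> (real ^ 'n \<Rightarrow> real) \<Rightarrow> bool" where
  "admissible_datum \<Omega> h \<longleftrightarrow>
     in_Linf \<Omega> h \<and> (AE x in lebesgue_on \<Omega>. h x \<ge> 0) \<and> \<not> (AE x in lebesgue_on \<Omega>. h x = 0)"

definition distributional_solution ::
    "(real ^ 'n) set \<Rightarrow> (real ^ 'n \<Rightarrow> real ^ 'n ^ 'n) \<Rightarrow> (real ^ 'n \<Rightarrow> real) \<Rightarrow> real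
      \<Rightarrow> (real ^ 'n \<Rightarrow> real) \<Rightarrow> bool" where
  "distributional_solution \<Omega> M h \<gamma> u \<longleftrightarrow>
     \<gamma> > 0 \<and> admissible_datum \<Omega> h \<and>
     (AE x in lebesgue_on \<Omega>. u x > 0) \<and>
     (\<gamma> < 1 \<longrightarrow> (\<exists>H. W1p0 1 \<Omega> u H)) \<and>
     (\<gamma> \<ge> 1 \<longrightarrow> (\<exists>H. W1p0 1 \<Omega> (\<lambda>x. u x powr ((\<gamma> + 1) / 2)) H)) \<and>
     (\<forall>A. A \<subset>\<subset> \<Omega> \<longrightarrow> (\<exists>c>0. AE x in lebesgue_on \<Omega>. x \<in> A \<longrightarrow> u x \<ge> c)) \<and>
     (\<exists>G. W11_loc \<Omega> u G \<and>
        (\<forall>\<phi> D. C1c \<Omega> \<phi> D \<longrightarrow>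
           (\<integral>x. (M x *v G x) \<bullet> D x \<partial>lebesgue_on \<Omega>)
             = (\<integral>x. h x * \<phi> x / u x powr \<gamma> \<partial>lebesgue_on \<Omega>)))"

text \<open>The regularised problem with datum \<open>h/(v + 1/m)\<^sup>\<gamma>\<close>, which is bounded by
  \<open>m\<^sup>\<gamma> h\<close>; its solution is the usual weak one in \<open>W\<^sup>1\<^sup>,\<^sup>2\<^sub>0(\<Omega>)\<close>.\<close>

definition approximate_solution ::
    "(real ^ 'n) set \<Rightarrow> (real ^ 'n \<Rightarrow> real ^ 'n ^ 'n) \<Rightarrow> (real ^ 'n \<Rightarrow> real) \<Rightarrow> real
      \<Rightarrow> nat \<Rightarrow> (real ^ 'n \<Rightarrow> real) \<Rightarrow> bool" where
  "approximate_solution \<Omega> M h \<gamma> m v \<longleftrightarrow>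
     (AE x in lebesgue_on \<Omega>. v x > 0) \<and>
     (\<exists>G. W1p0 2 \<Omega> v G \<and>
        (\<forall>\<phi> D. C1c \<Omega> \<phi> D \<longrightarrow>
           (\<integral>x. (M x *v G x) \<bullet> D x \<partial>lebesgue_on \<Omega>)
             = (\<integral>x. h x * \<phi> x / (v x + 1 / real m) powr \<gamma> \<partial>lebesgue_on \<Omega>)))"

definition limit_of_approximations ::
    "(real ^ 'n) set \<Rightarrow> (real ^ 'n \<Rightarrow> real ^ 'n ^ 'n) \<Rightarrow> (real ^ 'n \<Rightarrow> real) \<Rightarrow> real
      \<Rightarrow> (real ^ 'n \<Rightarrow> real) \<Rightarrow> bool" where
  "limit_of_approximations \<Omega> M h \<gamma> u \<longleftrightarrow>
     (\<exists>v. (\<forall>m\<ge>1. approximate_solution \<Omega> M h \<gamma> m (v m)) \<and>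
        (AE x in lebesgue_on \<Omega>. (\<forall>m\<ge>1. v m x \<le> v (Suc m) x) \<and> (\<lambda>m. v m x) \<longlonglongrightarrow> u x))"

text \<open>For \<open>\<gamma> \<ge> 1\<close> the definition of distributional solution does not by itself
  single out one function (for a merely measurable \<open>M\<close> not even in \<open>W\<^sup>1\<^sup>,\<^sup>1\<^sub>0(\<Omega>)\<close>, the
  case \<open>\<gamma> = 1\<close>); \<^emph>\<open>the\<close> solution is then the one produced by the existence argument.\<close>

definition singular_solution ::
    "(real ^ 'n) set \<Rightarrow> (real ^ 'n \<Rightarrow> real ^ 'n ^ 'n) \<Rightarrow> (real ^ 'n \<Rightarrow> real) \<Rightarrow> real
      \<Rightarrow> (real ^ 'n \<Rightarrow> real) \<Rightarrow> bool" where
  "singular_solution \<Omega> M h \<gamma> u \<longleftrightarrow>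
     distributional_solution \<Omega> M h \<gamma> u \<and>
     (\<gamma> \<ge> 1 \<longrightarrow> limit_of_approximations \<Omega> M h \<gamma> u)"

section \<open>Limit equations\<close>

text \<open>\<open>-div(M \<nabla>u) = T\<close> in \<open>\<Omega>\<close>, \<open>u = 0\<close> on \<open>\<partial>\<Omega>\<close>, with an arbitrary functional \<open>T\<close> on test
  functions as right-hand side.  The boundary condition is the one imposed on distributional
  solutions, with an unspecified exponent because \<open>(\<gamma> + 1)/2\<close> varies along the sequence.\<close>

definition dirichlet_problem ::
    "(real ^ 'n) set \<Rightarrow> (real ^ 'n \<Rightarrow> real ^ 'n ^ 'n) \<Rightarrow> ((real ^ 'n \<Rightarrow> real) \<Rightarrow> real)
      \<Rightarrow> (real ^ 'n \<Rightarrow> real) \<Rightarrow> bool" where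
  "dirichlet_problem \<Omega> M T u \<longleftrightarrow>
     (\<exists>p>0. \<exists>H. W1p0 1 \<Omega> (\<lambda>x. \<bar>u x\<bar> powr p) H) \<and>
     (\<exists>G. W11_loc \<Omega> u G \<and>
        (\<forall>\<phi> D. C1c \<Omega> \<phi> D \<longrightarrow> (\<integral>x. (M x *v G x) \<bullet> D x \<partial>lebesgue_on \<Omega>) = T \<phi>))"

text \<open>A limit equation for the limit \<open>u\<close> of solutions of
  \<open>-div(M \<nabla>u\<^sub>k) = g\<^sub>k\<close> in \<open>\<Omega>\<close>, \<open>u\<^sub>k = 0\<close> on \<open>\<partial>\<Omega>\<close>: the Dirichlet problem solved by \<open>u\<close>
  whose right-hand side is the limit of the \<open>g\<^sub>k\<close>.  The convergence of the \<open>g\<^sub>k\<close> is taken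
  in the weakest sense (against each test function), so that limits in \<open>L\<^sup>1\<close> or in the sense
  of measures are included.  The boundary condition is an essential part of the equation:
  a constant always satisfies \<open>-div(M \<nabla>u) = 0\<close> in the interior.\<close>

definition limit_equation ::
    "(real ^ 'n) set \<Rightarrow> (real ^ 'n \<Rightarrow> real ^ 'n ^ 'n) \<Rightarrow> (nat \<Rightarrow> real ^ 'n \<Rightarrow> real)
      \<Rightarrow> ((real ^ 'n \<Rightarrow> real) \<Rightarrow> real) \<Rightarrow> (real ^ 'n \<Rightarrow> real) \<Rightarrow> bool" where
  "limit_equation \<Omega> M g T u \<longleftrightarrow>
     (\<forall>\<phi> D. C1c \<Omega> \<phi> D \<longrightarrow> (\<lambda>k. \<integral>x. g k x * \<phi> x \<partial>lebesgue_on \<Omega>) \<longlonglongrightarrow> T \<phi>) \<and>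
     dirichlet_problem \<Omega> M T u"

end

theory Submission
  imports Defs
begin

text \<open>
  The solution \<open>u\<^sub>n\<close> is the increasing limit of the solutions \<open>v\<close> in \<open>W\<^sup>1\<^sup>,\<^sup>2\<^sub>0(\<Omega>)\<close> of the regularised
  equations \<open>-div(M \<nabla>v) = h/(v + 1/m)\<^sup>n\<close> with \<open>h = f \<chi>\<close>, \<open>\<chi>\<close> the indicator of \<open>\<omega>\<^sub>n\<close>.  The right-hand
  side decreases in \<open>v\<close>, so comparison gives \<open>v \<le> u\<^sub>n \<le> v + 1/m\<close>
  (\<open>limit_of_approximations_sandwich\<close>), and every estimate can be made on \<open>v\<close>, where functions of
  the solution are admissible test functions.

  From above: on \<open>{v > t}\<close> the right-hand side is at most \<open>\<parallel>f\<parallel>\<^sub>\<infinity>/t\<^sup>n\<close>, and Stampacchia's truncation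
  argument (\<open>sup_bound\<close>) yields \<open>u\<^sub>n \<le> t + C/t\<^sup>n\<close> with \<open>C\<close> independent of \<open>n\<close>.  The choice \<open>t = 1\<close>
  is the bound in \<open>L\<^sup>\<infinity>\<close>, and \<open>t > 1\<close> gives \<open>limsup u\<^sub>n \<le> 1\<close>.  In place of the Sobolev inequality a
  Nash inequality is used, which follows from translation estimates and Tonelli's theorem.

  From below: \<open>v\<close> is bounded and \<open>-div(M \<nabla>v) \<ge> 0\<close>, so testing with \<open>\<phi>\<^sup>2(K - v)\<close> bounds \<open>\<nabla>v\<close> locally
  in \<open>L\<^sup>2\<close>; testing with \<open>\<phi>\<^sup>2\<close> then bounds the local mass of the right-hand side independently of \<open>n\<close>
  (\<open>local_mass_bound\<close>).  On \<open>{u\<^sub>n < 1 - \<delta>}\<close> the right-hand side is exponentially large in \<open>n\<close>, so the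
  measure of this set decays geometrically within each compact part of \<open>\<Omega>\<close>, and Borel-Cantelli
  gives \<open>liminf u\<^sub>n \<ge> 1\<close> almost everywhere.  Thus the whole sequence tends to \<open>1\<close>.

  At the boundary: if the right-hand sides were bounded in \<open>L\<^sup>1\<close>, testing with \<open>v\<close> itself would bound
  \<open>\<nabla>v\<close> in \<open>L\<^sup>2(\<Omega>)\<close>, and \<open>1\<close> would be a limit in \<open>L\<^sup>1\<close> of \<open>C\<^sup>1\<^sub>c\<close> functions with gradients bounded in
  \<open>L\<^sup>2\<close>.  This contradicts the integration by parts \<open>\<integral>\<psi> = -\<integral>x\<^sub>e \<partial>\<^sub>e\<psi>\<close>: the gradients of functions that
  tend to \<open>1\<close> disappear in the interior, and nothing is left on the right to balance the measure
  of \<open>\<Omega>\<close> on the left (\<open>no_approximation_of_one\<close>).  The same argument shows that \<open>1\<close> is not in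
  \<open>W\<^sup>1\<^sup>,\<^sup>1\<^sub>0(\<Omega>)\<close>, as the boundary condition of a limit equation would require.
\<close>

section \<open>Test functions of class \<open>C\<^sup>1\<^sub>c\<close>\<close>

lemma C1c_continuous: "C1c \<Omega> \<phi> D \<Longrightarrow> continuous_on UNIV \<phi>"
  unfolding C1c_def gderiv_def
  by (meson has_derivative_continuous continuous_at_imp_continuous_on)

lemma GDERIV_unique: "GDERIV f x :> D \<Longrightarrow> GDERIV f x :> E \<Longrightarrow> D = E"
  unfolding gderiv_def
  by (metis has_derivative_unique inner_commute vector_eq_ldot)

lemma C1c_support:
  assumes "C1c \<Omega> \<phi> D"
  obtains K where "compact K" "K \<subseteq> \<Omega>" "\<And>x. x \<notin> K \<Longrightarrow> \<phi> x = 0" "\<And>x. x \<notin> K \<Longrightarrow> D x = 0"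
proof -
  obtain K where K: "compact K" "K \<subseteq> \<Omega>" "\<And>x. x \<notin> K \<Longrightarrow> \<phi> x = 0"
    using assms unfolding C1c_def by blast
  have "D x = 0" if "x \<notin> K" for x
  proof -
    have "GDERIV (\<lambda>x. 0::real) x :> 0" by (simp add: GDERIV_const)
    then have "GDERIV \<phi> x :> 0" unfolding gderiv_def
      by (rule has_derivative_transform_within_open[where s="-K"])
         (use K that in \<open>auto simp: compact_imp_closed open_Compl\<close>)
    then show ?thesis using assms GDERIV_unique unfolding C1c_def by blast
  qed
  with K show ?thesis using that by blast
qed

lemma C1c_bounded:
  assumes "C1c \<Omega> \<phi> D"
  obtains B where "B > 0" "\<And>x. \<bar>\<phi> x\<bar> \<le> B" "\<And>x. norm (D x) \<le> B"
proof -
  obtain K where K: "compact K" "\<And>x. x \<notin> K \<Longrightarrow> \<phi> x = 0" "\<And>x. x \<notin> K \<Longrightarrow> D x = 0"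
    using C1c_support[OF assms] by metis
  have "bounded (\<phi> ` K)" "bounded (D ` K)"
    using K(1) C1c_continuous[OF assms] assms
    by (auto intro!: compact_imp_bounded compact_continuous_image intro: continuous_on_subset simp: C1c_def)
  then obtain a b where ab: "\<And>x. x \<in> K \<Longrightarrow> \<bar>\<phi> x\<bar> \<le> a" "\<And>x. x \<in> K \<Longrightarrow> norm (D x) \<le> b"
    unfolding bounded_iff by auto
  show ?thesis
  proof (rule that[of "\<bar>a\<bar> + \<bar>b\<bar> + 1"])
    fix x show "\<bar>\<phi> x\<bar> \<le> \<bar>a\<bar> + \<bar>b\<bar> + 1" "norm (D x) \<le> \<bar>a\<bar> + \<bar>b\<bar> + 1"
      using ab[of x] K(2,3)[of x] by (cases "x \<in> K"; force)+
  qed simp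
qed

lemma C1c_add:
  assumes "C1c \<Omega> \<phi> D" "C1c \<Omega> \<psi> E"
  shows "C1c \<Omega> (\<lambda>x. \<phi> x + \<psi> x) (\<lambda>x. D x + E x)"
proof -
  obtain K where K: "compact K" "K \<subseteq> \<Omega>" "\<And>x. x \<notin> K \<Longrightarrow> \<phi> x = 0" using C1c_support[OF assms(1)] by metis
  obtain L where L: "compact L" "L \<subseteq> \<Omega>" "\<And>x. x \<notin> L \<Longrightarrow> \<psi> x = 0" using C1c_support[OF assms(2)] by metis
  show ?thesis using assms unfolding C1c_def
    by (intro conjI allI GDERIV_add continuous_intros exI[of _ "K \<union> L"]) (use K L in \<open>auto simp: compact_Un\<close>)
qed

text \<open>Only one factor carries the compact support, so that the other one may be a coordinate function.\<close>

lemma C1c_mult: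
  assumes "C1c \<Omega> \<phi> D" "\<And>x. GDERIV \<psi> x :> E x" "continuous_on UNIV E"
  shows "C1c \<Omega> (\<lambda>x. \<phi> x * \<psi> x) (\<lambda>x. \<phi> x *\<^sub>R E x + \<psi> x *\<^sub>R D x)"
proof -
  have "continuous_on UNIV \<psi>" using assms(2) unfolding gderiv_def
    by (meson has_derivative_continuous continuous_at_imp_continuous_on)
  moreover obtain K where "compact K" "K \<subseteq> \<Omega>" "\<And>x. x \<notin> K \<Longrightarrow> \<phi> x = 0" using C1c_support[OF assms(1)] by metis
  ultimately show ?thesis using assms C1c_continuous[OF assms(1)] unfolding C1c_def
    by (auto intro!: GDERIV_mult continuous_intros exI[of _ K])
qed

lemma C1c_comp:
  assumes "C1c \<Omega> \<phi> D" "\<And>s. (\<Psi> has_real_derivative \<psi> s) (at s)" "continuous_on UNIV \<psi>" "\<Psi> 0 = 0"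
  shows "C1c \<Omega> (\<lambda>x. \<Psi> (\<phi> x)) (\<lambda>x. \<psi> (\<phi> x) *\<^sub>R D x)"
proof -
  have "continuous_on UNIV (\<lambda>x. \<psi> (\<phi> x))"
    using continuous_on_compose2[OF assms(3) C1c_continuous[OF assms(1)]] by auto
  moreover have "continuous_on UNIV D" using assms unfolding C1c_def by auto
  moreover obtain K where "compact K" "K \<subseteq> \<Omega>" "\<And>x. x \<notin> K \<Longrightarrow> \<phi> x = 0" using C1c_support[OF assms(1)] by metis
  ultimately show ?thesis using assms unfolding C1c_def
    by (intro conjI allI continuous_intros exI[of _ K] GDERIV_DERIV_compose[where g=\<Psi>]) auto
qed

lemma C1c_scale: "C1c \<Omega> \<phi> D \<Longrightarrow> C1c \<Omega> (\<lambda>x. c * \<phi> x) (\<lambda>x. c *\<^sub>R D x)"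
  by (rule C1c_comp[where \<Psi>="\<lambda>s. c * s" and \<psi>="\<lambda>s. c"]) (auto intro!: derivative_eq_intros)

lemma C1c_diff:
  assumes "C1c \<Omega> \<phi> D" "C1c \<Omega> \<psi> E"
  shows "C1c \<Omega> (\<lambda>x. \<phi> x - \<psi> x) (\<lambda>x. D x - E x)"
  using C1c_add[OF assms(1) C1c_scale[OF assms(2), of "-1"]] by simp

lemma C1c_zero: "C1c \<Omega> (\<lambda>x. 0) (\<lambda>x. 0)"
  unfolding C1c_def by (auto simp: GDERIV_const intro!: exI[of _ "{}"])

lemma C1c_sum:
  "finite I \<Longrightarrow> (\<And>i. i \<in> I \<Longrightarrow> C1c \<Omega> (\<phi> i) (D i)) \<Longrightarrow> C1c \<Omega> (\<lambda>x. \<Sum>i\<in>I. \<phi> i x) (\<lambda>x. \<Sum>i\<in>I. D i x)"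
  by (induction rule: finite_induct) (auto simp: C1c_zero intro!: C1c_add)

text \<open>Squaring removes the kink of the positive part at \<open>0\<close>; the bumps and the smooth truncations
  below are built from this function.\<close>

lemma has_real_derivative_positive_part_squared:
  "((\<lambda>s. (max 0 s)\<^sup>2) has_real_derivative 2 * max 0 s) (at (s::real))"
proof (cases s "0::real" rule: linorder_cases)
  case less
  have "((\<lambda>s. 0) has_real_derivative 2 * max 0 s) (at s)" using less by simp
  then show ?thesis by (rule has_field_derivative_transform_within_open[where S="{..<0}"]) (use less in auto)
next
  case equal
  have "(\<lambda>h. ((max 0 h)\<^sup>2 - 0) / h) \<midarrow>0\<rightarrow> (0::real)"
  proof (rule Lim_null_comparison)
    show "\<forall>\<^sub>F h in at 0. norm (((max 0 h)\<^sup>2 - 0) / h) \<le> \<bar>h::real\<bar>"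
      by (intro always_eventually allI) (auto simp: max_def power2_eq_square)
    show "((\<lambda>h. \<bar>h::real\<bar>) \<longlongrightarrow> 0) (at 0)" by (auto intro: tendsto_eq_intros)
  qed
  then show ?thesis unfolding equal DERIV_def by simp
next
  case greater
  have "((\<lambda>s. s\<^sup>2) has_real_derivative 2 * max 0 s) (at s)" using greater by (auto intro!: derivative_eq_intros)
  then show ?thesis by (rule has_field_derivative_transform_within_open[where S="{0<..}"]) (use greater in auto)
qed


lemma C1c_bump:
  fixes a :: "real^'n"
  assumes "r > 0" "cball a r \<subseteq> \<Omega>"
  obtains D where "C1c \<Omega> (\<lambda>x. (max 0 (r\<^sup>2 - (x - a) \<bullet> (x - a)))\<^sup>2) D"
proof
  let ?D = "\<lambda>x. (2 * max 0 (r\<^sup>2 - (x - a) \<bullet> (x - a))) *\<^sub>R (- (2 *\<^sub>R (x - a)))"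
  have "GDERIV (\<lambda>x. (max 0 (r\<^sup>2 - (x - a) \<bullet> (x - a)))\<^sup>2) x :> ?D x" for x
  proof (rule GDERIV_DERIV_compose[OF _ has_real_derivative_positive_part_squared])
    show "GDERIV (\<lambda>x. r\<^sup>2 - (x - a) \<bullet> (x - a)) x :> - (2 *\<^sub>R (x - a))"
    proof -
      have "((\<lambda>x. (x - a) \<bullet> (x - a)) has_derivative (\<lambda>h. (x - a) \<bullet> h + h \<bullet> (x - a))) (at x)"
        by (rule has_derivative_inner) (auto intro: has_derivative_diff[of "\<lambda>x. x" "\<lambda>h. h" _ "\<lambda>_. a" "\<lambda>_. 0", simplified])
      from has_derivative_diff[OF has_derivative_const[of "r\<^sup>2"] this] show ?thesis
        unfolding gderiv_def by (rule has_derivative_eq_rhs) (auto simp: inner_commute algebra_simps)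
    qed
  qed
  moreover have "continuous_on UNIV ?D" by (intro continuous_intros)
  moreover have "(max 0 (r\<^sup>2 - (x - a) \<bullet> (x - a)))\<^sup>2 = 0" if "x \<notin> cball a r" for x
  proof -
    have "r \<le> norm (x - a)" using that by (auto simp: dist_norm norm_minus_commute)
    then have "r\<^sup>2 \<le> (norm (x - a))\<^sup>2" using assms by (intro power_mono) auto
    then show ?thesis by (simp add: dot_square_norm)
  qed
  ultimately show "C1c \<Omega> (\<lambda>x. (max 0 (r\<^sup>2 - (x - a) \<bullet> (x - a)))\<^sup>2) ?D"
    unfolding C1c_def using assms by (intro conjI allI exI[of _ "cball a r"]) auto
qed

lemma open_countable_ball_cover:
  fixes \<Omega> :: "(real^'n) set"
  assumes "open \<Omega>" "\<Omega> \<noteq> {}"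
  obtains a :: "nat \<Rightarrow> real^'n" and r :: "nat \<Rightarrow> real" where
    "\<And>i. r i > 0" "\<And>i. cball (a i) (r i) \<subseteq> \<Omega>" "\<Omega> = (\<Union>i. ball (a i) (r i))"
proof -
  define F where "F = {ball x r | x r. 0 < r \<and> cball x r \<subseteq> \<Omega>}"
  have "\<Union>F = \<Omega>"
  proof
    show "\<Union>F \<subseteq> \<Omega>" unfolding F_def using ball_subset_cball by blast
    show "\<Omega> \<subseteq> \<Union>F" 
    proof
      fix x assume "x \<in> \<Omega>"
      then obtain e where "e > 0" "cball x e \<subseteq> \<Omega>" using assms(1) open_contains_cball by metis
      then show "x \<in> \<Union>F" unfolding F_def by (intro UnionI[of "ball x e"]) auto
    qed
  qed
  moreover have "\<And>S. S \<in> F \<Longrightarrow> open S" unfolding F_def by auto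
  ultimately obtain F' where F': "F' \<subseteq> F" "countable F'" "\<Union>F' = \<Omega>" using Lindelof by metis
  have ne: "F' \<noteq> {}" using F'(3) assms(2) by auto
  have "\<forall>i. \<exists>p. from_nat_into F' i = ball (fst p) (snd p) \<and> 0 < snd p \<and> cball (fst p) (snd p) \<subseteq> \<Omega>"
  proof
    fix i
    have "from_nat_into F' i \<in> F" using from_nat_into[OF ne] F'(1) by auto
    then show "\<exists>p. from_nat_into F' i = ball (fst p) (snd p) \<and> 0 < snd p \<and> cball (fst p) (snd p) \<subseteq> \<Omega>"
      unfolding F_def by auto
  qed
  then obtain p where p: "\<And>i. from_nat_into F' i = ball (fst (p i)) (snd (p i)) \<and> 0 < snd (p i) \<and> cball (fst (p i)) (snd (p i)) \<subseteq> \<Omega>"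
    by metis
  have "(\<Union>i. ball (fst (p i)) (snd (p i))) = \<Union> (range (from_nat_into F'))" using p by auto
  also have "\<dots> = \<Omega>" using F' ne by (simp add: range_from_nat_into)
  finally have "\<Omega> = (\<Union>i. ball (fst (p i)) (snd (p i)))" by (rule sym)
  moreover have "0 < snd (p i)" "cball (fst (p i)) (snd (p i)) \<subseteq> \<Omega>" for i using p[of i] by blast+
  ultimately show ?thesis using that[of "\<lambda>i. snd (p i)" "\<lambda>i. fst (p i)"] by blast
qed

text \<open>If \<open>S\<close> sums the first \<open>j\<close> bumps of a countable cover by balls, then \<open>1 - exp (- j S)\<close> is
  again of class \<open>C\<^sup>1\<^sub>c\<close>, and it tends to \<open>1\<close> wherever some bump is positive, that is, on \<open>\<Omega>\<close>.\<close>

lemma cutoff_sequence: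
  fixes \<Omega> :: "(real^'n) set"
  assumes "open \<Omega>"
  obtains \<eta> :: "nat \<Rightarrow> real^'n \<Rightarrow> real" and D where "\<And>j. C1c \<Omega> (\<eta> j) (D j)" "\<And>j x. 0 \<le> \<eta> j x" "\<And>j x. \<eta> j x \<le> 1"
    "\<And>x. x \<in> \<Omega> \<Longrightarrow> (\<lambda>j. \<eta> j x) \<longlonglongrightarrow> 1"
proof (cases "\<Omega> = {}")
  case True
  show ?thesis by (rule that[of "\<lambda>_ _. 0" "\<lambda>_ _. 0"]) (auto simp: C1c_zero True)
next
  case False
  obtain a r where ar: "\<And>i. r i > 0" "\<And>i. cball (a i) (r i) \<subseteq> \<Omega>" "\<Omega> = (\<Union>i::nat. ball (a i) (r i))"
    using open_countable_ball_cover[OF assms False] by metis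
  define b where "b = (\<lambda>i x. (max 0 ((r i)\<^sup>2 - (x - a i) \<bullet> (x - a i)))\<^sup>2)"
  have "\<exists>D. C1c \<Omega> (b i) D" for i
    unfolding b_def by (rule C1c_bump[OF ar(1,2)[of i]]) (rule exI)
  then obtain E where E: "\<And>i. C1c \<Omega> (b i) (E i)" by metis
  define S where "S = (\<lambda>j x. \<Sum>i<j. b i x)"
  have S: "C1c \<Omega> (S j) (\<lambda>x. \<Sum>i<j. E i x)" for j unfolding S_def by (intro C1c_sum E) auto
  have b0: "b i x \<ge> 0" for i x unfolding b_def by simp
  have S0: "S j x \<ge> 0" for j x unfolding S_def by (intro sum_nonneg b0)
  define \<eta> where "\<eta> = (\<lambda>j x. 1 - exp (- (real j * S j x)))"
  have "C1c \<Omega> (\<eta> j) (\<lambda>x. (real j * exp (- (real j * S j x))) *\<^sub>R (\<Sum>i<j. E i x))" for j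
    unfolding \<eta>_def
    by (rule C1c_comp[where \<Psi>="\<lambda>s. 1 - exp (- (real j * s))" and \<psi>="\<lambda>s. real j * exp (- (real j * s))", OF S])
       (auto intro!: derivative_eq_intros continuous_intros)
  moreover have "0 \<le> \<eta> j x" "\<eta> j x \<le> 1" for j x unfolding \<eta>_def using S0 by auto
  moreover have "(\<lambda>j. \<eta> j x) \<longlonglongrightarrow> 1" if x: "x \<in> \<Omega>" for x
  proof -
    obtain i where i: "x \<in> ball (a i) (r i)" using ar(3) x by auto
    then have "norm (x - a i) < r i" by (simp add: dist_norm norm_minus_commute)
    then have "(norm (x - a i))\<^sup>2 < (r i)\<^sup>2" by (intro power_strict_mono) auto
    then have c: "b i x > 0" unfolding b_def by (simp add: dot_square_norm max_def)
    have lim: "(\<lambda>j. 1 - exp (- (real j * b i x))) \<longlonglongrightarrow> 1"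
    proof -
      have "filterlim (\<lambda>j. b i x * real j) at_top sequentially"
        by (rule filterlim_tendsto_pos_mult_at_top[OF tendsto_const c filterlim_real_sequentially])
      then have "(\<lambda>j. exp (- (b i x * real j))) \<longlonglongrightarrow> 0"
        by (intro filterlim_compose[OF exp_at_bot]) (simp add: filterlim_uminus_at_bot)
      from tendsto_diff[OF tendsto_const[of 1] this] show ?thesis by (simp add: mult.commute)
    qed
    show ?thesis
    proof (rule tendsto_sandwich[OF _ _ lim tendsto_const])
      show "\<forall>\<^sub>F j in sequentially. 1 - exp (- (real j * b i x)) \<le> \<eta> j x"
        using eventually_gt_at_top[of i]
      proof eventually_elim
        case (elim j)
        have "b i x \<le> S j x" unfolding S_def using elim b0 by (intro member_le_sum) auto
        then have "real j * b i x \<le> real j * S j x" by (intro mult_left_mono) auto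
        then show ?case unfolding \<eta>_def by simp
      qed
      show "\<forall>\<^sub>F j in sequentially. \<eta> j x \<le> 1" using S0 unfolding \<eta>_def by auto
    qed
  qed
  ultimately show ?thesis by (rule that)
qed

section \<open>A Nash inequality\<close>

lemma integrable_lborel_compact_support:
  fixes f :: "'a::euclidean_space \<Rightarrow> 'b::euclidean_space"
  assumes "continuous_on UNIV f" "compact K" "\<And>x. x \<notin> K \<Longrightarrow> f x = 0"
  shows "integrable lborel f"
proof -
  have "integrable lborel (\<lambda>x. indicator K x *\<^sub>R f x)"
    using assms(1,2) by (intro borel_integrable_compact) (auto intro: continuous_on_subset)
  also have "(\<lambda>x. indicator K x *\<^sub>R f x) = f" using assms(3) by (auto simp: fun_eq_iff indicator_def)
  finally show ?thesis .
qed

lemma integral_lborel_translate: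
  fixes f :: "'a::euclidean_space \<Rightarrow> real"
  assumes [measurable]: "f \<in> borel_measurable borel"
  shows "(\<integral>x. f (x + y) \<partial>lborel) = (\<integral>x. f x \<partial>lborel)"
proof -
  have "(\<integral>x. f x \<partial>lborel) = (\<integral>x. f x \<partial>distr lborel borel ((+) y))" by (simp add: lborel_distr_plus)
  also have "\<dots> = (\<integral>x. f (y + x) \<partial>lborel)" by (subst integral_distr) auto
  finally show ?thesis by (simp add: add.commute)
qed

lemma nn_integral_lborel_translate:
  fixes f :: "'a::euclidean_space \<Rightarrow> ennreal"
  assumes [measurable]: "f \<in> borel_measurable borel"
  shows "(\<integral>\<^sup>+x. f (x + y) \<partial>lborel) = (\<integral>\<^sup>+x. f x \<partial>lborel)"
proof -
  have "(\<integral>\<^sup>+x. f x \<partial>lborel) = (\<integral>\<^sup>+x. f x \<partial>distr lborel borel ((+) y))" by (simp add: lborel_distr_plus)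
  also have "\<dots> = (\<integral>\<^sup>+x. f (y + x) \<partial>lborel)" by (subst nn_integral_distr) auto
  finally show ?thesis by (simp add: add.commute)
qed

lemma C1c_measurable [measurable_dest]:
  assumes "C1c \<Omega> \<phi> D"
  shows "\<phi> \<in> borel_measurable borel" "D \<in> borel_measurable borel"
  using C1c_continuous[OF assms] assms unfolding C1c_def
  by (auto intro: borel_measurable_continuous_onI)

text \<open>By translation invariance the difference quotients of \<open>\<phi>\<close> have integral \<open>0\<close>; they converge
  boundedly, on a common bounded set, to the directional derivative.\<close>

lemma integral_directional_derivative_eq_0:
  fixes \<phi> :: "real^'n \<Rightarrow> real"
  assumes "C1c \<Omega> \<phi> D"
  shows "(\<integral>x. D x \<bullet> e \<partial>lborel) = 0"
proof -
  note [measurable] = C1c_measurable[OF assms]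
  obtain K where K: "compact K" "\<And>x. x \<notin> K \<Longrightarrow> \<phi> x = 0" using C1c_support[OF assms] by metis
  obtain B where B: "B > 0" "\<And>x. norm (D x) \<le> B" using C1c_bounded[OF assms] by metis
  obtain R where R: "\<And>x. x \<in> K \<Longrightarrow> norm x \<le> R"
    using compact_imp_bounded[OF K(1)] unfolding bounded_iff by auto
  have der: "(\<phi> has_derivative (\<lambda>h. h \<bullet> D x)) (at x)" for x
    using assms unfolding C1c_def gderiv_def by auto
  define q where "q = (\<lambda>k x. (\<phi> (x + inverse (real (Suc k)) *\<^sub>R e) - \<phi> x) * real (Suc k))"
  have [measurable]: "q k \<in> borel_measurable borel" for k unfolding q_def by measurable
  have int: "integrable lborel \<phi>" using integrable_lborel_compact_support[OF C1c_continuous[OF assms] K] .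
  have q0: "(\<integral>x. q k x \<partial>lborel) = 0" for k
  proof -
    have "integrable lborel (\<lambda>x. \<phi> (x + inverse (real (Suc k)) *\<^sub>R e))"
    proof (rule integrable_lborel_compact_support[of _ "(\<lambda>x. x - inverse (real (Suc k)) *\<^sub>R e) ` K"])
      show "continuous_on UNIV (\<lambda>x. \<phi> (x + inverse (real (Suc k)) *\<^sub>R e))"
        by (intro continuous_on_compose2[OF C1c_continuous[OF assms]] continuous_intros) auto
      show "compact ((\<lambda>x. x - inverse (real (Suc k)) *\<^sub>R e) ` K)"
        by (intro compact_continuous_image continuous_intros K)
      fix x assume "x \<notin> (\<lambda>x. x - inverse (real (Suc k)) *\<^sub>R e) ` K"
      then have "x + inverse (real (Suc k)) *\<^sub>R e \<notin> K" by (metis add_diff_cancel_right' image_eqI)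
      then show "\<phi> (x + inverse (real (Suc k)) *\<^sub>R e) = 0" by (rule K(2))
    qed
    then show ?thesis unfolding q_def using int integral_lborel_translate[OF C1c_measurable(1)[OF assms], of "inverse (real (Suc k)) *\<^sub>R e"]
      by simp
  qed
  have "(\<lambda>k. \<integral>x. q k x \<partial>lborel) \<longlonglongrightarrow> (\<integral>x. D x \<bullet> e \<partial>lborel)"
  proof (rule integral_dominated_convergence[where w="\<lambda>x. B * norm e * indicator (cball 0 (R + norm e)) x"])
    show "integrable lborel (\<lambda>x. B * norm e * indicator (cball 0 (R + norm e)) (x::real^'n) :: real)"
      by (intro integrable_mult_right integrable_real_indicator) (use emeasure_lborel_cball_finite[of "0::real^'n"] in \<open>auto simp: less_top[symmetric]\<close>)
    show "AE x in lborel. (\<lambda>k. q k x) \<longlonglongrightarrow> D x \<bullet> e"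
    proof (rule AE_I2)
      fix x
      have "((\<lambda>t. \<phi> (x + t *\<^sub>R e)) has_derivative (\<lambda>t. (t *\<^sub>R e) \<bullet> D x)) (at 0)"
      proof (rule has_derivative_compose[where g=\<phi> and f="\<lambda>t. x + t *\<^sub>R e", THEN has_derivative_eq_rhs])
        show "((\<lambda>t. x + t *\<^sub>R e) has_derivative (\<lambda>t. t *\<^sub>R e)) (at 0)" by (auto intro!: derivative_eq_intros)
        show "(\<phi> has_derivative (\<lambda>h. h \<bullet> D x)) (at (x + 0 *\<^sub>R e))" using der by simp
      qed simp
      then have "((\<lambda>t. \<phi> (x + t *\<^sub>R e)) has_real_derivative (D x \<bullet> e)) (at 0)"
        unfolding has_field_derivative_def
        by (rule has_derivative_eq_rhs) (auto simp: fun_eq_iff inner_commute mult.commute)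
      then have "(\<lambda>h. (\<phi> (x + h *\<^sub>R e) - \<phi> x) / h) \<midarrow>0\<rightarrow> D x \<bullet> e" unfolding DERIV_def by simp
      then have "(\<lambda>k. (\<phi> (x + inverse (real (Suc k)) *\<^sub>R e) - \<phi> x) / inverse (real (Suc k))) \<longlonglongrightarrow> D x \<bullet> e"
        by (rule filterlim_compose) (rule filterlim_atI[OF LIMSEQ_inverse_real_of_nat], simp)
      then show "(\<lambda>k. q k x) \<longlonglongrightarrow> D x \<bullet> e" unfolding q_def by (simp add: divide_inverse)
    qed
    show "AE x in lborel. norm (q k x) \<le> B * norm e * indicator (cball 0 (R + norm e)) x" for k
    proof (rule AE_I2)
      fix x
      let ?s = "inverse (real (Suc k))"
      have s: "0 < ?s" "?s \<le> 1" by (auto simp: field_simps)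
      have ns: "norm (?s *\<^sub>R e) \<le> norm e" using s by (simp add: mult_left_le_one_le del: of_nat_Suc)
      have "norm (\<phi> (x + ?s *\<^sub>R e) - \<phi> x) \<le> B * norm ((x + ?s *\<^sub>R e) - x)"
      proof (rule differentiable_bound[OF convex_UNIV der])
        fix z
        show "onorm (\<lambda>h. h \<bullet> D z) \<le> B"
        proof (rule onorm_le)
          fix h have "\<bar>h \<bullet> D z\<bar> \<le> norm h * norm (D z)" by (rule Cauchy_Schwarz_ineq2)
          also have "\<dots> \<le> norm h * B" using B by (intro mult_left_mono) auto
          finally show "norm (h \<bullet> D z) \<le> B * norm h" by (simp add: mult.commute)
        qed
      qed auto
      then have "\<bar>\<phi> (x + ?s *\<^sub>R e) - \<phi> x\<bar> * real (Suc k) \<le> (B * (?s * norm e)) * real (Suc k)"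
        using s by (intro mult_right_mono) (auto simp del: of_nat_Suc)
      also have "\<dots> = B * norm e" by (simp del: of_nat_Suc)
      finally have "\<bar>q k x\<bar> \<le> B * norm e" unfolding q_def by (simp add: abs_mult del: of_nat_Suc)
      moreover have "q k x = 0" if "norm x > R + norm e"
      proof -
        have "norm x \<le> norm (x + ?s *\<^sub>R e) + norm (?s *\<^sub>R e)" by (metis add_diff_cancel_right' norm_triangle_ineq4)
        then have "norm (x + ?s *\<^sub>R e) > R" using that ns by linarith
        moreover have "norm x > R" using that norm_ge_zero[of e] by linarith
        ultimately have "x \<notin> K" "x + ?s *\<^sub>R e \<notin> K" using R by force+
        then show ?thesis unfolding q_def using K(2) by simp
      qed
      ultimately show "norm (q k x) \<le> B * norm e * indicator (cball 0 (R + norm e)) x"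
        by (auto simp: indicator_def)
    qed
  qed (measurable)
  then show ?thesis using q0 LIMSEQ_unique by (simp add: LIMSEQ_const_iff)
qed

text \<open>The increment \<open>\<phi>(x + y) - \<phi>(x)\<close> is the integral of \<open>\<nabla>\<phi> \<bullet> y\<close> along a segment.  Squaring it and
  integrating in \<open>x\<close> first, translation invariance makes the inner integral independent of the
  position on the segment.\<close>

lemma translation_estimate:
  assumes "C1c \<Omega> \<phi> D"
  shows "(\<integral>\<^sup>+x. ennreal ((\<phi> (x + y) - \<phi> x)\<^sup>2) \<partial>lborel) \<le> ennreal ((norm y)\<^sup>2) * (\<integral>\<^sup>+x. ennreal ((norm (D x))\<^sup>2) \<partial>lborel)"
proof -
  note [measurable] = C1c_measurable[OF assms]
  have der: "(\<phi> has_derivative (\<lambda>h. h \<bullet> D x)) (at x)" for x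
    using assms unfolding C1c_def gderiv_def by auto
  have contD: "continuous_on UNIV D" using assms unfolding C1c_def by auto
  let ?N = "\<lambda>x t. ennreal ((norm (D (x + t *\<^sub>R y)))\<^sup>2) * indicator {0..1::real} t"
  have pt: "ennreal ((\<phi> (x + y) - \<phi> x)\<^sup>2) \<le> ennreal ((norm y)\<^sup>2) * (\<integral>\<^sup>+t. ?N x t \<partial>lborel)" for x
  proof -
    define c where "c = \<phi> (x + y) - \<phi> x"
    define g where "g = (\<lambda>t. D (x + t *\<^sub>R y) \<bullet> y)"
    have contg: "continuous_on A g" for A unfolding g_def
      by (intro continuous_intros continuous_on_compose2[OF contD]) auto
    have "((\<lambda>t. \<phi> (x + t *\<^sub>R y)) has_real_derivative g t) (at t)" for t
    proof -
      have "((\<lambda>t. \<phi> (x + t *\<^sub>R y)) has_derivative (\<lambda>s. (s *\<^sub>R y) \<bullet> D (x + t *\<^sub>R y))) (at t)"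
      proof (rule has_derivative_compose[where g=\<phi> and f="\<lambda>t. x + t *\<^sub>R y", THEN has_derivative_eq_rhs])
        show "((\<lambda>t. x + t *\<^sub>R y) has_derivative (\<lambda>t. t *\<^sub>R y)) (at t)" by (auto intro!: derivative_eq_intros)
      qed (use der in auto)
      then show ?thesis unfolding g_def has_field_derivative_def
        by (rule has_derivative_eq_rhs) (auto simp: fun_eq_iff inner_commute mult.commute)
    qed
    then have "(g has_integral (\<phi> (x + 1 *\<^sub>R y) - \<phi> (x + 0 *\<^sub>R y))) {0..1}"
      by (intro fundamental_theorem_of_calculus)
         (auto simp: has_real_derivative_iff_has_vector_derivative[symmetric] intro: has_field_derivative_at_within)
    then have gc: "(g has_integral c) {0..1}" unfolding c_def by simp
    obtain J where J: "((\<lambda>t. (g t)\<^sup>2) has_integral J) {0..1}"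
      using integrable_continuous_real[of 0 1 "\<lambda>t. (g t)\<^sup>2"] contg by (auto intro!: continuous_intros simp: integrable_on_def)
    \<comment> \<open>The integrand is \<open>(g - c)\<^sup>2\<close> with \<open>c\<close> the mean of \<open>g\<close>: this is Jensen's inequality \<open>c\<^sup>2 \<le> J\<close>.\<close>
    have "((\<lambda>t. (g t)\<^sup>2 - 2 * c * g t + c\<^sup>2) has_integral (J - 2 * c * c + (1 - 0) *\<^sub>R c\<^sup>2)) {0..1}"
      using has_integral_const_real[of "c\<^sup>2" 0 1]
      by (intro has_integral_add has_integral_diff J has_integral_mult_right gc) auto
    then have "0 \<le> J - 2 * c * c + (1 - 0) *\<^sub>R c\<^sup>2"
    proof (rule has_integral_nonneg)
      fix t have "0 \<le> (g t - c)\<^sup>2" by simp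
      then show "0 \<le> (g t)\<^sup>2 - 2 * c * g t + c\<^sup>2" by (simp add: power2_diff mult_ac)
    qed
    then have cJ: "c\<^sup>2 \<le> J" by (simp add: power2_eq_square)
    have "ennreal (c\<^sup>2) \<le> ennreal J" using cJ by (rule ennreal_leI)
    also have "ennreal J = (\<integral>\<^sup>+t. ennreal ((g t)\<^sup>2) * indicator {0..1} t \<partial>lborel)"
      by (rule nn_integral_has_integral_lebesgue'[symmetric, OF _ J]) simp
    also have "\<dots> \<le> (\<integral>\<^sup>+t. ennreal ((norm y)\<^sup>2) * ?N x t \<partial>lborel)"
    proof (rule nn_integral_mono)
      fix t
      have "\<bar>g t\<bar> \<le> norm (D (x + t *\<^sub>R y)) * norm y" unfolding g_def by (rule Cauchy_Schwarz_ineq2)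
      then have "(g t)\<^sup>2 \<le> (norm (D (x + t *\<^sub>R y)) * norm y)\<^sup>2" by (rule abs_le_square_iff[THEN iffD1, OF order_trans]) simp
      then have "ennreal ((g t)\<^sup>2) \<le> ennreal ((norm y)\<^sup>2) * ennreal ((norm (D (x + t *\<^sub>R y)))\<^sup>2)"
        by (simp add: power_mult_distrib ennreal_mult[symmetric] mult.commute ennreal_leI)
      then show "ennreal ((g t)\<^sup>2) * indicator {0..1} t \<le> ennreal ((norm y)\<^sup>2) * ?N x t"
        by (auto simp: indicator_def)
    qed
    also have "\<dots> = ennreal ((norm y)\<^sup>2) * (\<integral>\<^sup>+t. ?N x t \<partial>lborel)"
      by (rule nn_integral_cmult) measurable
    finally show ?thesis unfolding c_def .
  qed
  have "(\<integral>\<^sup>+x. ennreal ((\<phi> (x + y) - \<phi> x)\<^sup>2) \<partial>lborel) \<le> (\<integral>\<^sup>+x. ennreal ((norm y)\<^sup>2) * (\<integral>\<^sup>+t. ?N x t \<partial>lborel) \<partial>lborel)"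
    by (intro nn_integral_mono pt)
  also have "\<dots> = ennreal ((norm y)\<^sup>2) * (\<integral>\<^sup>+x. (\<integral>\<^sup>+t. ?N x t \<partial>lborel) \<partial>lborel)"
    by (rule nn_integral_cmult) measurable
  also have "(\<integral>\<^sup>+x. (\<integral>\<^sup>+t. ?N x t \<partial>lborel) \<partial>lborel) = (\<integral>\<^sup>+t. (\<integral>\<^sup>+x. ?N x t \<partial>lborel) \<partial>lborel)"
    by (rule lborel_pair.Fubini'[symmetric]) measurable
  also have "\<dots> = (\<integral>\<^sup>+t. (\<integral>\<^sup>+x. ennreal ((norm (D x))\<^sup>2) \<partial>lborel) * indicator {0..1::real} t \<partial>lborel)"
  proof (rule nn_integral_cong)
    fix t
    have "(\<integral>\<^sup>+x. ?N x t \<partial>lborel) = (\<integral>\<^sup>+x. ennreal ((norm (D (x + t *\<^sub>R y)))\<^sup>2) \<partial>lborel) * indicator {0..1} t"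
      by (rule nn_integral_multc) measurable
    also have "(\<integral>\<^sup>+x. ennreal ((norm (D (x + t *\<^sub>R y)))\<^sup>2) \<partial>lborel) = (\<integral>\<^sup>+x. ennreal ((norm (D x))\<^sup>2) \<partial>lborel)"
      by (rule nn_integral_lborel_translate) measurable
    finally show "(\<integral>\<^sup>+x. ?N x t \<partial>lborel) = (\<integral>\<^sup>+x. ennreal ((norm (D x))\<^sup>2) \<partial>lborel) * indicator {0..1} t" .
  qed
  also have "\<dots> = (\<integral>\<^sup>+x. ennreal ((norm (D x))\<^sup>2) \<partial>lborel)"
    by (subst nn_integral_cmult_indicator) auto
  finally show ?thesis .
qed

text \<open>Expanding the square in the translation estimate bounds \<open>2\<integral>\<phi>\<^sup>2 - r\<^sup>2\<integral>|\<nabla>\<phi>|\<^sup>2\<close> by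
  \<open>2\<integral>|\<phi>(x + y)| |\<phi>(x)| dx\<close> for every \<open>|y| < r\<close>; averaging over the ball of radius \<open>r\<close> turns the
  right-hand side into at most \<open>2(\<integral>|\<phi>|)\<^sup>2\<close> divided by its volume.  For a function that lives on a
  small set this inequality yields the gain in measure that truncation arguments usually take
  from the Sobolev inequality, and, unlike a bound in terms of the support, it passes to limits
  in \<open>W\<^sup>1\<^sup>,\<^sup>2\<close>.\<close>

lemma nash_inequality_C1c:
  fixes \<phi> :: "real^'n \<Rightarrow> real"
  assumes "C1c \<Omega> \<phi> D" "r > 0"
  shows "(\<integral>x. (\<phi> x)\<^sup>2 \<partial>lborel) \<le> r\<^sup>2 / 2 * (\<integral>x. (norm (D x))\<^sup>2 \<partial>lborel)
     + (\<integral>x. \<bar>\<phi> x\<bar> \<partial>lborel)\<^sup>2 / measure lborel (ball (0::real^'n) r)"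
proof -
  note [measurable] = C1c_measurable[OF assms(1)]
  have cont: "continuous_on UNIV \<phi>" "continuous_on UNIV D"
    using C1c_continuous[OF assms(1)] assms(1) unfolding C1c_def by auto
  obtain K where K: "compact K" "\<And>x. x \<notin> K \<Longrightarrow> \<phi> x = 0" "\<And>x. x \<notin> K \<Longrightarrow> D x = 0"
    using C1c_support[OF assms(1)] by metis
  have i2: "integrable lborel (\<lambda>x. (\<phi> x)\<^sup>2)"
    by (rule integrable_lborel_compact_support[OF _ K(1)]) (auto intro!: continuous_intros cont simp: K)
  have i1: "integrable lborel (\<lambda>x. \<bar>\<phi> x\<bar>)"
    by (rule integrable_lborel_compact_support[OF _ K(1)]) (auto intro!: continuous_intros cont simp: K)
  have iD: "integrable lborel (\<lambda>x. (norm (D x))\<^sup>2)"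
    by (rule integrable_lborel_compact_support[OF _ K(1)]) (auto intro!: continuous_intros cont simp: K)
  define S where "S = (\<integral>x. (\<phi> x)\<^sup>2 \<partial>lborel)"
  define A where "A = (\<integral>x. (norm (D x))\<^sup>2 \<partial>lborel)"
  define L where "L = (\<integral>x. \<bar>\<phi> x\<bar> \<partial>lborel)"
  define V where "V = measure lborel (ball (0::real^'n) r)"
  have V: "V > 0" unfolding V_def using content_ball_pos[OF assms(2)] by simp
  have pos: "S \<ge> 0" "A \<ge> 0" "L \<ge> 0" unfolding S_def A_def L_def by (auto intro!: integral_nonneg_AE)
  have eV: "emeasure lborel (ball (0::real^'n) r) = ennreal V"
    unfolding V_def using emeasure_lborel_ball_finite[of "0::real^'n" r] by (intro emeasure_eq_ennreal_measure) auto
  have nL: "(\<integral>\<^sup>+x. ennreal \<bar>\<phi> x\<bar> \<partial>lborel) = ennreal L" unfolding L_def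
    by (rule nn_integral_eq_integral[OF i1]) auto
  have nD: "(\<integral>\<^sup>+x. ennreal ((norm (D x))\<^sup>2) \<partial>lborel) = ennreal A" unfolding A_def
    by (rule nn_integral_eq_integral[OF iD]) auto
  let ?P = "\<lambda>x y. ennreal \<bar>\<phi> (x + y)\<bar> * ennreal \<bar>\<phi> x\<bar>"
  have one: "ennreal (2 * S - r\<^sup>2 * A) \<le> 2 * (\<integral>\<^sup>+x. ?P x y \<partial>lborel)" if "y \<in> ball 0 r" for y
  proof -
    have nS: "(\<integral>\<^sup>+x. ennreal ((\<phi> x)\<^sup>2) \<partial>lborel) = ennreal S" unfolding S_def
      by (rule nn_integral_eq_integral[OF i2]) auto
    have nS': "(\<integral>\<^sup>+x. ennreal ((\<phi> (x + y))\<^sup>2) \<partial>lborel) = ennreal S"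
      using nn_integral_lborel_translate[of "\<lambda>x. ennreal ((\<phi> x)\<^sup>2)" y] nS by simp
    have "ennreal S + ennreal S = (\<integral>\<^sup>+x. ennreal ((\<phi> (x + y))\<^sup>2) + ennreal ((\<phi> x)\<^sup>2) \<partial>lborel)"
      by (subst nn_integral_add) (auto simp: nS nS')
    also have "\<dots> \<le> (\<integral>\<^sup>+x. ennreal ((\<phi> (x + y) - \<phi> x)\<^sup>2) + 2 * ?P x y \<partial>lborel)"
    proof (rule nn_integral_mono)
      fix x
      have "(\<phi> (x + y))\<^sup>2 + (\<phi> x)\<^sup>2 = (\<phi> (x + y) - \<phi> x)\<^sup>2 + 2 * (\<phi> (x + y) * \<phi> x)"
        by (simp add: power2_diff)
      also have "\<dots> \<le> (\<phi> (x + y) - \<phi> x)\<^sup>2 + 2 * (\<bar>\<phi> (x + y)\<bar> * \<bar>\<phi> x\<bar>)" 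
        using abs_ge_self[of "\<phi> (x + y) * \<phi> x"] by (simp add: abs_mult)
      finally have "ennreal ((\<phi> (x + y))\<^sup>2 + (\<phi> x)\<^sup>2) \<le> ennreal ((\<phi> (x + y) - \<phi> x)\<^sup>2 + 2 * (\<bar>\<phi> (x + y)\<bar> * \<bar>\<phi> x\<bar>))"
        by (rule ennreal_leI)
      then show "ennreal ((\<phi> (x + y))\<^sup>2) + ennreal ((\<phi> x)\<^sup>2) \<le> ennreal ((\<phi> (x + y) - \<phi> x)\<^sup>2) + 2 * ?P x y"
        by (simp add: ennreal_mult)
    qed
    also have "\<dots> = (\<integral>\<^sup>+x. ennreal ((\<phi> (x + y) - \<phi> x)\<^sup>2) \<partial>lborel) + 2 * (\<integral>\<^sup>+x. ?P x y \<partial>lborel)"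
      by (subst nn_integral_add) (auto simp: nn_integral_cmult)
    also have "\<dots> \<le> ennreal (r\<^sup>2 * A) + 2 * (\<integral>\<^sup>+x. ?P x y \<partial>lborel)"
    proof (rule add_right_mono)
      have "(norm y)\<^sup>2 \<le> r\<^sup>2" using that by (intro power_mono) auto
      then have "(norm y)\<^sup>2 * A \<le> r\<^sup>2 * A" using pos by (intro mult_right_mono) auto
      then show "(\<integral>\<^sup>+x. ennreal ((\<phi> (x + y) - \<phi> x)\<^sup>2) \<partial>lborel) \<le> ennreal (r\<^sup>2 * A)"
        using translation_estimate[OF assms(1), of y] pos unfolding nD
        by (auto simp: ennreal_mult[symmetric] intro: order_trans ennreal_leI)
    qed
    finally have "ennreal S + ennreal S \<le> ennreal (r\<^sup>2 * A) + 2 * (\<integral>\<^sup>+x. ?P x y \<partial>lborel)" .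
    moreover have "ennreal (2 * S - r\<^sup>2 * A) = (ennreal S + ennreal S) - ennreal (r\<^sup>2 * A)"
      using pos by (simp add: ennreal_minus ennreal_plus[symmetric] del: ennreal_plus)
    ultimately show ?thesis by (simp add: ennreal_minus_le_iff)
  qed
  have "ennreal (2 * S - r\<^sup>2 * A) * ennreal V = (\<integral>\<^sup>+y. ennreal (2 * S - r\<^sup>2 * A) * indicator (ball 0 r) (y::real^'n) \<partial>lborel)"
    by (subst nn_integral_cmult_indicator) (auto simp: eV)
  also have "\<dots> \<le> (\<integral>\<^sup>+y. 2 * (\<integral>\<^sup>+x. ?P x y \<partial>lborel) \<partial>lborel)"
    using one by (intro nn_integral_mono) (auto simp: indicator_def)
  also have "\<dots> = 2 * (\<integral>\<^sup>+y. (\<integral>\<^sup>+x. ?P x y \<partial>lborel) \<partial>lborel)"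
    by (rule nn_integral_cmult) measurable
  also have "(\<integral>\<^sup>+y. (\<integral>\<^sup>+x. ?P x y \<partial>lborel) \<partial>lborel) = (\<integral>\<^sup>+x. (\<integral>\<^sup>+y. ?P x y \<partial>lborel) \<partial>lborel)"
    by (rule lborel_pair.Fubini'[symmetric]) measurable
  also have "\<dots> = (\<integral>\<^sup>+x. ennreal L * ennreal \<bar>\<phi> x\<bar> \<partial>lborel)"
  proof (rule nn_integral_cong)
    fix x
    have "(\<integral>\<^sup>+y. ?P x y \<partial>lborel) = (\<integral>\<^sup>+y. ennreal \<bar>\<phi> (x + y)\<bar> \<partial>lborel) * ennreal \<bar>\<phi> x\<bar>"
      by (rule nn_integral_multc) measurable
    also have "(\<integral>\<^sup>+y. ennreal \<bar>\<phi> (x + y)\<bar> \<partial>lborel) = ennreal L"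
      using nn_integral_lborel_translate[of "\<lambda>z. ennreal \<bar>\<phi> z\<bar>" x] nL by (simp add: add.commute)
    finally show "(\<integral>\<^sup>+y. ?P x y \<partial>lborel) = ennreal L * ennreal \<bar>\<phi> x\<bar>" .
  qed
  also have "\<dots> = ennreal L * ennreal L" by (subst nn_integral_cmult) (auto simp: nL)
  finally have "ennreal (2 * S - r\<^sup>2 * A) * ennreal V \<le> 2 * (ennreal L * ennreal L)" .
  then have "ennreal ((2 * S - r\<^sup>2 * A) * V) \<le> ennreal (2 * (L * L))"
    using pos V by (simp add: ennreal_mult ennreal_mult'')
  then have "(2 * S - r\<^sup>2 * A) * V \<le> 2 * (L * L)" using pos by (simp add: ennreal_le_iff)
  then have "2 * S - r\<^sup>2 * A \<le> 2 * (L * L) / V" using V by (simp add: pos_le_divide_eq)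
  then show ?thesis using V unfolding S_def[symmetric] A_def[symmetric] L_def[symmetric] V_def[symmetric]
    by (simp add: power2_eq_square)
qed

section \<open>Square-integrable functions and \<open>W\<^sup>1\<^sup>,\<^sup>2\<^sub>0\<close>\<close>

definition square_integrable :: "'a measure \<Rightarrow> ('a \<Rightarrow> 'b::euclidean_space) \<Rightarrow> bool" where
  "square_integrable M f \<longleftrightarrow> f \<in> borel_measurable M \<and> integrable M (\<lambda>x. (norm (f x))\<^sup>2)"

lemma square_integrable_measurable: "square_integrable M f \<Longrightarrow> f \<in> borel_measurable M"
  by (simp add: square_integrable_def)

lemma square_integrable_bound:
  fixes f :: "'a \<Rightarrow> 'b::euclidean_space" and g :: "'a \<Rightarrow> 'c::euclidean_space"
  assumes [measurable]: "f \<in> borel_measurable M"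
    and g: "square_integrable M g" and le: "AE x in M. norm (f x) \<le> C * norm (g x)"
  shows "square_integrable M f"
  unfolding square_integrable_def
proof
  have "integrable M (\<lambda>x. C\<^sup>2 * (norm (g x))\<^sup>2)" using g unfolding square_integrable_def by auto
  then show "integrable M (\<lambda>x. (norm (f x))\<^sup>2)"
  proof (rule Bochner_Integration.integrable_bound)
    show "AE x in M. norm ((norm (f x))\<^sup>2) \<le> norm (C\<^sup>2 * (norm (g x))\<^sup>2)"
      using le
    proof eventually_elim
      case (elim x)
      then have "(norm (f x))\<^sup>2 \<le> (C * norm (g x))\<^sup>2" by (intro power_mono) auto
      then show ?case by (simp add: power_mult_distrib)
    qed
  qed measurable
qed fact

lemma norm_add_power2_le: "(norm (a + b))\<^sup>2 \<le> 2 * (norm a)\<^sup>2 + 2 * (norm (b::'a::real_normed_vector))\<^sup>2"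
proof -
  have "(norm (a + b))\<^sup>2 \<le> (norm a + norm b)\<^sup>2" by (intro power_mono norm_triangle_ineq) auto
  also have "\<dots> \<le> 2 * (norm a)\<^sup>2 + 2 * (norm b)\<^sup>2"
    using sum_squares_bound[of "norm a" "norm b"] by (simp add: power2_sum)
  finally show ?thesis .
qed

lemma square_integrable_add:
  assumes "square_integrable M f" "square_integrable M g"
  shows "square_integrable M (\<lambda>x. f x + g x)"
  unfolding square_integrable_def
proof
  have [measurable]: "f \<in> borel_measurable M" "g \<in> borel_measurable M" using assms unfolding square_integrable_def by auto
  show "(\<lambda>x. f x + g x) \<in> borel_measurable M" by measurable
  have "integrable M (\<lambda>x. 2 * (norm (f x))\<^sup>2 + 2 * (norm (g x))\<^sup>2)" using assms unfolding square_integrable_def by auto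
  then show "integrable M (\<lambda>x. (norm (f x + g x))\<^sup>2)"
    by (rule Bochner_Integration.integrable_bound) (auto intro: norm_add_power2_le)
qed

lemma square_integrable_scaleR:
  assumes "square_integrable M f" shows "square_integrable M (\<lambda>x. c *\<^sub>R f x)"
  by (rule square_integrable_bound[OF _ assms, where C="\<bar>c\<bar>"]) (use assms in \<open>auto simp: square_integrable_def\<close>)

lemma square_integrable_diff:
  assumes "square_integrable M f" "square_integrable M g"
  shows "square_integrable M (\<lambda>x. f x - g x)"
  using square_integrable_add[OF assms(1) square_integrable_scaleR[OF assms(2), of "-1"]] by simp

lemma integrable_norm_mult:
  fixes f :: "'a \<Rightarrow> 'b::euclidean_space" and g :: "'a \<Rightarrow> 'c::euclidean_space"
  assumes "square_integrable M f" "square_integrable M g"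
  shows "integrable M (\<lambda>x. norm (f x) * norm (g x))"
proof (rule Bochner_Integration.integrable_bound)
  have [measurable]: "f \<in> borel_measurable M" "g \<in> borel_measurable M" using assms unfolding square_integrable_def by auto
  show "integrable M (\<lambda>x. (norm (f x))\<^sup>2 + (norm (g x))\<^sup>2)" using assms unfolding square_integrable_def by auto
  show "AE x in M. norm (norm (f x) * norm (g x)) \<le> norm ((norm (f x))\<^sup>2 + (norm (g x))\<^sup>2)"
  proof (rule AE_I2)
    fix x
    have "2 * norm (f x) * norm (g x) \<le> (norm (f x))\<^sup>2 + (norm (g x))\<^sup>2" by (rule sum_squares_bound)
    moreover have "norm (f x) * norm (g x) \<ge> 0" by simp
    ultimately have "norm (f x) * norm (g x) \<le> (norm (f x))\<^sup>2 + (norm (g x))\<^sup>2" by linarith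
    then show "norm (norm (f x) * norm (g x)) \<le> norm ((norm (f x))\<^sup>2 + (norm (g x))\<^sup>2)" by simp
  qed
  show "(\<lambda>x. norm (f x) * norm (g x)) \<in> borel_measurable M" by measurable
qed

lemma integrable_inner:
  fixes f g :: "'a \<Rightarrow> 'b::euclidean_space"
  assumes "square_integrable M f" "square_integrable M g"
  shows "integrable M (\<lambda>x. f x \<bullet> g x)"
proof (rule Bochner_Integration.integrable_bound[OF integrable_norm_mult[OF assms]])
  have [measurable]: "f \<in> borel_measurable M" "g \<in> borel_measurable M" using assms unfolding square_integrable_def by auto
  show "(\<lambda>x. f x \<bullet> g x) \<in> borel_measurable M" by measurable
  show "AE x in M. norm (f x \<bullet> g x) \<le> norm (norm (f x) * norm (g x))"
    by (auto intro: Cauchy_Schwarz_ineq2)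
qed

lemma Cauchy_Schwarz_integral:
  fixes f :: "'a \<Rightarrow> 'b::euclidean_space" and g :: "'a \<Rightarrow> 'c::euclidean_space"
  assumes f: "square_integrable M f" and g: "square_integrable M g"
  shows "(\<integral>x. norm (f x) * norm (g x) \<partial>M)\<^sup>2 \<le> (\<integral>x. (norm (f x))\<^sup>2 \<partial>M) * (\<integral>x. (norm (g x))\<^sup>2 \<partial>M)"
proof -
  define A where "A = (\<integral>x. (norm (f x))\<^sup>2 \<partial>M)"
  define B where "B = (\<integral>x. (norm (g x))\<^sup>2 \<partial>M)"
  define C where "C = (\<integral>x. norm (f x) * norm (g x) \<partial>M)"
  note int = integrable_norm_mult[OF f g]
  have i2: "integrable M (\<lambda>x. (norm (f x))\<^sup>2)" "integrable M (\<lambda>x. (norm (g x))\<^sup>2)"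
    using f g unfolding square_integrable_def by auto
  have B0: "B \<ge> 0" unfolding B_def by (intro integral_nonneg_AE) auto
  \<comment> \<open>The integral expands to \<open>B (A B - C\<^sup>2)\<close>.\<close>
  have "0 \<le> (\<integral>x. (B * norm (f x) - C * norm (g x))\<^sup>2 \<partial>M)" by (intro integral_nonneg_AE) auto
  also have "(\<lambda>x. (B * norm (f x) - C * norm (g x))\<^sup>2) =
      (\<lambda>x. B\<^sup>2 * (norm (f x))\<^sup>2 - 2 * B * C * (norm (f x) * norm (g x)) + C\<^sup>2 * (norm (g x))\<^sup>2)"
    by (simp add: power2_diff power_mult_distrib mult_ac fun_eq_iff)
  also have "(\<integral>x. (B\<^sup>2 * (norm (f x))\<^sup>2 - 2 * B * C * (norm (f x) * norm (g x)) + C\<^sup>2 * (norm (g x))\<^sup>2) \<partial>M)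
      = B\<^sup>2 * A - 2 * B * C * C + C\<^sup>2 * B"
    using int i2 unfolding A_def B_def C_def by simp
  also have "\<dots> = B * (A * B - C\<^sup>2)" by (simp add: power2_eq_square algebra_simps)
  finally have 1: "0 \<le> B * (A * B - C\<^sup>2)" .
  have "C\<^sup>2 \<le> A * B"
  proof (cases "B = 0")
    case True
    then have "AE x in M. (norm (g x))\<^sup>2 = 0" using integral_nonneg_eq_0_iff_AE[OF i2(2)] unfolding B_def by auto
    then have "AE x in M. norm (f x) * norm (g x) = 0" by eventually_elim auto
    then have "C = 0" unfolding C_def by (rule integral_eq_zero_AE)
    then show ?thesis using True by simp
  next
    case False
    then show ?thesis using 1 B0 by (simp add: zero_le_mult_iff)
  qed
  then show ?thesis unfolding A_def B_def C_def .
qed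

lemma Cauchy_Schwarz_integral_sqrt:
  fixes f :: "'a \<Rightarrow> 'b::euclidean_space" and g :: "'a \<Rightarrow> 'c::euclidean_space"
  assumes "square_integrable M f" and "square_integrable M g"
  shows "(\<integral>x. norm (f x) * norm (g x) \<partial>M) \<le> sqrt (\<integral>x. (norm (f x))\<^sup>2 \<partial>M) * sqrt (\<integral>x. (norm (g x))\<^sup>2 \<partial>M)"
  using real_le_rsqrt[OF Cauchy_Schwarz_integral[OF assms]] by (simp add: real_sqrt_mult)

definition L2_converges :: "'a measure \<Rightarrow> (nat \<Rightarrow> 'a \<Rightarrow> 'b::euclidean_space) \<Rightarrow> ('a \<Rightarrow> 'b) \<Rightarrow> bool" where
  "L2_converges M F f \<longleftrightarrow> (\<forall>k. square_integrable M (F k)) \<and> square_integrable M f \<and>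
     (\<lambda>k. \<integral>x. (norm (F k x - f x))\<^sup>2 \<partial>M) \<longlonglongrightarrow> 0"

lemma L2_convergesD:
  assumes "L2_converges M F f"
  shows "square_integrable M (F k)" "square_integrable M f" "square_integrable M (\<lambda>x. F k x - f x)"
    "(\<lambda>k. \<integral>x. (norm (F k x - f x))\<^sup>2 \<partial>M) \<longlonglongrightarrow> 0"
  using assms unfolding L2_converges_def by (auto intro: square_integrable_diff)

lemma L2_converges_inner:
  assumes "L2_converges M F f" "square_integrable M g"
  shows "(\<lambda>k. \<integral>x. F k x \<bullet> g x \<partial>M) \<longlonglongrightarrow> (\<integral>x. f x \<bullet> g x \<partial>M)"
proof -
  have F: "square_integrable M (F k)" and f: "square_integrable M f"
    and lim: "(\<lambda>k. \<integral>x. (norm (F k x - f x))\<^sup>2 \<partial>M) \<longlonglongrightarrow> 0" for k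
    using assms(1) unfolding L2_converges_def by auto
  note d = square_integrable_diff[OF F f]
  have "(\<lambda>k. (\<integral>x. F k x \<bullet> g x \<partial>M) - (\<integral>x. f x \<bullet> g x \<partial>M)) \<longlonglongrightarrow> 0"
  proof (rule Lim_null_comparison)
    show "(\<lambda>k. sqrt (\<integral>x. (norm (F k x - f x))\<^sup>2 \<partial>M) * sqrt (\<integral>x. (norm (g x))\<^sup>2 \<partial>M)) \<longlonglongrightarrow> 0"
      using tendsto_mult[OF tendsto_real_sqrt[OF lim] tendsto_const] by simp
    show "\<forall>\<^sub>F k in sequentially. norm ((\<integral>x. F k x \<bullet> g x \<partial>M) - (\<integral>x. f x \<bullet> g x \<partial>M))
        \<le> sqrt (\<integral>x. (norm (F k x - f x))\<^sup>2 \<partial>M) * sqrt (\<integral>x. (norm (g x))\<^sup>2 \<partial>M)"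
    proof (intro always_eventually allI)
      fix k
      have "(\<integral>x. F k x \<bullet> g x \<partial>M) - (\<integral>x. f x \<bullet> g x \<partial>M) = (\<integral>x. (F k x - f x) \<bullet> g x \<partial>M)"
        using integrable_inner[OF F assms(2)] integrable_inner[OF f assms(2)] by (simp add: inner_diff_left)
      also have "norm \<dots> \<le> (\<integral>x. norm ((F k x - f x) \<bullet> g x) \<partial>M)" by (rule integral_norm_bound)
      also have "\<dots> \<le> (\<integral>x. norm (F k x - f x) * norm (g x) \<partial>M)"
        by (intro integral_mono integrable_norm integrable_inner integrable_norm_mult d assms)
           (auto intro: Cauchy_Schwarz_ineq2)
      also have "\<dots> \<le> sqrt (\<integral>x. (norm (F k x - f x))\<^sup>2 \<partial>M) * sqrt (\<integral>x. (norm (g x))\<^sup>2 \<partial>M)"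
        by (rule Cauchy_Schwarz_integral_sqrt[OF d assms(2)])
      finally show "norm ((\<integral>x. F k x \<bullet> g x \<partial>M) - (\<integral>x. f x \<bullet> g x \<partial>M))
        \<le> sqrt (\<integral>x. (norm (F k x - f x))\<^sup>2 \<partial>M) * sqrt (\<integral>x. (norm (g x))\<^sup>2 \<partial>M)" .
    qed
  qed
  then show ?thesis by (simp add: LIM_zero_iff)
qed

lemma L2_converges_norm:
  assumes "L2_converges M F f"
  shows "(\<lambda>k. \<integral>x. (norm (F k x))\<^sup>2 \<partial>M) \<longlonglongrightarrow> (\<integral>x. (norm (f x))\<^sup>2 \<partial>M)"
proof -
  have F: "square_integrable M (F k)" and f: "square_integrable M f"
    and lim: "(\<lambda>k. \<integral>x. (norm (F k x - f x))\<^sup>2 \<partial>M) \<longlonglongrightarrow> 0" for k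
    using assms(1) unfolding L2_converges_def by auto
  have "(\<integral>x. (norm (F k x))\<^sup>2 \<partial>M) =
     (\<integral>x. (norm (F k x - f x))\<^sup>2 \<partial>M) + 2 * (\<integral>x. F k x \<bullet> f x \<partial>M) - (\<integral>x. (norm (f x))\<^sup>2 \<partial>M)" for k
  proof -
    have "(\<lambda>x. (norm (F k x))\<^sup>2) = (\<lambda>x. (norm (F k x - f x))\<^sup>2 + 2 * (F k x \<bullet> f x) - (norm (f x))\<^sup>2)"
      by (simp add: fun_eq_iff power2_norm_eq_inner inner_diff_left inner_diff_right inner_commute)
    then show ?thesis
      using square_integrable_diff[OF F f, of k] integrable_inner[OF F f, of k] f by (simp add: square_integrable_def)
  qed
  moreover have "(\<lambda>k. (\<integral>x. (norm (F k x - f x))\<^sup>2 \<partial>M) + 2 * (\<integral>x. F k x \<bullet> f x \<partial>M) - (\<integral>x. (norm (f x))\<^sup>2 \<partial>M))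
      \<longlonglongrightarrow> 0 + 2 * (\<integral>x. f x \<bullet> f x \<partial>M) - (\<integral>x. (norm (f x))\<^sup>2 \<partial>M)"
    by (intro tendsto_intros lim L2_converges_inner assms f)
  ultimately show ?thesis by (simp add: power2_norm_eq_inner)
qed

lemma L2_converges_L1:
  assumes "L2_converges M F f" "finite_measure M"
  shows "(\<lambda>k. \<integral>x. norm (F k x - f x) \<partial>M) \<longlonglongrightarrow> 0"
proof -
  interpret finite_measure M by fact
  have F: "square_integrable M (F k)" and f: "square_integrable M f"
    and lim: "(\<lambda>k. \<integral>x. (norm (F k x - f x))\<^sup>2 \<partial>M) \<longlonglongrightarrow> 0" for k
    using assms(1) unfolding L2_converges_def by auto
  have one: "square_integrable M (\<lambda>x. 1::real)" by (simp add: square_integrable_def)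
  show ?thesis
  proof (rule Lim_null_comparison)
    show "(\<lambda>k. sqrt (\<integral>x. (norm (F k x - f x))\<^sup>2 \<partial>M) * sqrt (\<integral>x. (norm (1::real))\<^sup>2 \<partial>M)) \<longlonglongrightarrow> 0"
      using tendsto_mult[OF tendsto_real_sqrt[OF lim] tendsto_const] by simp
    show "\<forall>\<^sub>F k in sequentially. norm (\<integral>x. norm (F k x - f x) \<partial>M)
        \<le> sqrt (\<integral>x. (norm (F k x - f x))\<^sup>2 \<partial>M) * sqrt (\<integral>x. (norm (1::real))\<^sup>2 \<partial>M)"
      using Cauchy_Schwarz_integral_sqrt[OF square_integrable_diff[OF F f] one] by (intro always_eventually) auto
  qed
qed

lemma square_integrable_L1:
  assumes "square_integrable M f" "finite_measure M"
  shows "integrable M f"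
proof -
  interpret finite_measure M by fact
  have "square_integrable M (\<lambda>x. 1::real)" by (simp add: square_integrable_def)
  from integrable_norm_mult[OF assms(1) this] show ?thesis
    using assms(1) by (simp add: integrable_norm_iff square_integrable_def)
qed

lemma null_sequence_bound2:
  assumes "\<And>k. 0 \<le> c k" "\<And>k. c k \<le> A * a k + B * b k" "a \<longlonglongrightarrow> 0" "b \<longlonglongrightarrow> (0::real)"
  shows "c \<longlonglongrightarrow> 0"
proof (rule Lim_null_comparison)
  show "(\<lambda>k. A * a k + B * b k) \<longlonglongrightarrow> 0"
    using tendsto_add[OF tendsto_mult_right_zero[OF assms(3), of A] tendsto_mult_right_zero[OF assms(4), of B]] by simp
qed (use assms in auto)

lemma square_integral_null_dominated:
  fixes a :: "nat \<Rightarrow> 'a \<Rightarrow> 'b::euclidean_space" and b :: "nat \<Rightarrow> 'a \<Rightarrow> 'c::euclidean_space"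
    and c :: "nat \<Rightarrow> 'a \<Rightarrow> 'd::euclidean_space"
  assumes a: "\<And>k. square_integrable M (a k)" "(\<lambda>k. \<integral>x. (norm (a k x))\<^sup>2 \<partial>M) \<longlonglongrightarrow> 0"
    and b: "\<And>k. square_integrable M (b k)" "(\<lambda>k. \<integral>x. (norm (b k x))\<^sup>2 \<partial>M) \<longlonglongrightarrow> 0"
    and le: "\<And>k x. norm (c k x) \<le> A * norm (a k x) + B * norm (b k x)"
  shows "(\<lambda>k. \<integral>x. (norm (c k x))\<^sup>2 \<partial>M) \<longlonglongrightarrow> 0"
proof (rule null_sequence_bound2[OF _ _ a(2) b(2)])
  fix k
  have "(norm (c k x))\<^sup>2 \<le> 2 * A\<^sup>2 * (norm (a k x))\<^sup>2 + 2 * B\<^sup>2 * (norm (b k x))\<^sup>2" for x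
  proof -
    have "(norm (c k x))\<^sup>2 \<le> (A * norm (a k x) + B * norm (b k x))\<^sup>2" by (intro power_mono le) auto
    also have "\<dots> \<le> 2 * A\<^sup>2 * (norm (a k x))\<^sup>2 + 2 * B\<^sup>2 * (norm (b k x))\<^sup>2"
      using norm_add_power2_le[of "A * norm (a k x)" "B * norm (b k x)"] by (simp add: power_mult_distrib)
    finally show ?thesis .
  qed
  moreover have "integrable M (\<lambda>x. 2 * A\<^sup>2 * (norm (a k x))\<^sup>2 + 2 * B\<^sup>2 * (norm (b k x))\<^sup>2)"
    using a(1)[of k] b(1)[of k] by (simp add: square_integrable_def)
  ultimately have "(\<integral>x. (norm (c k x))\<^sup>2 \<partial>M) \<le> (\<integral>x. 2 * A\<^sup>2 * (norm (a k x))\<^sup>2 + 2 * B\<^sup>2 * (norm (b k x))\<^sup>2 \<partial>M)"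
    by (intro integral_mono') auto
  then show "(\<integral>x. (norm (c k x))\<^sup>2 \<partial>M)
      \<le> 2 * A\<^sup>2 * (\<integral>x. (norm (a k x))\<^sup>2 \<partial>M) + 2 * B\<^sup>2 * (\<integral>x. (norm (b k x))\<^sup>2 \<partial>M)"
    using a(1)[of k] b(1)[of k] by (simp add: square_integrable_def)
qed (auto intro!: integral_nonneg_AE)

text \<open>The pairs \<open>(w, \<nabla>w)\<close> with \<open>w\<close> in \<open>W\<^sup>1\<^sup>,\<^sup>2\<^sub>0(\<Omega>)\<close>.  Approximability by \<open>C\<^sup>1\<^sub>c\<close> is the only condition on
  \<open>G\<close>: it already forces \<open>G\<close> to be the weak gradient, and it is what every argument below uses.\<close>

definition H10 :: "(real ^ 'n) set \<Rightarrow> (real ^ 'n \<Rightarrow> real) \<Rightarrow> (real ^ 'n \<Rightarrow> real ^ 'n) \<Rightarrow> bool" where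
  "H10 \<Omega> w G \<longleftrightarrow> square_integrable (lebesgue_on \<Omega>) w \<and> square_integrable (lebesgue_on \<Omega>) G \<and>
     (\<forall>\<epsilon>>0. \<exists>\<phi> D. C1c \<Omega> \<phi> D \<and> (\<integral>x. (norm (\<phi> x - w x))\<^sup>2 \<partial>lebesgue_on \<Omega>) < \<epsilon> \<and>
        (\<integral>x. (norm (D x - G x))\<^sup>2 \<partial>lebesgue_on \<Omega>) < \<epsilon>)"

lemma H10_square_integrable:
  assumes "H10 \<Omega> w G"
  shows "square_integrable (lebesgue_on \<Omega>) w" "square_integrable (lebesgue_on \<Omega>) G"
  using assms unfolding H10_def by auto

lemma W1p0_2_imp_H10:
  assumes "W1p0 2 \<Omega> u G" shows "H10 \<Omega> u G"
proof -
  have p2: "(norm (x::'b::real_normed_vector)) powr 2 = (norm x)\<^sup>2" for x by simp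
  obtain \<phi> D where C: "\<And>k::nat. C1c \<Omega> (\<phi> k) (D k)"
    and l1: "(\<lambda>k. \<integral>x. (norm (\<phi> k x - u x)) powr 2 \<partial>lebesgue_on \<Omega>) \<longlonglongrightarrow> 0"
    and l2: "(\<lambda>k. \<integral>x. norm (D k x - G x) powr 2 \<partial>lebesgue_on \<Omega>) \<longlonglongrightarrow> 0"
    using assms unfolding W1p0_def by auto
  show ?thesis unfolding H10_def
  proof (intro conjI allI impI)
    show "square_integrable (lebesgue_on \<Omega>) u" "square_integrable (lebesgue_on \<Omega>) G"
      using assms unfolding W1p0_def W1p_def in_Lp_def square_integrable_def by auto
    fix \<epsilon>::real assume "\<epsilon> > 0"
    then have "\<forall>\<^sub>F k in sequentially. (\<integral>x. (norm (\<phi> k x - u x)) powr 2 \<partial>lebesgue_on \<Omega>) < \<epsilon> \<and>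
        (\<integral>x. norm (D k x - G x) powr 2 \<partial>lebesgue_on \<Omega>) < \<epsilon>"
      using order_tendstoD(2)[OF l1] order_tendstoD(2)[OF l2] by (intro eventually_conj) auto
    then obtain k where "(\<integral>x. (norm (\<phi> k x - u x)) powr 2 \<partial>lebesgue_on \<Omega>) < \<epsilon> \<and>
        (\<integral>x. norm (D k x - G x) powr 2 \<partial>lebesgue_on \<Omega>) < \<epsilon>"
      unfolding eventually_sequentially by blast
    then show "\<exists>\<phi> D. C1c \<Omega> \<phi> D \<and> (\<integral>x. (norm (\<phi> x - u x))\<^sup>2 \<partial>lebesgue_on \<Omega>) < \<epsilon> \<and>
        (\<integral>x. (norm (D x - G x))\<^sup>2 \<partial>lebesgue_on \<Omega>) < \<epsilon>"
      using C unfolding p2 by blast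
  qed
qed

locale bounded_open =
  fixes \<Omega> :: "(real ^ 'n) set"
  assumes open_domain: "open \<Omega>" and bounded_domain: "bounded \<Omega>"
begin

abbreviation \<mu> :: "(real ^ 'n) measure" where
  "\<mu> \<equiv> lebesgue_on \<Omega>"

lemma domain_lmeasurable: "\<Omega> \<in> lmeasurable"
  using open_domain bounded_domain by (simp add: lmeasurable_open)

lemma domain_sets [simp]: "\<Omega> \<in> sets lebesgue" using domain_lmeasurable by auto

sublocale finite_measure "\<mu>"
  by (rule finite_measure_lebesgue_on[OF domain_lmeasurable])

lemma borel_imp_measurable_domain:
  "f \<in> borel_measurable borel \<Longrightarrow> f \<in> borel_measurable \<mu>"
  by (intro measurable_restrict_space1 measurable_completion) simp

lemma integral_lebesgue_on_eq_lborel: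
  fixes f :: "real^'n \<Rightarrow> 'b::euclidean_space"
  assumes "f \<in> borel_measurable borel" "\<And>x. x \<notin> \<Omega> \<Longrightarrow> f x = 0"
  shows "(\<integral>x. f x \<partial>\<mu>) = (\<integral>x. f x \<partial>lborel)"
proof -
  have "(\<integral>x. f x \<partial>\<mu>) = (\<integral>x. indicator \<Omega> x *\<^sub>R f x \<partial>lebesgue)"
    by (rule integral_restrict_space) simp
  also have "(\<lambda>x. indicator \<Omega> x *\<^sub>R f x) = f" using assms(2) by (auto simp: fun_eq_iff indicator_def)
  also have "(\<integral>x. f x \<partial>lebesgue) = (\<integral>x. f x \<partial>lborel)" using assms(1) by (intro integral_completion) simp
  finally show ?thesis .
qed

lemma square_integrable_bounded:
  fixes f :: "real^'n \<Rightarrow> 'b::euclidean_space"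
  assumes "f \<in> borel_measurable \<mu>" "AE x in \<mu>. norm (f x) \<le> B"
  shows "square_integrable \<mu> f"
  by (rule square_integrable_bound[where g="\<lambda>x. 1::real" and C=B])
     (use assms in \<open>auto simp: square_integrable_def\<close>)

lemma C1c_square_integrable:
  assumes "C1c \<Omega> \<phi> D"
  shows "square_integrable \<mu> \<phi>" "square_integrable \<mu> D"
proof -
  obtain B where B: "\<And>x. \<bar>\<phi> x\<bar> \<le> B" "\<And>x. norm (D x) \<le> B" using C1c_bounded[OF assms] by metis
  show "square_integrable \<mu> \<phi>" "square_integrable \<mu> D"
    using B by (auto intro!: square_integrable_bounded[of _ B] borel_imp_measurable_domain C1c_measurable[OF assms])
qed

lemma H10_C1c: "C1c \<Omega> \<phi> D \<Longrightarrow> H10 \<Omega> \<phi> D"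
  unfolding H10_def using C1c_square_integrable by (auto intro!: exI[of _ \<phi>] exI[of _ D])

lemma H10_sequence:
  assumes "H10 \<Omega> w G"
  obtains \<phi> D where "\<And>k. C1c \<Omega> (\<phi> k) (D k)" "L2_converges \<mu> \<phi> w" "L2_converges \<mu> D G"
proof -
  have "\<forall>k. \<exists>\<phi> D. C1c \<Omega> \<phi> D \<and> (\<integral>x. (norm (\<phi> x - w x))\<^sup>2 \<partial>\<mu>) < inverse (real (Suc k)) \<and>
        (\<integral>x. (norm (D x - G x))\<^sup>2 \<partial>\<mu>) < inverse (real (Suc k))"
    using assms unfolding H10_def by auto
  from choice[OF this] obtain \<phi> where "\<forall>k. \<exists>D. C1c \<Omega> (\<phi> k) D \<and> (\<integral>x. (norm (\<phi> k x - w x))\<^sup>2 \<partial>\<mu>) < inverse (real (Suc k)) \<and>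
        (\<integral>x. (norm (D x - G x))\<^sup>2 \<partial>\<mu>) < inverse (real (Suc k))" by (elim exE)
  from choice[OF this] obtain D where D: "\<forall>k. C1c \<Omega> (\<phi> k) (D k) \<and> (\<integral>x. (norm (\<phi> k x - w x))\<^sup>2 \<partial>\<mu>) < inverse (real (Suc k)) \<and>
        (\<integral>x. (norm (D k x - G x))\<^sup>2 \<partial>\<mu>) < inverse (real (Suc k))" by (elim exE)
  then have C: "C1c \<Omega> (\<phi> k) (D k)"
    and 1: "(\<integral>x. (norm (\<phi> k x - w x))\<^sup>2 \<partial>\<mu>) < inverse (real (Suc k))"
    and 2: "(\<integral>x. (norm (D k x - G x))\<^sup>2 \<partial>\<mu>) < inverse (real (Suc k))" for k
    by blast+
  have "(\<lambda>k. \<integral>x. (norm (\<phi> k x - w x))\<^sup>2 \<partial>\<mu>) \<longlonglongrightarrow> 0"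
    by (rule Lim_null_comparison[OF _ LIMSEQ_inverse_real_of_nat])
       (use 1 in \<open>auto intro!: always_eventually intro: less_imp_le\<close>)
  moreover have "(\<lambda>k. \<integral>x. (norm (D k x - G x))\<^sup>2 \<partial>\<mu>) \<longlonglongrightarrow> 0"
    by (rule Lim_null_comparison[OF _ LIMSEQ_inverse_real_of_nat])
       (use 2 in \<open>auto intro!: always_eventually intro: less_imp_le\<close>)
  ultimately show ?thesis
    using that[of \<phi> D] C C1c_square_integrable[OF C] H10_square_integrable[OF assms] unfolding L2_converges_def by auto
qed

lemma H10_I:
  assumes "\<And>k. C1c \<Omega> (\<phi> k) (D k)" "square_integrable \<mu> w" "square_integrable \<mu> G"
    and 1: "(\<lambda>k. \<integral>x. (norm (\<phi> k x - w x))\<^sup>2 \<partial>\<mu>) \<longlonglongrightarrow> 0"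
    and 2: "(\<lambda>k. \<integral>x. (norm (D k x - G x))\<^sup>2 \<partial>\<mu>) \<longlonglongrightarrow> 0"
  shows "H10 \<Omega> w G"
  unfolding H10_def
proof (intro conjI assms allI impI)
  fix \<epsilon> :: real assume "\<epsilon> > 0"
  then have "\<forall>\<^sub>F k in sequentially. (\<integral>x. (norm (\<phi> k x - w x))\<^sup>2 \<partial>\<mu>) < \<epsilon> \<and>
      (\<integral>x. (norm (D k x - G x))\<^sup>2 \<partial>\<mu>) < \<epsilon>"
    using order_tendstoD(2)[OF 1] order_tendstoD(2)[OF 2] by (intro eventually_conj) auto
  then obtain k where "(\<integral>x. (norm (\<phi> k x - w x))\<^sup>2 \<partial>\<mu>) < \<epsilon> \<and>
      (\<integral>x. (norm (D k x - G x))\<^sup>2 \<partial>\<mu>) < \<epsilon>"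
    unfolding eventually_sequentially by blast
  then show "\<exists>\<phi> D. C1c \<Omega> \<phi> D \<and> (\<integral>x. (norm (\<phi> x - w x))\<^sup>2 \<partial>\<mu>) < \<epsilon> \<and>
      (\<integral>x. (norm (D x - G x))\<^sup>2 \<partial>\<mu>) < \<epsilon>" using assms(1) by blast
qed

lemma H10_diff:
  assumes "H10 \<Omega> w G" "H10 \<Omega> v F"
  shows "H10 \<Omega> (\<lambda>x. w x - v x) (\<lambda>x. G x - F x)"
proof -
  obtain \<phi> D where \<phi>: "\<And>k. C1c \<Omega> (\<phi> k) (D k)" "L2_converges \<mu> \<phi> w" "L2_converges \<mu> D G"
    using H10_sequence[OF assms(1)] by metis
  obtain \<psi> E where \<psi>: "\<And>k. C1c \<Omega> (\<psi> k) (E k)" "L2_converges \<mu> \<psi> v" "L2_converges \<mu> E F"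
    using H10_sequence[OF assms(2)] by metis
  have *: "(\<lambda>k. \<integral>x. (norm ((f k x - g k x) - (a x - b x)))\<^sup>2 \<partial>\<mu>) \<longlonglongrightarrow> 0"
    if F: "L2_converges \<mu> f a" and G: "L2_converges \<mu> g b"
    for f g :: "nat \<Rightarrow> real^'n \<Rightarrow> 'b::euclidean_space" and a b
  proof (rule square_integral_null_dominated[OF L2_convergesD(3,4)[OF F] L2_convergesD(3,4)[OF G]])
    show "norm ((f k x - g k x) - (a x - b x)) \<le> 1 * norm (f k x - a x) + 1 * norm (g k x - b x)" for k x
      using norm_triangle_ineq4[of "f k x - a x" "g k x - b x"] by (simp add: algebra_simps)
  qed
  show ?thesis
    by (rule H10_I[OF C1c_diff[OF \<phi>(1) \<psi>(1)] _ _ *[OF \<phi>(2) \<psi>(2)] *[OF \<phi>(3) \<psi>(3)]])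
       (auto intro!: square_integrable_diff H10_square_integrable[OF assms(1)] H10_square_integrable[OF assms(2)])
qed

text \<open>Needed for the localised test function \<open>\<phi>\<^sup>2(K - v)\<close>.\<close>

lemma H10_mult_C1c:
  assumes "C1c \<Omega> \<eta> E" "H10 \<Omega> w G"
  shows "H10 \<Omega> (\<lambda>x. \<eta> x * w x) (\<lambda>x. \<eta> x *\<^sub>R G x + w x *\<^sub>R E x)"
proof -
  obtain \<phi> D where \<phi>: "\<And>k. C1c \<Omega> (\<phi> k) (D k)" "L2_converges \<mu> \<phi> w" "L2_converges \<mu> D G"
    using H10_sequence[OF assms(2)] by metis
  obtain B where B: "B > 0" "\<And>x. \<bar>\<eta> x\<bar> \<le> B" "\<And>x. norm (E x) \<le> B" using C1c_bounded[OF assms(1)] by metis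
  have [measurable]: "\<eta> \<in> borel_measurable \<mu>" "E \<in> borel_measurable \<mu>"
    by (auto intro!: borel_imp_measurable_domain C1c_measurable[OF assms(1)])
  note wG = H10_square_integrable[OF assms(2)]
  have sq: "square_integrable \<mu> (\<lambda>x. \<eta> x *\<^sub>R f x)"
    if "square_integrable \<mu> f" for f :: "real^'n \<Rightarrow> 'b::euclidean_space"
    by (rule square_integrable_bound[OF _ that, where C=B])
       (use square_integrable_measurable[OF that] B in \<open>auto intro!: mult_right_mono\<close>)
  have sqE: "square_integrable \<mu> (\<lambda>x. f x *\<^sub>R E x)"
    if "square_integrable \<mu> f" for f :: "real^'n \<Rightarrow> real"
    by (rule square_integrable_bound[OF _ that, where C=B])
       (use square_integrable_measurable[OF that] B in \<open>auto intro!: mult_left_mono simp: mult.commute[of B]\<close>)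
  show ?thesis
  proof (rule H10_I)
    show "C1c \<Omega> (\<lambda>x. \<eta> x * \<phi> k x) (\<lambda>x. \<eta> x *\<^sub>R D k x + \<phi> k x *\<^sub>R E x)" for k
      using C1c_mult[OF assms(1)] \<phi>(1)[of k] unfolding C1c_def by auto
    show "square_integrable \<mu> (\<lambda>x. \<eta> x * w x)" using sq[OF wG(1)] by simp
    show "square_integrable \<mu> (\<lambda>x. \<eta> x *\<^sub>R G x + w x *\<^sub>R E x)"
      by (intro square_integrable_add sq wG sqE)
    note dom = square_integral_null_dominated[OF L2_convergesD(3,4)[OF \<phi>(2)] L2_convergesD(3,4)[OF \<phi>(3)]]
    have 1: "norm (\<eta> x * \<phi> k x - \<eta> x * w x) \<le> B * norm (\<phi> k x - w x)" for k x
      using B(2)[of x] by (simp add: right_diff_distrib[symmetric] abs_mult mult_right_mono)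
    show "(\<lambda>k. \<integral>x. (norm (\<eta> x * \<phi> k x - \<eta> x * w x))\<^sup>2 \<partial>\<mu>) \<longlonglongrightarrow> 0"
      by (rule dom[where A=B and B=0]) (use 1 in simp)
    show "(\<lambda>k. \<integral>x. (norm (\<eta> x *\<^sub>R D k x + \<phi> k x *\<^sub>R E x - (\<eta> x *\<^sub>R G x + w x *\<^sub>R E x)))\<^sup>2 \<partial>\<mu>) \<longlonglongrightarrow> 0"
    proof (rule dom)
      fix k x
      have "\<eta> x *\<^sub>R D k x + \<phi> k x *\<^sub>R E x - (\<eta> x *\<^sub>R G x + w x *\<^sub>R E x)
          = (\<phi> k x - w x) *\<^sub>R E x + \<eta> x *\<^sub>R (D k x - G x)"
        by (simp add: algebra_simps)
      also have "norm \<dots> \<le> norm ((\<phi> k x - w x) *\<^sub>R E x) + norm (\<eta> x *\<^sub>R (D k x - G x))" by (rule norm_triangle_ineq)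
      also have "\<dots> \<le> B * norm (\<phi> k x - w x) + B * norm (D k x - G x)"
        using mult_left_mono[OF B(3)[of x], of "\<bar>\<phi> k x - w x\<bar>"] mult_right_mono[OF B(2)[of x], of "norm (D k x - G x)"]
        by (simp add: mult.commute)
      finally show "norm (\<eta> x *\<^sub>R D k x + \<phi> k x *\<^sub>R E x - (\<eta> x *\<^sub>R G x + w x *\<^sub>R E x))
          \<le> B * norm (\<phi> k x - w x) + B * norm (D k x - G x)" .
    qed
  qed
qed

text \<open>Along a subsequence of the approximants that converges almost everywhere,
  \<open>\<psi>(\<phi>\<^sub>k) \<rightarrow> \<psi>(w)\<close> boundedly, so that \<open>\<psi>(\<phi>\<^sub>k) G\<close> converges in \<open>L\<^sup>2\<close> by dominated convergence.\<close>

lemma H10_comp: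
  assumes "H10 \<Omega> w G" "\<And>s. (\<Psi> has_real_derivative \<psi> s) (at s)" "continuous_on UNIV \<psi>" "\<Psi> 0 = 0"
    and L: "\<And>s. \<bar>\<psi> s\<bar> \<le> L"
  shows "H10 \<Omega> (\<lambda>x. \<Psi> (w x)) (\<lambda>x. \<psi> (w x) *\<^sub>R G x)"
proof -
  obtain \<phi> D where \<phi>: "\<And>k. C1c \<Omega> (\<phi> k) (D k)" "L2_converges \<mu> \<phi> w" "L2_converges \<mu> D G"
    using H10_sequence[OF assms(1)] by metis
  note wG = H10_square_integrable[OF assms(1)]
  have sqs: "square_integrable \<mu> (\<phi> k)" "square_integrable \<mu> (D k)" for k using \<phi> by (auto simp: L2_converges_def)
  have [measurable]: "w \<in> borel_measurable \<mu>" "G \<in> borel_measurable \<mu>"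
     "\<phi> k \<in> borel_measurable \<mu>" "D k \<in> borel_measurable \<mu>" for k
    using wG sqs by (auto simp: square_integrable_def)
  have cont: "continuous_on UNIV \<Psi>" using assms(2) by (meson DERIV_isCont continuous_at_imp_continuous_on)
  have [measurable]: "\<Psi> \<in> borel_measurable borel" "\<psi> \<in> borel_measurable borel"
    using cont assms(3) by (auto intro: borel_measurable_continuous_onI)
  have lip: "\<bar>\<Psi> a - \<Psi> b\<bar> \<le> L * \<bar>a - b\<bar>" for a b
    using field_differentiable_bound[OF convex_UNIV _ _ UNIV_I UNIV_I, of \<Psi> \<psi> L a b] assms(2) L by auto
  have "\<exists>r::nat\<Rightarrow>nat. strict_mono r \<and> (AE x in \<mu>. (\<lambda>k. \<phi> (r k) x - w x) \<longlonglongrightarrow> 0)"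
    by (rule tendsto_L1_AE_subseq[OF _ L2_converges_L1[OF \<phi>(2)]])
       (intro square_integrable_L1 square_integrable_diff sqs wG finite_measure_axioms)+
  then obtain r :: "nat \<Rightarrow> nat" where r: "strict_mono r" "AE x in \<mu>. (\<lambda>k. \<phi> (r k) x - w x) \<longlonglongrightarrow> 0" by auto
  have l1: "(\<lambda>k. \<integral>x. (norm (\<phi> (r k) x - w x))\<^sup>2 \<partial>\<mu>) \<longlonglongrightarrow> 0"
    and l2: "(\<lambda>k. \<integral>x. (norm (D (r k) x - G x))\<^sup>2 \<partial>\<mu>) \<longlonglongrightarrow> 0"
    using \<phi> by (auto simp: L2_converges_def intro!: LIMSEQ_subseq_LIMSEQ[OF _ r(1), unfolded comp_def])
  have l3: "(\<lambda>k. \<integral>x. (norm ((\<psi> (\<phi> (r k) x) - \<psi> (w x)) *\<^sub>R G x))\<^sup>2 \<partial>\<mu>) \<longlonglongrightarrow> (\<integral>x. 0 \<partial>\<mu>)"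
  proof (rule integral_dominated_convergence[where w="\<lambda>x. (2 * L)\<^sup>2 * (norm (G x))\<^sup>2"])
    show "integrable \<mu> (\<lambda>x. (2 * L)\<^sup>2 * (norm (G x))\<^sup>2)" using wG by (simp add: square_integrable_def)
    show "AE x in \<mu>. (\<lambda>k. (norm ((\<psi> (\<phi> (r k) x) - \<psi> (w x)) *\<^sub>R G x))\<^sup>2) \<longlonglongrightarrow> 0"
      using r(2)
    proof eventually_elim
      case (elim x)
      then have "(\<lambda>k. \<phi> (r k) x) \<longlonglongrightarrow> w x" by (simp add: LIM_zero_iff)
      then have "(\<lambda>k. \<psi> (\<phi> (r k) x)) \<longlonglongrightarrow> \<psi> (w x)"
        using continuous_on_tendsto_compose[OF assms(3)] by auto
      then have "(\<lambda>k. (norm ((\<psi> (\<phi> (r k) x) - \<psi> (w x)) *\<^sub>R G x))\<^sup>2) \<longlonglongrightarrow> (norm ((\<psi> (w x) - \<psi> (w x)) *\<^sub>R G x))\<^sup>2"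
        by (intro tendsto_intros)
      then show ?case by simp
    qed
    show "AE x in \<mu>. norm ((norm ((\<psi> (\<phi> (r k) x) - \<psi> (w x)) *\<^sub>R G x))\<^sup>2) \<le> (2 * L)\<^sup>2 * (norm (G x))\<^sup>2" for k
    proof (rule AE_I2)
      fix x
      have "\<bar>\<psi> (\<phi> (r k) x) - \<psi> (w x)\<bar> \<le> 2 * L" using L[of "\<phi> (r k) x"] L[of "w x"] by linarith
      then have "norm ((\<psi> (\<phi> (r k) x) - \<psi> (w x)) *\<^sub>R G x) \<le> 2 * L * norm (G x)" by (simp add: mult_right_mono)
      then have "(norm ((\<psi> (\<phi> (r k) x) - \<psi> (w x)) *\<^sub>R G x))\<^sup>2 \<le> (2 * L * norm (G x))\<^sup>2" by (intro power_mono) auto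
      then show "norm ((norm ((\<psi> (\<phi> (r k) x) - \<psi> (w x)) *\<^sub>R G x))\<^sup>2) \<le> (2 * L)\<^sup>2 * (norm (G x))\<^sup>2"
        by (simp add: power_mult_distrib)
    qed
  qed measurable
  have sqb: "square_integrable \<mu> (\<lambda>x. a x *\<^sub>R F x)"
    if "square_integrable \<mu> F" "a \<in> borel_measurable \<mu>" "\<And>x. \<bar>a x\<bar> \<le> B" for F :: "real^'n \<Rightarrow> real^'n" and a B
    by (rule square_integrable_bound[OF _ that(1), where C=B])
       (use square_integrable_measurable[OF that(1)] that in \<open>auto intro!: mult_right_mono\<close>)
  have s: "square_integrable \<mu> (\<lambda>x. \<phi> k x - w x)" "square_integrable \<mu> (\<lambda>x. D k x - G x)" for k
    using sqs wG by (auto intro: square_integrable_diff)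
  show ?thesis
  proof (rule H10_I[where \<phi>="\<lambda>k x. \<Psi> (\<phi> (r k) x)" and D="\<lambda>k x. \<psi> (\<phi> (r k) x) *\<^sub>R D (r k) x"])
    show "C1c \<Omega> (\<lambda>x. \<Psi> (\<phi> (r k) x)) (\<lambda>x. \<psi> (\<phi> (r k) x) *\<^sub>R D (r k) x)" for k
      by (rule C1c_comp[OF \<phi>(1) assms(2-4)])
    show "square_integrable \<mu> (\<lambda>x. \<Psi> (w x))"
      by (rule square_integrable_bound[OF _ wG(1), where C=L]) (use lip[of _ 0] assms(4) in auto)
    show "square_integrable \<mu> (\<lambda>x. \<psi> (w x) *\<^sub>R G x)"
      by (rule sqb[OF wG(2)]) (use L in auto)
    show "(\<lambda>k. \<integral>x. (norm (\<Psi> (\<phi> (r k) x) - \<Psi> (w x)))\<^sup>2 \<partial>\<mu>) \<longlonglongrightarrow> 0"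
      by (rule square_integral_null_dominated[OF s(1) l1 s(2) l2, where A=L and B=0]) (use lip in simp)
    have s3: "square_integrable \<mu> (\<lambda>x. (\<psi> (\<phi> (r k) x) - \<psi> (w x)) *\<^sub>R G x)" for k
    proof (rule sqb[OF wG(2)])
      show "\<bar>\<psi> (\<phi> (r k) x) - \<psi> (w x)\<bar> \<le> 2 * L" for x using L[of "\<phi> (r k) x"] L[of "w x"] by linarith
    qed measurable
    show "(\<lambda>k. \<integral>x. (norm (\<psi> (\<phi> (r k) x) *\<^sub>R D (r k) x - \<psi> (w x) *\<^sub>R G x))\<^sup>2 \<partial>\<mu>) \<longlonglongrightarrow> 0"
    proof (rule square_integral_null_dominated[OF s(2) l2 s3 l3[unfolded Bochner_Integration.integral_zero]])
      fix k x
      have "\<psi> (\<phi> (r k) x) *\<^sub>R D (r k) x - \<psi> (w x) *\<^sub>R G x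
          = \<psi> (\<phi> (r k) x) *\<^sub>R (D (r k) x - G x) + (\<psi> (\<phi> (r k) x) - \<psi> (w x)) *\<^sub>R G x"
        by (simp add: algebra_simps)
      also have "norm \<dots> \<le> norm (\<psi> (\<phi> (r k) x) *\<^sub>R (D (r k) x - G x)) + norm ((\<psi> (\<phi> (r k) x) - \<psi> (w x)) *\<^sub>R G x)"
        by (rule norm_triangle_ineq)
      also have "norm (\<psi> (\<phi> (r k) x) *\<^sub>R (D (r k) x - G x)) \<le> L * norm (D (r k) x - G x)"
        using L by (simp add: mult_right_mono)
      finally show "norm (\<psi> (\<phi> (r k) x) *\<^sub>R D (r k) x - \<psi> (w x) *\<^sub>R G x)
          \<le> L * norm (D (r k) x - G x) + 1 * norm ((\<psi> (\<phi> (r k) x) - \<psi> (w x)) *\<^sub>R G x)" by simp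
    qed
  qed
qed

text \<open>All three integrals in the inequality are continuous along the approximating sequence.\<close>

lemma nash_inequality_H10:
  assumes "H10 \<Omega> w G" "r > 0"
  shows "(\<integral>x. (w x)\<^sup>2 \<partial>\<mu>) \<le> r\<^sup>2 / 2 * (\<integral>x. (norm (G x))\<^sup>2 \<partial>\<mu>)
     + (\<integral>x. \<bar>w x\<bar> \<partial>\<mu>)\<^sup>2 / measure lborel (ball (0::real^'n) r)"
proof -
  obtain \<phi> D where \<phi>: "\<And>k. C1c \<Omega> (\<phi> k) (D k)" "L2_converges \<mu> \<phi> w" "L2_converges \<mu> D G"
    using H10_sequence[OF assms(1)] by metis
  have sw: "square_integrable \<mu> w" "square_integrable \<mu> (\<phi> k)" for k using \<phi> by (auto simp: L2_converges_def)
  have i: "integrable \<mu> w" "integrable \<mu> (\<phi> k)" for k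
    using square_integrable_L1[OF _ finite_measure_axioms] sw by auto
  have "(\<lambda>k. (\<integral>x. \<bar>\<phi> k x\<bar> \<partial>\<mu>) - (\<integral>x. \<bar>w x\<bar> \<partial>\<mu>)) \<longlonglongrightarrow> 0"
  proof (rule Lim_null_comparison[OF _ L2_converges_L1[OF \<phi>(2) finite_measure_axioms]], intro always_eventually allI)
    fix k
    have "(\<integral>x. \<bar>\<phi> k x\<bar> \<partial>\<mu>) - (\<integral>x. \<bar>w x\<bar> \<partial>\<mu>) = (\<integral>x. \<bar>\<phi> k x\<bar> - \<bar>w x\<bar> \<partial>\<mu>)" using i by simp
    also have "norm \<dots> \<le> (\<integral>x. norm (\<bar>\<phi> k x\<bar> - \<bar>w x\<bar>) \<partial>\<mu>)" by (rule integral_norm_bound)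
    also have "\<dots> \<le> (\<integral>x. norm (\<phi> k x - w x) \<partial>\<mu>)"
      by (rule integral_mono) (use i in auto)
    finally show "norm ((\<integral>x. \<bar>\<phi> k x\<bar> \<partial>\<mu>) - (\<integral>x. \<bar>w x\<bar> \<partial>\<mu>)) \<le> (\<integral>x. norm (\<phi> k x - w x) \<partial>\<mu>)" .
  qed
  then have l1: "(\<lambda>k. \<integral>x. \<bar>\<phi> k x\<bar> \<partial>\<mu>) \<longlonglongrightarrow> (\<integral>x. \<bar>w x\<bar> \<partial>\<mu>)" by (simp add: LIM_zero_iff)
  have "(\<integral>x. (\<phi> k x)\<^sup>2 \<partial>\<mu>) \<le> r\<^sup>2 / 2 * (\<integral>x. (norm (D k x))\<^sup>2 \<partial>\<mu>) + (\<integral>x. \<bar>\<phi> k x\<bar> \<partial>\<mu>)\<^sup>2 / measure lborel (ball (0::real^'n) r)" for k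
  proof -
    note [measurable] = C1c_measurable[OF \<phi>(1), of k]
    obtain K where K: "K \<subseteq> \<Omega>" "\<And>x. x \<notin> K \<Longrightarrow> \<phi> k x = 0" "\<And>x. x \<notin> K \<Longrightarrow> D k x = 0" using C1c_support[OF \<phi>(1)[of k]] by metis
    then have z: "x \<notin> \<Omega> \<Longrightarrow> \<phi> k x = 0" "x \<notin> \<Omega> \<Longrightarrow> D k x = 0" for x by auto
    show ?thesis using nash_inequality_C1c[OF \<phi>(1) assms(2), of k] z
      by (simp add: integral_lebesgue_on_eq_lborel)
  qed
  moreover have "(\<lambda>k. r\<^sup>2 / 2 * (\<integral>x. (norm (D k x))\<^sup>2 \<partial>\<mu>) + (\<integral>x. \<bar>\<phi> k x\<bar> \<partial>\<mu>)\<^sup>2 / measure lborel (ball (0::real^'n) r))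
    \<longlonglongrightarrow> r\<^sup>2 / 2 * (\<integral>x. (norm (G x))\<^sup>2 \<partial>\<mu>) + (\<integral>x. \<bar>w x\<bar> \<partial>\<mu>)\<^sup>2 / measure lborel (ball (0::real^'n) r)"
    by (intro tendsto_add tendsto_mult tendsto_divide tendsto_const tendsto_power l1 L2_converges_norm[OF \<phi>(3)])
       (use content_ball_pos[OF assms(2), of "0::real^'n"] in auto)
  ultimately show ?thesis
    using LIMSEQ_le[OF L2_converges_norm[OF \<phi>(2), simplified]] by blast
qed

text \<open>Both sides are continuous in the \<open>L\<^sup>2\<close> norms in which \<open>C\<^sup>1\<^sub>c\<close> is dense; this is what permits
  nonlinear functions of a solution as test functions.\<close>

lemma weak_formulation_H10:
  assumes "\<And>\<phi> D. C1c \<Omega> \<phi> D \<Longrightarrow> (\<integral>x. A x \<bullet> D x \<partial>\<mu>) = (\<integral>x. h x * \<phi> x \<partial>\<mu>)"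
    and "square_integrable \<mu> A" "square_integrable \<mu> h"
    and "H10 \<Omega> w G"
  shows "(\<integral>x. A x \<bullet> G x \<partial>\<mu>) = (\<integral>x. h x * w x \<partial>\<mu>)"
proof -
  obtain \<phi> D where \<phi>: "\<And>k. C1c \<Omega> (\<phi> k) (D k)" "L2_converges \<mu> \<phi> w" "L2_converges \<mu> D G"
    using H10_sequence[OF assms(4)] by metis
  have "(\<lambda>k. \<integral>x. A x \<bullet> D k x \<partial>\<mu>) \<longlonglongrightarrow> (\<integral>x. A x \<bullet> G x \<partial>\<mu>)"
    using L2_converges_inner[OF \<phi>(3) assms(2)] by (simp add: inner_commute)
  moreover have "(\<lambda>k. \<integral>x. A x \<bullet> D k x \<partial>\<mu>) \<longlonglongrightarrow> (\<integral>x. h x * w x \<partial>\<mu>)"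
    using L2_converges_inner[OF \<phi>(2) assms(3)] assms(1)[OF \<phi>(1)] by (simp add: mult.commute)
  ultimately show ?thesis by (rule LIMSEQ_unique)
qed

end

section \<open>Supremum bound, comparison and local mass of supersolutions\<close>

text \<open>Stampacchia's lemma.  Along the levels \<open>k\<^sub>j = k0 + d(1 - 2\<^sup>-\<^sup>j)\<close> the hypothesis gains the power \<open>\<delta>\<close> at
  the price of a factor \<open>2\<^sup>j\<close>; for the stated value of \<open>d\<close> these balance and give
  \<open>a(k\<^sub>j) \<le> S q\<^sup>j\<close> with \<open>q = 2\<^sup>-\<^sup>1\<^sup>/\<^sup>\<delta>\<close>.\<close>

lemma Stampacchia_iteration:
  fixes a :: "real \<Rightarrow> real"
  assumes mono: "\<And>k k'. k \<le> k' \<Longrightarrow> a k' \<le> a k" and nonneg: "\<And>k. 0 \<le> a k"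
    and step: "\<And>k k'. k0 \<le> k \<Longrightarrow> k < k' \<Longrightarrow> (k' - k) * a k' \<le> C * a k powr (1 + \<delta>)"
    and "C > 0" "\<delta> > 0" "S > 0" "a k0 \<le> S"
  shows "a (k0 + C * S powr \<delta> * 2 powr (1 + 1 / \<delta>)) = 0"
proof -
  define d where "d = C * S powr \<delta> * 2 powr (1 + 1 / \<delta>)"
  define q where "q = (2::real) powr (- 1 / \<delta>)"
  define k where "k = (\<lambda>j::nat. k0 + d * (1 - (1/2)^j))"
  have d: "d > 0" unfolding d_def using assms by simp
  have q: "q > 0" "q < 1" unfolding q_def using \<open>\<delta> > 0\<close> by (auto simp: powr_less_one)
  have qd: "q powr \<delta> = 1/2" unfolding q_def powr_powr using \<open>\<delta> > 0\<close> by (simp add: powr_minus_divide)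
  have dq: "C * 2 * S powr \<delta> / d = q"
  proof -
    have "2 powr (1 + 1 / \<delta>) = 2 * 2 powr (1 / \<delta>)" by (simp add: powr_add)
    moreover have "q = inverse (2 powr (1 / \<delta>))" unfolding q_def by (simp add: powr_minus[symmetric])
    ultimately show ?thesis unfolding d_def using \<open>C > 0\<close> \<open>S > 0\<close> by (simp add: divide_simps)
  qed
  have bound: "a (k j) \<le> S * q ^ j" for j
  proof (induction j)
    case 0 then show ?case using \<open>a k0 \<le> S\<close> by (simp add: k_def)
  next
    case (Suc j)
    have diff: "k (Suc j) - k j = d * (1/2)^(Suc j)" unfolding k_def by (simp add: algebra_simps)
    have lt: "k j < k (Suc j)" using diff d by (smt (verit) mult_pos_pos zero_less_power half_gt_zero zero_less_one)
    have ge: "k0 \<le> k j" unfolding k_def using d by (simp add: power_le_one)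
    have "(d * (1/2)^(Suc j)) * a (k (Suc j)) \<le> C * a (k j) powr (1 + \<delta>)"
      using step[OF ge lt] unfolding diff .
    also have "\<dots> \<le> C * (S * q ^ j) powr (1 + \<delta>)"
      using Suc nonneg \<open>C > 0\<close> \<open>\<delta> > 0\<close> by (intro mult_left_mono powr_mono2) auto
    also have "(S * q ^ j) powr (1 + \<delta>) = S * q ^ j * (S powr \<delta> * (1/2) ^ j)"
    proof -
      have "(q ^ j) powr \<delta> = (q powr \<delta>) ^ j"
        using q by (simp add: powr_realpow[symmetric] powr_powr mult.commute)
      then have "(q ^ j) powr \<delta> = (1/2) ^ j" unfolding qd .
      then show ?thesis using q \<open>S > 0\<close> by (simp add: powr_add powr_mult)
    qed
    finally have "a (k (Suc j)) \<le> C * (S * q ^ j * (S powr \<delta> * (1/2) ^ j)) / (d * (1/2)^(Suc j))"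
      using d by (simp add: pos_le_divide_eq mult.commute)
    also have "\<dots> = S * q ^ j * (C * 2 * S powr \<delta> / d)" using d by (simp add: field_simps)
    also have "\<dots> = S * q ^ Suc j" unfolding dq by simp
    finally show ?case .
  qed
  have "a (k0 + d) \<le> S * q ^ j" for j
  proof -
    have "a (k0 + d) \<le> a (k j)" by (rule mono) (use d in \<open>simp add: k_def\<close>)
    then show ?thesis using bound[of j] by linarith
  qed
  moreover have "(\<lambda>j. S * q ^ j) \<longlonglongrightarrow> 0"
    using q tendsto_mult_right_zero[OF LIMSEQ_power_zero[of q], of S] by simp
  ultimately have "a (k0 + d) \<le> 0" by (intro LIMSEQ_le_const) auto
  then show ?thesis using nonneg[of "k0 + d"] unfolding d_def by linarith
qed

text \<open>A \<open>C\<^sup>1\<close> substitute for the excess \<open>(s - k)\<^sub>+\<close>, because the chain rule above is for \<open>C\<^sup>1\<close> functions.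
  The parameter \<open>\<epsilon>\<close> will be the distance to the next level, above which the substitute is at least
  a fixed fraction of \<open>\<epsilon>\<close>.\<close>

definition smooth_excess :: "real \<Rightarrow> real \<Rightarrow> real \<Rightarrow> real" where
  "smooth_excess k \<epsilon> s = sqrt (\<epsilon>\<^sup>2 + (max 0 (s - k))\<^sup>2) - \<epsilon>"

definition smooth_excess_deriv :: "real \<Rightarrow> real \<Rightarrow> real \<Rightarrow> real" where
  "smooth_excess_deriv k \<epsilon> s = max 0 (s - k) / sqrt (\<epsilon>\<^sup>2 + (max 0 (s - k))\<^sup>2)"

lemma smooth_excess_props:
  assumes "\<epsilon> > 0"
  shows "(smooth_excess k \<epsilon> has_real_derivative smooth_excess_deriv k \<epsilon> s) (at s)"
    and "continuous_on UNIV (smooth_excess_deriv k \<epsilon>)"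
    and "0 \<le> smooth_excess_deriv k \<epsilon> s" "smooth_excess_deriv k \<epsilon> s \<le> 1" "0 \<le> smooth_excess k \<epsilon> s"
    and "s \<le> k \<Longrightarrow> smooth_excess k \<epsilon> s = 0" "k + \<epsilon> \<le> s \<Longrightarrow> \<epsilon> / 3 \<le> smooth_excess k \<epsilon> s"
proof -
  have pos: "\<epsilon>\<^sup>2 + (max 0 (s - k))\<^sup>2 > 0" for s using assms by (simp add: add_pos_nonneg)
  have d: "((\<lambda>s. (max 0 (s - k))\<^sup>2) has_real_derivative 2 * max 0 (s - k) * 1) (at s)"
    by (rule DERIV_chain2[OF has_real_derivative_positive_part_squared]) (auto intro!: derivative_eq_intros)
  show "(smooth_excess k \<epsilon> has_real_derivative smooth_excess_deriv k \<epsilon> s) (at s)"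
  proof -
    have "((\<lambda>s. sqrt (\<epsilon>\<^sup>2 + (max 0 (s - k))\<^sup>2)) has_real_derivative
        inverse (sqrt (\<epsilon>\<^sup>2 + (max 0 (s - k))\<^sup>2)) / 2 * (0 + 2 * max 0 (s - k) * 1)) (at s)"
      by (rule DERIV_chain2[OF DERIV_real_sqrt[OF pos] DERIV_add[OF DERIV_const d]])
    from DERIV_diff[OF this DERIV_const[of \<epsilon>]]
    have "((\<lambda>s. sqrt (\<epsilon>\<^sup>2 + (max 0 (s - k))\<^sup>2) - \<epsilon>) has_real_derivative smooth_excess_deriv k \<epsilon> s) (at s)"
      by (rule DERIV_cong) (simp only: smooth_excess_deriv_def divide_inverse, simp)
    then show ?thesis unfolding smooth_excess_def[abs_def] .
  qed
  show "continuous_on UNIV (smooth_excess_deriv k \<epsilon>)"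
  proof -
    have "sqrt (\<epsilon>\<^sup>2 + (max 0 (s - k))\<^sup>2) \<noteq> 0" for s using real_sqrt_gt_zero[OF pos[of s]] by linarith
    then show ?thesis unfolding smooth_excess_deriv_def[abs_def] by (intro continuous_intros ballI)
  qed
  show "0 \<le> smooth_excess_deriv k \<epsilon> s" unfolding smooth_excess_deriv_def by simp
  have "max 0 (s - k) \<le> sqrt (\<epsilon>\<^sup>2 + (max 0 (s - k))\<^sup>2)" by (rule real_le_rsqrt) simp
  then show "smooth_excess_deriv k \<epsilon> s \<le> 1" unfolding smooth_excess_deriv_def using pos[of s] by simp
  have "\<epsilon> \<le> sqrt (\<epsilon>\<^sup>2 + (max 0 (s - k))\<^sup>2)" by (rule real_le_rsqrt) simp
  then show "0 \<le> smooth_excess k \<epsilon> s" unfolding smooth_excess_def by simp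
  show "smooth_excess k \<epsilon> s = 0" if "s \<le> k" using that assms unfolding smooth_excess_def by (simp add: max_def)
  show "\<epsilon> / 3 \<le> smooth_excess k \<epsilon> s" if "k + \<epsilon> \<le> s"
  proof -
    have "\<epsilon>\<^sup>2 \<le> (max 0 (s - k))\<^sup>2" using that assms by (intro power_mono) auto
    moreover have "(\<epsilon> + \<epsilon> / 3)\<^sup>2 = 16 / 9 * \<epsilon>\<^sup>2" by (simp add: power2_eq_square field_simps)
    ultimately have "(\<epsilon> + \<epsilon> / 3)\<^sup>2 \<le> \<epsilon>\<^sup>2 + (max 0 (s - k))\<^sup>2"
      using zero_le_power2[of \<epsilon>] by linarith
    then have "\<epsilon> + \<epsilon> / 3 \<le> sqrt (\<epsilon>\<^sup>2 + (max 0 (s - k))\<^sup>2)" by (rule real_le_rsqrt)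
    then show ?thesis unfolding smooth_excess_def by simp
  qed
qed

text \<open>A weak solution of \<open>-div A = h\<close> with \<open>v = 0\<close> on the boundary and \<open>G = \<nabla>v\<close>.  The flux \<open>A\<close> stands for
  \<open>M\<nabla>v\<close>; as a separate argument it makes the notion linear, so that differences of solutions are
  covered.\<close>

definition weak_solution :: "(real ^ 'n) set \<Rightarrow> (real ^ 'n \<Rightarrow> real) \<Rightarrow> (real ^ 'n \<Rightarrow> real ^ 'n)
    \<Rightarrow> (real ^ 'n \<Rightarrow> real ^ 'n) \<Rightarrow> (real ^ 'n \<Rightarrow> real) \<Rightarrow> bool" where
  "weak_solution \<Omega> v G A h \<longleftrightarrow> H10 \<Omega> v G \<and> square_integrable (lebesgue_on \<Omega>) A \<and>
     square_integrable (lebesgue_on \<Omega>) h \<and>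
     (\<forall>w W. H10 \<Omega> w W \<longrightarrow> (\<integral>x. A x \<bullet> W x \<partial>lebesgue_on \<Omega>) = (\<integral>x. h x * w x \<partial>lebesgue_on \<Omega>))"

context bounded_open
begin

text \<open>The Nash inequality at a radius whose ball has at least twice the measure of \<open>A\<close>: by Cauchy-Schwarz
  \<open>(\<integral>w)\<^sup>2 \<le> |A| \<integral>w\<^sup>2\<close>, so the \<open>L\<^sup>1\<close> term is absorbed by half of \<open>\<integral>w\<^sup>2\<close>.\<close>

lemma level_set_estimate:
  assumes H: "H10 \<Omega> w W" and w0: "AE x in \<mu>. 0 \<le> w x"
    and A: "A \<in> sets \<mu>" "AE x in \<mu>. x \<notin> A \<longrightarrow> w x = 0"
    and energy: "(\<integral>x. (norm (W x))\<^sup>2 \<partial>\<mu>) \<le> c * (\<integral>x. w x \<partial>\<mu>)" "c \<ge> 0"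
    and r: "r > 0" "2 * measure \<mu> A \<le> measure lborel (ball (0::real^'n) r)"
  shows "(\<integral>x. w x \<partial>\<mu>) \<le> c * r\<^sup>2 * measure \<mu> A"
proof -
  define I where "I = (\<integral>x. w x \<partial>\<mu>)"
  define S where "S = (\<integral>x. (w x)\<^sup>2 \<partial>\<mu>)"
  define V where "V = measure lborel (ball (0::real^'n) r)"
  define m where "m = measure \<mu> A"
  have V: "V > 0" unfolding V_def using content_ball_pos[OF r(1)] by simp
  have sw: "square_integrable \<mu> w" using H10_square_integrable[OF H] by simp
  have [measurable]: "w \<in> borel_measurable \<mu>" using sw by (simp add: square_integrable_def)
  have I0: "I \<ge> 0" unfolding I_def using w0 by (rule integral_nonneg_AE)
  have S0: "S \<ge> 0" unfolding S_def by (intro integral_nonneg_AE) auto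
  have Iabs: "(\<integral>x. \<bar>w x\<bar> \<partial>\<mu>) = I" unfolding I_def
    by (intro integral_cong_AE) (use w0 in auto)
  have sA: "square_integrable \<mu> (indicator A :: _ \<Rightarrow> real)"
    by (rule square_integrable_bounded[of _ 1]) (use A(1) in \<open>auto simp: indicator_def\<close>)
  have "(\<integral>x. norm (w x) * norm (indicator A x :: real) \<partial>\<mu>) = I" unfolding I_def
    by (intro integral_cong_AE) (use A w0 in \<open>auto simp: indicator_def elim!: eventually_elim2[OF w0]\<close>)
  moreover have "(\<integral>x. (norm (indicator A x :: real))\<^sup>2 \<partial>\<mu>) = m"
  proof -
    have "(\<lambda>x. (norm (indicator A x :: real))\<^sup>2) = indicator A" by (auto simp: fun_eq_iff indicator_def)
    then show ?thesis using sets.sets_into_space[OF A(1)] unfolding m_def by (simp add: Int_absorb2)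
  qed
  ultimately have CS: "I\<^sup>2 \<le> S * m" using Cauchy_Schwarz_integral[OF sw sA] unfolding S_def by simp
  have "S \<le> r\<^sup>2 / 2 * (\<integral>x. (norm (W x))\<^sup>2 \<partial>\<mu>) + I\<^sup>2 / V"
    using nash_inequality_H10[OF H r(1)] unfolding S_def V_def Iabs .
  also have "\<dots> \<le> r\<^sup>2 / 2 * (c * I) + S / 2"
  proof (rule add_mono)
    show "r\<^sup>2 / 2 * (\<integral>x. (norm (W x))\<^sup>2 \<partial>\<mu>) \<le> r\<^sup>2 / 2 * (c * I)"
      using energy(1) unfolding I_def by (intro mult_left_mono) auto
    have "I\<^sup>2 \<le> S * (V / 2)" using CS r(2) S0 unfolding m_def V_def
      by (smt (verit) mult_left_mono field_sum_of_halves)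
    then show "I\<^sup>2 / V \<le> S / 2" using V by (simp add: pos_divide_le_eq)
  qed
  finally have "S \<le> r\<^sup>2 * c * I" by (simp add: field_simps)
  then have "I\<^sup>2 \<le> (r\<^sup>2 * c * I) * m" using CS unfolding m_def by (smt (verit) mult_right_mono measure_nonneg)
  then have "I * I \<le> I * (c * r\<^sup>2 * m)" by (simp add: power2_eq_square mult_ac)
  moreover have "0 \<le> c * r\<^sup>2 * m" using energy(2) unfolding m_def by simp
  ultimately have "I \<le> c * r\<^sup>2 * m" using I0 by (cases "I = 0") auto
  then show ?thesis unfolding I_def m_def .
qed

text \<open>Stampacchia's truncation argument.  Testing with the smooth excess \<open>w\<close> of \<open>v\<close> over a level \<open>k \<ge> k0\<close>
  bounds \<open>\<alpha>\<integral>|\<nabla>w|\<^sup>2\<close> by \<open>F\<integral>w\<close>, because the slope of the excess is at most \<open>1\<close>.  The level set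
  estimate with \<open>r\<^sup>N\<close> proportional to \<open>a(k) = |{v > k}|\<close> turns this into
  \<open>\<integral>w \<le> const F a(k)\<^sup>1\<^sup>+\<^sup>2\<^sup>/\<^sup>N\<close>, which is the hypothesis of Stampacchia's lemma.  The constant is
  proportional to \<open>F\<close>, and \<open>C\<close> depends on \<open>\<Omega>\<close> and \<open>\<alpha>\<close> alone: the limit \<open>n \<rightarrow> \<infinity>\<close> rests on both.\<close>

lemma sup_bound:
  assumes "\<alpha> > 0"
  obtains C where "C > 0" "\<And>v G A h k0 F. weak_solution \<Omega> v G A h \<Longrightarrow>
     AE x in \<mu>. \<alpha> * (norm (G x))\<^sup>2 \<le> A x \<bullet> G x \<Longrightarrow> 0 \<le> k0 \<Longrightarrow> 0 < F \<Longrightarrow>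
     AE x in \<mu>. v x > k0 \<longrightarrow> h x \<le> F \<Longrightarrow> AE x in \<mu>. v x \<le> k0 + C * F"
proof -
  define N where "N = real CARD('n)"
  define b where "b = measure lborel (ball (0::real^'n) 1)"
  define \<delta> where "\<delta> = 2 / N"
  define \<kappa> where "\<kappa> = (2 / b) powr \<delta>"
  \<comment> \<open>Adding \<open>1\<close> keeps the bound on \<open>a k0\<close> positive.\<close>
  define S where "S = measure \<mu> \<Omega> + 1"
  define C where "C = (3 * \<kappa> / \<alpha>) * S powr \<delta> * 2 powr (1 + 1 / \<delta>)"
  have N: "N > 0" unfolding N_def by simp
  have b: "b > 0" unfolding b_def using content_ball_pos[of 1 "0::real^'n"] by simp
  have S: "S > 0" unfolding S_def by (smt (verit) measure_nonneg)
  have \<delta>: "\<delta> > 0" unfolding \<delta>_def using N by simp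
  have \<kappa>: "\<kappa> > 0" unfolding \<kappa>_def using b by simp
  show ?thesis
  proof (rule that)
    show "C > 0" unfolding C_def using \<kappa> S assms by simp
    fix v G A h and k0 F :: real
    assume sol: "weak_solution \<Omega> v G A h" and ell: "AE x in \<mu>. \<alpha> * (norm (G x))\<^sup>2 \<le> A x \<bullet> G x"
      and k0: "0 \<le> k0" and F: "0 < F" and hF: "AE x in \<mu>. v x > k0 \<longrightarrow> h x \<le> F"
    have H: "H10 \<Omega> v G" and sA: "square_integrable \<mu> A" and sh: "square_integrable \<mu> h"
      and weak: "\<And>w W. H10 \<Omega> w W \<Longrightarrow> (\<integral>x. A x \<bullet> W x \<partial>\<mu>) = (\<integral>x. h x * w x \<partial>\<mu>)"
      using sol unfolding weak_solution_def by auto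
    have [measurable]: "v \<in> borel_measurable \<mu>" "G \<in> borel_measurable \<mu>"
      using H10_square_integrable[OF H] by (auto simp: square_integrable_def)
    define a where "a = (\<lambda>k. measure \<mu> {x \<in> space \<mu>. v x > k})"
    have sets: "{x \<in> space \<mu>. v x > k} \<in> sets \<mu>" for k by measurable
    have step: "(k' - k) * a k' \<le> 3 * F * \<kappa> / \<alpha> * a k powr (1 + \<delta>)" if k: "k0 \<le> k" "k < k'" for k k'
    proof -
      define \<epsilon> where "\<epsilon> = k' - k"
      have \<epsilon>: "\<epsilon> > 0" using k unfolding \<epsilon>_def by simp
      note T = smooth_excess_props[OF \<epsilon>]
      define w where "w = (\<lambda>x. smooth_excess k \<epsilon> (v x))"
      define W where "W = (\<lambda>x. smooth_excess_deriv k \<epsilon> (v x) *\<^sub>R G x)"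
      have Hw: "H10 \<Omega> w W" unfolding w_def W_def
      proof (rule H10_comp[OF H T(1,2)])
        show "smooth_excess k \<epsilon> 0 = 0" using k k0 T(6) by simp
        show "\<bar>smooth_excess_deriv k \<epsilon> s\<bar> \<le> 1" for s using T(3,4)[of k s] by simp
      qed
      have sw: "square_integrable \<mu> w" "square_integrable \<mu> W" using H10_square_integrable[OF Hw] by auto
      have iw: "integrable \<mu> w" by (rule square_integrable_L1[OF sw(1) finite_measure_axioms])
      have ihw: "integrable \<mu> (\<lambda>x. h x * w x)" using integrable_inner[OF sh sw(1)] by simp
      have iW: "integrable \<mu> (\<lambda>x. (norm (W x))\<^sup>2)" using sw by (simp add: square_integrable_def)
      have w0: "0 \<le> w x" for x unfolding w_def by (rule T(5))
      have "\<alpha> * (\<integral>x. (norm (W x))\<^sup>2 \<partial>\<mu>) = (\<integral>x. \<alpha> * (norm (W x))\<^sup>2 \<partial>\<mu>)" by simp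
      also have "\<dots> \<le> (\<integral>x. A x \<bullet> W x \<partial>\<mu>)"
      proof (rule integral_mono_AE[OF integrable_mult_right[OF iW] integrable_inner[OF sA sw(2)]])
        show "AE x in \<mu>. \<alpha> * (norm (W x))\<^sup>2 \<le> A x \<bullet> W x"
          using ell
        proof eventually_elim
          case (elim x)
          let ?t = "smooth_excess_deriv k \<epsilon> (v x)"
          have t: "0 \<le> ?t" "?t \<le> 1" by (rule T)+
          have "\<alpha> * (norm (W x))\<^sup>2 = ?t * (?t * (\<alpha> * (norm (G x))\<^sup>2))"
            unfolding W_def by (simp add: power_mult_distrib power2_eq_square)
          also have "\<dots> \<le> 1 * (?t * (\<alpha> * (norm (G x))\<^sup>2))"
            using t assms by (intro mult_right_mono) auto
          also have "\<dots> \<le> ?t * (A x \<bullet> G x)" using elim t by (simp add: mult_left_mono)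
          finally show ?case unfolding W_def by simp
        qed
      qed
      also have "\<dots> = (\<integral>x. h x * w x \<partial>\<mu>)" by (rule weak[OF Hw])
      also have "\<dots> \<le> (\<integral>x. F * w x \<partial>\<mu>)"
      proof (rule integral_mono_AE[OF ihw integrable_mult_right[OF iw]])
        show "AE x in \<mu>. h x * w x \<le> F * w x"
          using hF
        proof eventually_elim
          case (elim x)
          show ?case
          proof (cases "v x > k0")
            case True then show ?thesis using elim w0[of x] by (simp add: mult_right_mono)
          next
            case False then have "w x = 0" unfolding w_def using k by (intro T(6)) auto
            then show ?thesis by simp
          qed
        qed
      qed
      finally have en: "(\<integral>x. (norm (W x))\<^sup>2 \<partial>\<mu>) \<le> F / \<alpha> * (\<integral>x. w x \<partial>\<mu>)"
        using assms by (simp add: field_simps)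
      have wle: "(\<integral>x. w x \<partial>\<mu>) \<le> F / \<alpha> * (\<kappa> * a k powr (1 + \<delta>))"
      proof (cases "a k = 0")
        case True
        have "(\<integral>x. w x \<partial>\<mu>) \<le> F / \<alpha> * 1\<^sup>2 * measure \<mu> {x \<in> space \<mu>. v x > k}"
        proof (rule level_set_estimate[OF Hw _ sets _ en])
          show "AE x in \<mu>. x \<notin> {x \<in> space \<mu>. v x > k} \<longrightarrow> w x = 0"
            using T(6)[of "v _" k] by (auto simp: w_def)
          show "2 * measure \<mu> {x \<in> space \<mu>. v x > k} \<le> measure lborel (ball (0::real^'n) 1)"
            using True b unfolding a_def b_def by simp
        qed (use w0 F assms in auto)
        then show ?thesis using True unfolding a_def by simp
      next
        case False
        then have ak: "a k > 0" unfolding a_def by (simp add: zero_less_measure_iff)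
        define r where "r = (2 * a k / b) powr (1 / N)"
        have r: "r > 0" unfolding r_def using ak b by simp
        have "r ^ CARD('n) = (2 * a k / b)"
          unfolding r_def using ak b N
          by (simp add: powr_realpow[symmetric] powr_powr N_def)
        then have V: "measure lborel (ball (0::real^'n) r) = 2 * a k"
          using content_ball_conv_unit_ball[of r "0::real^'n"] r b unfolding b_def by simp
        have "(\<integral>x. w x \<partial>\<mu>) \<le> F / \<alpha> * r\<^sup>2 * measure \<mu> {x \<in> space \<mu>. v x > k}"
        proof (rule level_set_estimate[OF Hw _ sets _ en])
          show "AE x in \<mu>. x \<notin> {x \<in> space \<mu>. v x > k} \<longrightarrow> w x = 0"
            using T(6)[of "v _" k] by (auto simp: w_def)
          show "2 * measure \<mu> {x \<in> space \<mu>. v x > k} \<le> measure lborel (ball (0::real^'n) r)"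
            using V unfolding a_def by simp
        qed (use w0 F assms r in auto)
        also have "r\<^sup>2 = \<kappa> * a k powr \<delta>"
        proof -
          have "r\<^sup>2 = (2 / b * a k) powr \<delta>" unfolding r_def \<delta>_def using ak b
            by (simp add: powr_realpow[symmetric] powr_powr)
          then show ?thesis unfolding \<kappa>_def using powr_mult[of "2 / b" "a k" \<delta>] ak b by simp
        qed
        finally show ?thesis using ak unfolding a_def[symmetric] by (simp add: powr_add a_def mult_ac)
      qed
      have "\<epsilon> / 3 * a k' = (\<integral>x. \<epsilon> / 3 * indicator {x \<in> space \<mu>. v x > k'} x \<partial>\<mu>)"
        unfolding a_def using sets[of k'] sets.sets_into_space[OF sets[of k']] by (simp add: Int_absorb2)
      also have "\<dots> \<le> (\<integral>x. w x \<partial>\<mu>)"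
      proof (rule integral_mono[OF _ iw])
        show "integrable \<mu> (\<lambda>x. \<epsilon> / 3 * indicator {x \<in> space \<mu>. v x > k'} x)"
          by (intro integrable_mult_right integrable_real_indicator sets) (simp add: less_top[symmetric])
        show "\<epsilon> / 3 * indicator {x \<in> space \<mu>. v x > k'} x \<le> w x" for x
          using T(7)[of k "v x"] w0[of x] unfolding w_def by (auto simp: indicator_def \<epsilon>_def)
      qed
      also note wle
      finally show ?thesis unfolding \<epsilon>_def by (simp add: field_simps)
    qed
    have "a (k0 + (3 * F * \<kappa> / \<alpha>) * S powr \<delta> * 2 powr (1 + 1 / \<delta>)) = 0"
    proof (rule Stampacchia_iteration[OF _ _ step])
      show "a k' \<le> a k" if "k \<le> k'" for k k'
        unfolding a_def by (rule finite_measure_mono[OF _ sets]) (use that in auto)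
      show "a k0 \<le> S" unfolding a_def S_def using finite_measure_mono[of "{x \<in> space \<mu>. v x > k0}" \<Omega>] by fastforce
    qed (use F \<kappa> \<delta> S assms in \<open>auto simp: a_def\<close>)
    moreover have "(3 * F * \<kappa> / \<alpha>) * S powr \<delta> * 2 powr (1 + 1 / \<delta>) = C * F" unfolding C_def by simp
    ultimately have "measure \<mu> {x \<in> space \<mu>. v x > k0 + C * F} = 0" unfolding a_def by simp
    then have "emeasure \<mu> {x \<in> space \<mu>. v x > k0 + C * F} = 0" by (simp add: emeasure_eq_measure)
    then have "{x \<in> space \<mu>. v x > k0 + C * F} \<in> null_sets \<mu>" using sets by (intro null_setsI) auto
    then show "AE x in \<mu>. v x \<le> k0 + C * F"
      by (rule AE_I'[where P="\<lambda>x. v x \<le> k0 + C * F"]) auto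
  qed
qed

lemma weak_solution_diff:
  assumes "weak_solution \<Omega> v G A h" "weak_solution \<Omega> v' G' A' h'"
  shows "weak_solution \<Omega> (\<lambda>x. v x - v' x) (\<lambda>x. G x - G' x) (\<lambda>x. A x - A' x) (\<lambda>x. h x - h' x)"
  unfolding weak_solution_def
proof (intro conjI allI impI)
  fix w W assume H: "H10 \<Omega> w W"
  note sw = H10_square_integrable[OF H]
  have "integrable \<mu> (\<lambda>x. A x \<bullet> W x)" "integrable \<mu> (\<lambda>x. A' x \<bullet> W x)"
     "integrable \<mu> (\<lambda>x. h x * w x)" "integrable \<mu> (\<lambda>x. h' x * w x)"
    using assms sw integrable_inner[where f=h and g=w] integrable_inner[where f=h' and g=w]
    by (auto simp: weak_solution_def intro!: integrable_inner)
  then show "(\<integral>x. (A x - A' x) \<bullet> W x \<partial>\<mu>) = (\<integral>x. (h x - h' x) * w x \<partial>\<mu>)"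
    using assms H by (simp add: weak_solution_def inner_diff_left left_diff_distrib)
qed (use assms in \<open>auto simp: weak_solution_def intro: H10_diff square_integrable_diff\<close>)

text \<open>The difference of the solutions has a nonpositive datum above the level \<open>k\<close>, so the supremum bound
  applies to it with every \<open>F > 0\<close>.\<close>

lemma comparison:
  assumes "\<alpha> > 0" and sol: "weak_solution \<Omega> v G A h" "weak_solution \<Omega> v' G' A' h'"
    and ell: "AE x in \<mu>. \<alpha> * (norm (G x - G' x))\<^sup>2 \<le> (A x - A' x) \<bullet> (G x - G' x)"
    and "0 \<le> k" and le: "AE x in \<mu>. v x - v' x > k \<longrightarrow> h x \<le> h' x"
  shows "AE x in \<mu>. v x - v' x \<le> k"
proof -
  obtain C where C: "C > 0" "\<And>v G A h k0 F. weak_solution \<Omega> v G A h \<Longrightarrow>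
     AE x in \<mu>. \<alpha> * (norm (G x))\<^sup>2 \<le> A x \<bullet> G x \<Longrightarrow> 0 \<le> k0 \<Longrightarrow> 0 < F \<Longrightarrow>
     AE x in \<mu>. v x > k0 \<longrightarrow> h x \<le> F \<Longrightarrow> AE x in \<mu>. v x \<le> k0 + C * F"
    using sup_bound[OF \<open>\<alpha> > 0\<close>] by blast
  have "AE x in \<mu>. v x - v' x \<le> k + C * inverse (real (Suc j))" for j
  proof (rule C(2)[OF weak_solution_diff[OF sol] ell \<open>0 \<le> k\<close>])
    show "AE x in \<mu>. k < v x - v' x \<longrightarrow> h x - h' x \<le> inverse (real (Suc j))"
      using le
    proof eventually_elim
      case (elim x)
      have "0 < inverse (real (Suc j))" by simp
      then show ?case using elim by (smt (verit))
    qed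
  qed simp
  then have "AE x in \<mu>. \<forall>j. v x - v' x \<le> k + C * inverse (real (Suc j))" by (simp add: AE_all_countable)
  then show ?thesis
  proof eventually_elim
    case (elim x)
    have "(\<lambda>j. k + C * inverse (real (Suc j))) \<longlonglongrightarrow> k + C * 0" by (intro tendsto_intros LIMSEQ_inverse_real_of_nat)
    then show ?case using elim by (intro LIMSEQ_le_const[where X="\<lambda>j. k + C * inverse (real (Suc j))"]) auto
  qed
qed

text \<open>A Caccioppoli estimate for bounded supersolutions.  Since \<open>h \<ge> 0\<close> and the test function \<open>\<phi>\<^sup>2(K - v)\<close> is
  nonnegative, the weak formulation bounds \<open>\<integral>\<phi>\<^sup>2|\<nabla>v|\<^sup>2\<close>; testing with \<open>\<phi>\<^sup>2\<close> then bounds the local mass of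
  \<open>h\<close> by a quantity in which \<open>h\<close> does not occur.\<close>

lemma local_mass_bound:
  assumes "\<alpha> > 0" "\<beta> > 0" and sol: "weak_solution \<Omega> v G A h"
    and ell: "AE x in \<mu>. \<alpha> * (norm (G x))\<^sup>2 \<le> A x \<bullet> G x"
    and bd: "AE x in \<mu>. norm (A x) \<le> \<beta> * norm (G x)"
    and v: "AE x in \<mu>. 0 \<le> v x \<and> v x \<le> K" and h: "AE x in \<mu>. 0 \<le> h x"
    and \<phi>: "C1c \<Omega> \<phi> D"
  shows "(\<integral>x. h x * (\<phi> x)\<^sup>2 \<partial>\<mu>) \<le> \<beta> * (4 * \<beta>\<^sup>2 * K\<^sup>2 / \<alpha>\<^sup>2 + 1) * (\<integral>x. (norm (D x))\<^sup>2 \<partial>\<mu>)"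
proof -
  have H: "H10 \<Omega> v G" and sA: "square_integrable \<mu> A" and sh: "square_integrable \<mu> h"
    and weak: "\<And>w W. H10 \<Omega> w W \<Longrightarrow> (\<integral>x. A x \<bullet> W x \<partial>\<mu>) = (\<integral>x. h x * w x \<partial>\<mu>)"
    using sol unfolding weak_solution_def by auto
  note H\<phi> = H10_C1c[OF \<phi>]
  have H2: "H10 \<Omega> (\<lambda>x. \<phi> x * \<phi> x) (\<lambda>x. \<phi> x *\<^sub>R D x + \<phi> x *\<^sub>R D x)" by (rule H10_mult_C1c[OF \<phi> H\<phi>])
  have H3: "H10 \<Omega> (\<lambda>x. \<phi> x * (\<phi> x * v x)) (\<lambda>x. \<phi> x *\<^sub>R (\<phi> x *\<^sub>R G x + v x *\<^sub>R D x) + (\<phi> x * v x) *\<^sub>R D x)"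
    by (rule H10_mult_C1c[OF \<phi> H10_mult_C1c[OF \<phi> H]])
  obtain B where B: "B > 0" "\<And>x. \<bar>\<phi> x\<bar> \<le> B" "\<And>x. norm (D x) \<le> B" using C1c_bounded[OF \<phi>] by metis
  have [measurable]: "\<phi> \<in> borel_measurable \<mu>" "D \<in> borel_measurable \<mu>"
    by (auto intro!: borel_imp_measurable_domain C1c_measurable[OF \<phi>])
  have [measurable]: "v \<in> borel_measurable \<mu>" "G \<in> borel_measurable \<mu>"
    using H10_square_integrable[OF H] by (auto simp: square_integrable_def)
  have s\<phi>G: "square_integrable \<mu> (\<lambda>x. \<phi> x *\<^sub>R G x)"
    by (rule square_integrable_bound[OF _ H10_square_integrable(2)[OF H], where C=B])
       (use B in \<open>auto intro!: mult_right_mono\<close>)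
  have iD: "integrable \<mu> (\<lambda>x. (norm (D x))\<^sup>2)" using C1c_square_integrable[OF \<phi>] by (simp add: square_integrable_def)
  have iG: "integrable \<mu> (\<lambda>x. (norm (\<phi> x *\<^sub>R G x))\<^sup>2)" using s\<phi>G by (simp add: square_integrable_def)
  define J where "J = (\<integral>x. (norm (D x))\<^sup>2 \<partial>\<mu>)"
  define E where "E = (\<integral>x. (norm (\<phi> x *\<^sub>R G x))\<^sup>2 \<partial>\<mu>)"
  let ?W2 = "\<lambda>x. \<phi> x *\<^sub>R D x + \<phi> x *\<^sub>R D x"
  let ?W3 = "\<lambda>x. \<phi> x *\<^sub>R (\<phi> x *\<^sub>R G x + v x *\<^sub>R D x) + (\<phi> x * v x) *\<^sub>R D x"
  have i2: "integrable \<mu> (\<lambda>x. A x \<bullet> ?W2 x)" "integrable \<mu> (\<lambda>x. h x * (\<phi> x * \<phi> x))"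
    using integrable_inner[OF sA H10_square_integrable(2)[OF H2]] integrable_inner[OF sh H10_square_integrable(1)[OF H2]] by auto
  have i3: "integrable \<mu> (\<lambda>x. A x \<bullet> ?W3 x)" "integrable \<mu> (\<lambda>x. h x * (\<phi> x * (\<phi> x * v x)))"
    using integrable_inner[OF sA H10_square_integrable(2)[OF H3]] integrable_inner[OF sh H10_square_integrable(1)[OF H3]] by auto
  \<comment> \<open>The weak formulation with \<open>K\<phi>\<^sup>2\<close> minus the one with \<open>\<phi>\<^sup>2v\<close>.\<close>
  have "0 \<le> (\<integral>x. K * (h x * (\<phi> x * \<phi> x)) - h x * (\<phi> x * (\<phi> x * v x)) \<partial>\<mu>)"
  proof (rule integral_nonneg_AE)
    show "AE x in \<mu>. 0 \<le> K * (h x * (\<phi> x * \<phi> x)) - h x * (\<phi> x * (\<phi> x * v x))"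
      using v h
    proof eventually_elim
      case (elim x)
      have "0 \<le> (K - v x) * (h x * (\<phi> x * \<phi> x))" using elim by auto
      then show ?case by (simp add: algebra_simps)
    qed
  qed
  also have "\<dots> = K * (\<integral>x. A x \<bullet> ?W2 x \<partial>\<mu>) - (\<integral>x. A x \<bullet> ?W3 x \<partial>\<mu>)"
    unfolding weak[OF H2] weak[OF H3] using i2 i3 by simp
  also have "\<dots> = (\<integral>x. K * (A x \<bullet> ?W2 x) - A x \<bullet> ?W3 x \<partial>\<mu>)" using i2 i3 by simp
  also have "\<dots> \<le> (\<integral>x. - (\<alpha> / 2) * (norm (\<phi> x *\<^sub>R G x))\<^sup>2 + (2 * \<beta>\<^sup>2 * K\<^sup>2 / \<alpha>) * (norm (D x))\<^sup>2 \<partial>\<mu>)"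
  proof (rule integral_mono_AE)
    show "AE x in \<mu>. K * (A x \<bullet> ?W2 x) - A x \<bullet> ?W3 x
        \<le> - (\<alpha> / 2) * (norm (\<phi> x *\<^sub>R G x))\<^sup>2 + (2 * \<beta>\<^sup>2 * K\<^sup>2 / \<alpha>) * (norm (D x))\<^sup>2"
      using ell bd v
    proof eventually_elim
      case (elim x)
      define g where "g = \<bar>\<phi> x\<bar> * norm (G x)"
      define d where "d = norm (D x)"
      have gd: "g \<ge> 0" "d \<ge> 0" unfolding g_def d_def by auto
      have K: "K \<ge> 0" using elim by linarith
      have eq: "K * (A x \<bullet> ?W2 x) - A x \<bullet> ?W3 x = 2 * (\<phi> x * (K - v x)) * (A x \<bullet> D x) - (\<phi> x)\<^sup>2 * (A x \<bullet> G x)"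
        by (simp only: inner_add_right inner_scaleR_right) (simp add: algebra_simps power2_eq_square)
      have "(\<phi> x * (K - v x)) * (A x \<bullet> D x) \<le> \<bar>\<phi> x * (K - v x)\<bar> * \<bar>A x \<bullet> D x\<bar>"
        by (metis abs_ge_self abs_mult)
      also have "\<dots> \<le> (\<bar>\<phi> x\<bar> * K) * ((\<beta> * norm (G x)) * d)"
      proof (rule mult_mono)
        show "\<bar>\<phi> x * (K - v x)\<bar> \<le> \<bar>\<phi> x\<bar> * K" using elim by (simp add: abs_mult mult_left_mono)
        have "\<bar>A x \<bullet> D x\<bar> \<le> norm (A x) * d" unfolding d_def by (rule Cauchy_Schwarz_ineq2)
        also have "\<dots> \<le> (\<beta> * norm (G x)) * d" using elim gd by (intro mult_right_mono) auto
        finally show "\<bar>A x \<bullet> D x\<bar> \<le> (\<beta> * norm (G x)) * d" .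
      qed (use K in auto)
      also have "\<dots> = \<beta> * K * (g * d)" unfolding g_def by simp
      finally have 1: "(\<phi> x * (K - v x)) * (A x \<bullet> D x) \<le> \<beta> * K * (g * d)" .
      have 2: "\<alpha> * g\<^sup>2 \<le> (\<phi> x)\<^sup>2 * (A x \<bullet> G x)"
      proof -
        have "(\<phi> x)\<^sup>2 * (\<alpha> * (norm (G x))\<^sup>2) \<le> (\<phi> x)\<^sup>2 * (A x \<bullet> G x)" using elim by (intro mult_left_mono) auto
        then show ?thesis unfolding g_def by (simp add: power_mult_distrib mult_ac)
      qed
      have "0 \<le> (\<alpha> * g - 2 * \<beta> * K * d)\<^sup>2 / (2 * \<alpha>)" using assms(1) by simp
      also have "\<dots> = \<alpha> / 2 * g\<^sup>2 + (2 * \<beta>\<^sup>2 * K\<^sup>2 / \<alpha>) * d\<^sup>2 - 2 * (\<beta> * K * (g * d))"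
        using assms(1) by (simp add: power2_eq_square field_simps)
      finally have 3: "2 * (\<beta> * K * (g * d)) \<le> \<alpha> / 2 * g\<^sup>2 + (2 * \<beta>\<^sup>2 * K\<^sup>2 / \<alpha>) * d\<^sup>2" by simp
      have "(norm (\<phi> x *\<^sub>R G x))\<^sup>2 = g\<^sup>2" unfolding g_def by simp
      then show ?case unfolding eq using 1 2 3 by (simp add: d_def)
    qed
    show "integrable \<mu> (\<lambda>x. - (\<alpha> / 2) * (norm (\<phi> x *\<^sub>R G x))\<^sup>2 + (2 * \<beta>\<^sup>2 * K\<^sup>2 / \<alpha>) * (norm (D x))\<^sup>2)"
      by (intro Bochner_Integration.integrable_add integrable_mult_right iG iD)
    show "integrable \<mu> (\<lambda>x. K * (A x \<bullet> ?W2 x) - A x \<bullet> ?W3 x)"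
      by (intro Bochner_Integration.integrable_diff integrable_mult_right i2 i3)
  qed
  also have "\<dots> = - (\<alpha> / 2) * E + (2 * \<beta>\<^sup>2 * K\<^sup>2 / \<alpha>) * J"
    unfolding E_def J_def by (subst Bochner_Integration.integral_add) (auto intro!: integrable_mult_right iG iD simp del: norm_scaleR)
  finally have "\<alpha> / 2 * E \<le> (2 * \<beta>\<^sup>2 * K\<^sup>2 / \<alpha>) * J" by simp
  then have E: "E \<le> 4 * \<beta>\<^sup>2 * K\<^sup>2 / \<alpha>\<^sup>2 * J" using assms(1) by (simp add: field_simps power2_eq_square)
  have "(\<integral>x. h x * (\<phi> x)\<^sup>2 \<partial>\<mu>) = (\<integral>x. A x \<bullet> ?W2 x \<partial>\<mu>)" using weak[OF H2] by (simp add: power2_eq_square)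
  also have "\<dots> \<le> (\<integral>x. \<beta> * (norm (\<phi> x *\<^sub>R G x))\<^sup>2 + \<beta> * (norm (D x))\<^sup>2 \<partial>\<mu>)"
  proof (rule integral_mono_AE[OF i2(1)])
    show "integrable \<mu> (\<lambda>x. \<beta> * (norm (\<phi> x *\<^sub>R G x))\<^sup>2 + \<beta> * (norm (D x))\<^sup>2)"
      by (intro Bochner_Integration.integrable_add integrable_mult_right iG iD)
    show "AE x in \<mu>. A x \<bullet> ?W2 x \<le> \<beta> * (norm (\<phi> x *\<^sub>R G x))\<^sup>2 + \<beta> * (norm (D x))\<^sup>2"
      using bd
    proof eventually_elim
      case (elim x)
      have "A x \<bullet> ?W2 x = 2 * (\<phi> x * (A x \<bullet> D x))"
        by (simp only: inner_add_right inner_scaleR_right)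
      also have "\<phi> x * (A x \<bullet> D x) \<le> \<bar>\<phi> x\<bar> * \<bar>A x \<bullet> D x\<bar>" by (metis abs_ge_self abs_mult)
      also have "\<dots> \<le> \<bar>\<phi> x\<bar> * (\<beta> * norm (G x) * norm (D x))"
        by (intro mult_left_mono order_trans[OF Cauchy_Schwarz_ineq2] mult_right_mono elim) auto
      also have "2 * (\<bar>\<phi> x\<bar> * (\<beta> * norm (G x) * norm (D x))) = \<beta> * (2 * (norm (\<phi> x *\<^sub>R G x)) * norm (D x))" by simp
      also have "\<dots> \<le> \<beta> * ((norm (\<phi> x *\<^sub>R G x))\<^sup>2 + (norm (D x))\<^sup>2)"
        using assms(2) by (intro mult_left_mono sum_squares_bound) auto
      finally show ?case by (simp add: distrib_left)
    qed
  qed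
  also have "\<dots> = \<beta> * E + \<beta> * J"
    unfolding E_def J_def by (subst Bochner_Integration.integral_add) (auto intro!: integrable_mult_right iG iD simp del: norm_scaleR)
  also have "\<dots> \<le> \<beta> * (4 * \<beta>\<^sup>2 * K\<^sup>2 / \<alpha>\<^sup>2 * J) + \<beta> * J"
    using E assms(2) by (intro add_right_mono mult_left_mono) auto
  also have "\<dots> = \<beta> * (4 * \<beta>\<^sup>2 * K\<^sup>2 / \<alpha>\<^sup>2 + 1) * J" by (simp add: algebra_simps)
  finally show ?thesis unfolding J_def .
qed

lemma energy_estimate:
  assumes sol: "weak_solution \<Omega> v G A h"
    and ell: "AE x in \<mu>. \<alpha> * (norm (G x))\<^sup>2 \<le> A x \<bullet> G x"
  shows "\<alpha> * (\<integral>x. (norm (G x))\<^sup>2 \<partial>\<mu>) \<le> (\<integral>x. h x * v x \<partial>\<mu>)"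
proof -
  have H: "H10 \<Omega> v G" and sA: "square_integrable \<mu> A" using sol by (auto simp: weak_solution_def)
  have "(\<integral>x. \<alpha> * (norm (G x))\<^sup>2 \<partial>\<mu>) \<le> (\<integral>x. A x \<bullet> G x \<partial>\<mu>)"
    using H10_square_integrable(2)[OF H]
    by (intro integral_mono_AE ell integrable_inner sA) (auto simp: square_integrable_def)
  also have "\<dots> = (\<integral>x. h x * v x \<partial>\<mu>)" using sol H by (simp add: weak_solution_def)
  finally show ?thesis by simp
qed

end

section \<open>The constant 1 does not vanish on the boundary\<close>

context bounded_open
begin

lemma domain_norm_bound: obtains R where "R > 0" "\<And>x. x \<in> \<Omega> \<Longrightarrow> norm x \<le> R"
  using bounded_domain unfolding bounded_pos by blast

lemma measurable_domain_AE_limit: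
  fixes v :: "nat \<Rightarrow> real^'n \<Rightarrow> real"
  assumes "\<And>m. v m \<in> borel_measurable \<mu>" "AE x in \<mu>. (\<lambda>m. v m x) \<longlonglongrightarrow> u x"
  shows "u \<in> borel_measurable \<mu>"
proof -
  have "(\<lambda>x. lim (\<lambda>m. v m x)) \<in> borel_measurable \<mu>"
    using assms(1) by (rule borel_measurable_lim_metric)
  then have 1: "(\<lambda>x. if x \<in> \<Omega> then lim (\<lambda>m. v m x) else 0) \<in> borel_measurable lebesgue"
    by (simp add: borel_measurable_if)
  have "AE x in lebesgue. x \<in> \<Omega> \<longrightarrow> (\<lambda>m. v m x) \<longlonglongrightarrow> u x" using assms(2) by (simp add: AE_restrict_space_iff)
  then have "AE x in lebesgue. (if x \<in> \<Omega> then lim (\<lambda>m. v m x) else 0) = (if x \<in> \<Omega> then u x else 0)"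
    by eventually_elim (auto simp: limI)
  with 1 have "(\<lambda>x. if x \<in> \<Omega> then u x else 0) \<in> borel_measurable lebesgue" by (rule borel_measurable_AE)
  then show ?thesis by (simp add: borel_measurable_if)
qed

text \<open>Integration by parts gives \<open>\<integral>\<psi> = -\<integral>x\<^sub>e \<partial>\<^sub>e\<psi>\<close> for \<open>\<psi>\<close> of class \<open>C\<^sup>1\<^sub>c\<close>, where \<open>x\<^sub>e\<close> is a coordinate.  If
  \<open>\<psi> \<rightarrow> 1\<close> in \<open>L\<^sup>1\<close>, the left-hand side tends to the measure of \<open>\<Omega>\<close>.  On the right, the part of the
  gradient seen by a cutoff \<open>\<eta>\<close> disappears, since \<open>\<integral>\<eta> x\<^sub>e \<partial>\<^sub>e\<psi> = -\<integral>\<psi> \<partial>\<^sub>e(\<eta> x\<^sub>e)\<close> tends to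
  \<open>-\<integral>\<partial>\<^sub>e(\<eta> x\<^sub>e) = 0\<close>; only the mass of the gradients near the boundary is left, and the last
  hypothesis makes it small.\<close>

lemma no_approximation_of_one:
  fixes \<psi> :: "nat \<Rightarrow> real^'n \<Rightarrow> real"
  assumes C: "\<And>k. C1c \<Omega> (\<psi> k) (D k)"
    and lim: "(\<lambda>k. \<integral>x. \<bar>\<psi> k x - 1\<bar> \<partial>\<mu>) \<longlonglongrightarrow> 0"
    and tails: "\<And>\<epsilon>. \<epsilon> > 0 \<Longrightarrow> \<exists>\<eta> E. C1c \<Omega> \<eta> E \<and>
      (\<forall>\<^sub>F k in sequentially. (\<integral>x. \<bar>1 - \<eta> x\<bar> * norm (D k x) \<partial>\<mu>) \<le> \<epsilon>)"
  shows "measure \<mu> \<Omega> = 0"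
proof -
  obtain e :: "real^'n" where e: "e \<in> Basis" using nonempty_Basis by blast
  have e1: "norm e = 1" "e \<bullet> e = 1" using e by auto
  obtain R where R: "R > 0" "\<And>x. x \<in> \<Omega> \<Longrightarrow> norm x \<le> R" using domain_norm_bound by metis
  have GX: "GDERIV (\<lambda>x. x \<bullet> e) x :> e" for x :: "real^'n"
    unfolding gderiv_def by (auto intro!: derivative_eq_intros)
  have [measurable]: "\<psi> k \<in> borel_measurable \<mu>" "D k \<in> borel_measurable \<mu>" for k
    by (auto intro!: borel_imp_measurable_domain C1c_measurable[OF C])
  have [measurable]: "(\<lambda>x. x \<bullet> e) \<in> borel_measurable \<mu>" by (rule borel_imp_measurable_domain) measurable
  have int1: "integrable \<mu> (\<psi> k)" "integrable \<mu> (D k)" for k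
    using square_integrable_L1[OF C1c_square_integrable(1)[OF C] finite_measure_axioms]
      square_integrable_L1[OF C1c_square_integrable(2)[OF C] finite_measure_axioms] by auto
  have zero: "(\<integral>x. Z x \<bullet> e \<partial>\<mu>) = 0" if Z: "C1c \<Omega> \<phi> Z" for \<phi> Z
  proof -
    note [measurable] = C1c_measurable[OF Z]
    obtain K where "K \<subseteq> \<Omega>" "\<And>x. x \<notin> K \<Longrightarrow> Z x = 0" using C1c_support[OF Z] by metis
    then have "Z x = 0" if "x \<notin> \<Omega>" for x using that by blast
    then show ?thesis using integral_directional_derivative_eq_0[OF Z, of e]
      by (subst integral_lebesgue_on_eq_lborel) auto
  qed
  have bdX: "AE x in \<mu>. \<bar>x \<bullet> e\<bar> \<le> R"
  proof (rule AE_I2)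
    fix x assume "x \<in> space \<mu>"
    then show "\<bar>x \<bullet> e\<bar> \<le> R" using R(2)[of x] Cauchy_Schwarz_ineq2[of x e] e1 by simp
  qed
  have intb: "integrable \<mu> (\<lambda>x. b x * g x)"
    if "b \<in> borel_measurable \<mu>" "AE x in \<mu>. \<bar>b x\<bar> \<le> B" "integrable \<mu> g" for b g :: "real^'n \<Rightarrow> real" and B
  proof (rule Bochner_Integration.integrable_bound[OF integrable_mult_right[OF that(3), of B]])
    show "AE x in \<mu>. norm (b x * g x) \<le> norm (B * g x)"
      using that(2) by eventually_elim (auto simp: abs_mult intro!: mult_right_mono)
  qed (use that in measurable)
  have key: "measure \<mu> \<Omega> \<le> R * \<epsilon>" if \<epsilon>: "\<epsilon> > 0" for \<epsilon>
  proof -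
    obtain \<eta> E where \<eta>: "C1c \<Omega> \<eta> E"
      and tail: "\<forall>\<^sub>F k in sequentially. (\<integral>x. \<bar>1 - \<eta> x\<bar> * norm (D k x) \<partial>\<mu>) \<le> \<epsilon>"
      using tails[OF \<epsilon>] by blast
    define Y where "Y = (\<lambda>x. \<eta> x *\<^sub>R e + (x \<bullet> e) *\<^sub>R E x)"
    have CY: "C1c \<Omega> (\<lambda>x. \<eta> x * (x \<bullet> e)) Y" unfolding Y_def
      by (rule C1c_mult[OF \<eta> GX]) auto
    obtain B where B: "B > 0" "\<And>x. norm (Y x) \<le> B" using C1c_bounded[OF CY] by metis
    obtain B' where B': "B' > 0" "\<And>x. \<bar>\<eta> x\<bar> \<le> B'" using C1c_bounded[OF \<eta>] by metis
    have [measurable]: "\<eta> \<in> borel_measurable \<mu>" "Y \<in> borel_measurable \<mu>"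
      by (auto intro!: borel_imp_measurable_domain C1c_measurable[OF \<eta>] C1c_measurable[OF CY])
    have est: "(\<integral>x. \<psi> k x \<partial>\<mu>) \<le> R * (\<integral>x. \<bar>1 - \<eta> x\<bar> * norm (D k x) \<partial>\<mu>) + B * (\<integral>x. \<bar>\<psi> k x - 1\<bar> \<partial>\<mu>)" for k
    proof -
      have C1: "C1c \<Omega> (\<lambda>x. \<psi> k x * (x \<bullet> e)) (\<lambda>x. \<psi> k x *\<^sub>R e + (x \<bullet> e) *\<^sub>R D k x)"
        by (rule C1c_mult[OF C GX]) auto
      have C2: "C1c \<Omega> (\<lambda>x. \<psi> k x * (\<eta> x * (x \<bullet> e))) (\<lambda>x. \<psi> k x *\<^sub>R Y x + (\<eta> x * (x \<bullet> e)) *\<^sub>R D k x)"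
        using CY by (intro C1c_mult[OF C]) (auto simp: C1c_def)
      have iDe: "integrable \<mu> (\<lambda>x. D k x \<bullet> e)" using int1(2) by simp
      have iX: "integrable \<mu> (\<lambda>x. (x \<bullet> e) * (D k x \<bullet> e))" by (rule intb[OF _ bdX iDe]) measurable
      have i\<eta>: "integrable \<mu> (\<lambda>x. \<eta> x * ((x \<bullet> e) * (D k x \<bullet> e)))"
        by (rule intb[OF _ _ iX, where B=B']) (use B' in auto)
      have iYe: "integrable \<mu> (\<lambda>x. Y x \<bullet> e)"
        using square_integrable_L1[OF C1c_square_integrable(2)[OF CY] finite_measure_axioms] by simp
      have Ye: "\<bar>Y x \<bullet> e\<bar> \<le> B" for x
        using Cauchy_Schwarz_ineq2[of "Y x" e] e1 B(2)[of x] by simp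
      have iY: "integrable \<mu> (\<lambda>x. (Y x \<bullet> e) * \<psi> k x)" by (rule intb[OF _ _ int1(1), where B=B]) (use Ye in auto)
      have iT: "integrable \<mu> (\<lambda>x. \<bar>1 - \<eta> x\<bar> * norm (D k x))"
      proof (rule intb[OF _ _ integrable_norm[OF int1(2)], where B="1 + B'"])
        show "AE x in \<mu>. \<bar>\<bar>1 - \<eta> x\<bar>\<bar> \<le> 1 + B'"
        proof (rule AE_I2)
          fix x show "\<bar>\<bar>1 - \<eta> x\<bar>\<bar> \<le> 1 + B'" using B'(2)[of x] by linarith
        qed
      qed measurable
      have i\<psi>: "integrable \<mu> (\<lambda>x. \<bar>\<psi> k x - 1\<bar>)" using int1(1) by auto
      have "(\<integral>x. \<psi> k x + (x \<bullet> e) * (D k x \<bullet> e) \<partial>\<mu>) = 0"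
        using zero[OF C1] by (simp add: inner_add_left e1)
      then have eq1: "(\<integral>x. \<psi> k x \<partial>\<mu>) = - (\<integral>x. (x \<bullet> e) * (D k x \<bullet> e) \<partial>\<mu>)" using int1 iX by simp
      have "(\<integral>x. (Y x \<bullet> e) * \<psi> k x + \<eta> x * ((x \<bullet> e) * (D k x \<bullet> e)) \<partial>\<mu>) = 0"
        using zero[OF C2] by (simp add: inner_add_left mult_ac)
      then have eq2: "(\<integral>x. \<eta> x * ((x \<bullet> e) * (D k x \<bullet> e)) \<partial>\<mu>) = - (\<integral>x. (Y x \<bullet> e) * \<psi> k x \<partial>\<mu>)" using iY i\<eta> by simp
      have eq3: "(\<integral>x. Y x \<bullet> e \<partial>\<mu>) = 0" by (rule zero[OF CY])
      \<comment> \<open>By the three identities above, all the added terms cancel.\<close>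
      have "(\<integral>x. \<psi> k x \<partial>\<mu>) = (\<integral>x. - ((x \<bullet> e) * (D k x \<bullet> e)) + \<eta> x * ((x \<bullet> e) * (D k x \<bullet> e)) + ((Y x \<bullet> e) * \<psi> k x - Y x \<bullet> e) \<partial>\<mu>)"
        using iX i\<eta> iY iYe eq1 eq2 eq3 by simp
      also have "\<dots> \<le> (\<integral>x. R * (\<bar>1 - \<eta> x\<bar> * norm (D k x)) + B * \<bar>\<psi> k x - 1\<bar> \<partial>\<mu>)"
      proof (rule integral_mono_AE)
        show "integrable \<mu> (\<lambda>x. - ((x \<bullet> e) * (D k x \<bullet> e)) + \<eta> x * ((x \<bullet> e) * (D k x \<bullet> e)) + ((Y x \<bullet> e) * \<psi> k x - Y x \<bullet> e))"
          using iX i\<eta> iY iYe by simp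
        show "integrable \<mu> (\<lambda>x. R * (\<bar>1 - \<eta> x\<bar> * norm (D k x)) + B * \<bar>\<psi> k x - 1\<bar>)"
          using iT i\<psi> by simp
        show "AE x in \<mu>. - ((x \<bullet> e) * (D k x \<bullet> e)) + \<eta> x * ((x \<bullet> e) * (D k x \<bullet> e)) + ((Y x \<bullet> e) * \<psi> k x - Y x \<bullet> e)
            \<le> R * (\<bar>1 - \<eta> x\<bar> * norm (D k x)) + B * \<bar>\<psi> k x - 1\<bar>"
          using bdX
        proof eventually_elim
          case (elim x)
          have "- ((x \<bullet> e) * (D k x \<bullet> e)) + \<eta> x * ((x \<bullet> e) * (D k x \<bullet> e)) = - ((1 - \<eta> x) * ((x \<bullet> e) * (D k x \<bullet> e)))"
            by (simp add: algebra_simps)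
          also have "\<dots> \<le> \<bar>1 - \<eta> x\<bar> * (\<bar>x \<bullet> e\<bar> * \<bar>D k x \<bullet> e\<bar>)"
            by (metis abs_ge_minus_self abs_mult)
          also have "\<dots> \<le> \<bar>1 - \<eta> x\<bar> * (R * norm (D k x))"
            using Cauchy_Schwarz_ineq2[of "D k x" e] e1 elim by (intro mult_left_mono mult_mono) auto
          finally have 1: "- ((x \<bullet> e) * (D k x \<bullet> e)) + \<eta> x * ((x \<bullet> e) * (D k x \<bullet> e)) \<le> R * (\<bar>1 - \<eta> x\<bar> * norm (D k x))"
            by (simp add: mult_ac)
          have "(Y x \<bullet> e) * \<psi> k x - Y x \<bullet> e = (Y x \<bullet> e) * (\<psi> k x - 1)" by (simp add: algebra_simps)
          also have "\<dots> \<le> \<bar>Y x \<bullet> e\<bar> * \<bar>\<psi> k x - 1\<bar>" by (metis abs_ge_self abs_mult)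
          also have "\<dots> \<le> B * \<bar>\<psi> k x - 1\<bar>" using Ye by (intro mult_right_mono) auto
          finally show ?case using 1 by linarith
        qed
      qed
      also have "\<dots> = R * (\<integral>x. \<bar>1 - \<eta> x\<bar> * norm (D k x) \<partial>\<mu>) + B * (\<integral>x. \<bar>\<psi> k x - 1\<bar> \<partial>\<mu>)"
        using iT i\<psi> by simp
      finally show ?thesis .
    qed
    have int\<psi>: "measure \<mu> \<Omega> - (\<integral>x. \<bar>\<psi> k x - 1\<bar> \<partial>\<mu>) \<le> (\<integral>x. \<psi> k x \<partial>\<mu>)" for k
    proof -
      have "(\<integral>x. 1 - \<bar>\<psi> k x - 1\<bar> \<partial>\<mu>) \<le> (\<integral>x. \<psi> k x \<partial>\<mu>)"
        by (rule integral_mono) (use int1 in auto)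
      then show ?thesis using int1 by simp
    qed
    have "\<forall>\<^sub>F k in sequentially. measure \<mu> \<Omega> \<le> R * \<epsilon> + (B + 1) * (\<integral>x. \<bar>\<psi> k x - 1\<bar> \<partial>\<mu>)"
      using tail
    proof eventually_elim
      case (elim k)
      then have "R * (\<integral>x. \<bar>1 - \<eta> x\<bar> * norm (D k x) \<partial>\<mu>) \<le> R * \<epsilon>" using R by (intro mult_left_mono) auto
      then show ?case using est[of k] int\<psi>[of k] by (simp add: distrib_right)
    qed
    moreover have "(\<lambda>k. R * \<epsilon> + (B + 1) * (\<integral>x. \<bar>\<psi> k x - 1\<bar> \<partial>\<mu>)) \<longlonglongrightarrow> R * \<epsilon> + (B + 1) * 0"
      by (intro tendsto_intros lim)
    ultimately show ?thesis using tendsto_lowerbound[of _ "R * \<epsilon> + (B + 1) * 0" sequentially "measure \<mu> \<Omega>"] by simp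
  qed
  have "measure \<mu> \<Omega> \<le> 0"
  proof (rule field_le_epsilon)
    fix \<epsilon>::real assume "\<epsilon> > 0"
    then show "measure \<mu> \<Omega> \<le> 0 + \<epsilon>" using key[of "\<epsilon> / R"] R by simp
  qed
  then show ?thesis by (simp add: measure_le_0_iff)
qed

lemma cutoff_tail_small:
  fixes g :: "real^'n \<Rightarrow> 'b::euclidean_space"
  assumes g: "integrable \<mu> g" and \<epsilon>: "\<epsilon> > 0"
  obtains \<eta> E where "C1c \<Omega> \<eta> E" "\<And>x. \<bar>1 - \<eta> x\<bar> \<le> 1"
    "(\<integral>x. \<bar>1 - \<eta> x\<bar> * norm (g x) \<partial>\<mu>) < \<epsilon>"
proof -
  obtain \<eta> :: "nat \<Rightarrow> real^'n \<Rightarrow> real" and E where \<eta>: "\<And>j. C1c \<Omega> (\<eta> j) (E j)" "\<And>j x. 0 \<le> \<eta> j x" "\<And>j x. \<eta> j x \<le> 1"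
    "\<And>x. x \<in> \<Omega> \<Longrightarrow> (\<lambda>j. \<eta> j x) \<longlonglongrightarrow> 1" using cutoff_sequence[OF open_domain] by metis
  have ab: "\<bar>1 - \<eta> j x\<bar> \<le> 1" for j x using \<eta>(2,3)[of j x] by auto
  have [measurable]: "\<eta> j \<in> borel_measurable \<mu>" for j
    by (rule borel_imp_measurable_domain C1c_measurable[OF \<eta>(1)])+
  have "(\<lambda>j. \<integral>x. \<bar>1 - \<eta> j x\<bar> * norm (g x) \<partial>\<mu>) \<longlonglongrightarrow> (\<integral>x. 0 \<partial>\<mu>)"
  proof (rule integral_dominated_convergence[OF _ _ integrable_norm[OF g]])
    show "AE x in \<mu>. (\<lambda>j. \<bar>1 - \<eta> j x\<bar> * norm (g x)) \<longlonglongrightarrow> 0"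
    proof (rule AE_I2)
      fix x assume "x \<in> space \<mu>"
      then have "(\<lambda>j. \<eta> j x) \<longlonglongrightarrow> 1" using \<eta>(4) by simp
      then have "(\<lambda>j. \<bar>1 - \<eta> j x\<bar> * norm (g x)) \<longlonglongrightarrow> \<bar>1 - 1\<bar> * norm (g x)" by (intro tendsto_intros)
      then show "(\<lambda>j. \<bar>1 - \<eta> j x\<bar> * norm (g x)) \<longlonglongrightarrow> 0" by simp
    qed
    show "AE x in \<mu>. norm (\<bar>1 - \<eta> j x\<bar> * norm (g x)) \<le> norm (g x)" for j
      using ab by (auto simp: abs_mult intro!: mult_left_le_one_le)
    show "(\<lambda>x. \<bar>1 - \<eta> j x\<bar> * norm (g x)) \<in> borel_measurable \<mu>" for j using g by measurable
  qed auto
  then have "\<forall>\<^sub>F j in sequentially. (\<integral>x. \<bar>1 - \<eta> j x\<bar> * norm (g x) \<partial>\<mu>) < \<epsilon>"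
    using \<epsilon> by (intro order_tendstoD(2)) auto
  then obtain j where "(\<integral>x. \<bar>1 - \<eta> j x\<bar> * norm (g x) \<partial>\<mu>) < \<epsilon>" unfolding eventually_sequentially by blast
  then show ?thesis using that[OF \<eta>(1)[of j] ab] by blast
qed

text \<open>Gradients bounded in \<open>L\<^sup>2\<close> have uniformly small \<open>L\<^sup>1\<close> mass near the boundary, by Cauchy-Schwarz.\<close>

lemma no_bounded_energy_approximation_of_one:
  assumes C: "\<And>k. C1c \<Omega> (\<psi> k) (D k)"
    and lim: "(\<lambda>k. \<integral>x. \<bar>\<psi> k x - 1\<bar> \<partial>\<mu>) \<longlonglongrightarrow> 0"
    and B: "\<And>k. (\<integral>x. (norm (D k x))\<^sup>2 \<partial>\<mu>) \<le> B"
  shows "measure \<mu> \<Omega> = 0"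
proof (rule no_approximation_of_one[OF C lim])
  fix \<epsilon> :: real assume \<epsilon>: "\<epsilon> > 0"
  have B0: "0 \<le> B" by (rule order_trans[OF _ B[of 0]]) (auto intro!: integral_nonneg_AE)
  have one: "integrable \<mu> (\<lambda>x. 1::real)" by simp
  have "\<epsilon>\<^sup>2 / (B + 1) > 0" using \<epsilon> B0 by simp
  from cutoff_tail_small[OF one this] obtain \<eta> E where \<eta>: "C1c \<Omega> \<eta> E" "\<And>x. \<bar>1 - \<eta> x\<bar> \<le> 1"
    and small: "(\<integral>x. \<bar>1 - \<eta> x\<bar> * norm (1::real) \<partial>\<mu>) < \<epsilon>\<^sup>2 / (B + 1)" by blast
  have [measurable]: "\<eta> \<in> borel_measurable \<mu>" by (rule borel_imp_measurable_domain C1c_measurable[OF \<eta>(1)])+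
  have s\<eta>: "square_integrable \<mu> (\<lambda>x. \<bar>1 - \<eta> x\<bar>)"
    by (rule square_integrable_bounded[of _ 1]) (use \<eta>(2) in auto)
  have "(\<integral>x. (norm \<bar>1 - \<eta> x\<bar>)\<^sup>2 \<partial>\<mu>) \<le> (\<integral>x. \<bar>1 - \<eta> x\<bar> \<partial>\<mu>)"
  proof (rule integral_mono)
    show "integrable \<mu> (\<lambda>x. (norm \<bar>1 - \<eta> x\<bar>)\<^sup>2)" using s\<eta> by (simp add: square_integrable_def)
    show "integrable \<mu> (\<lambda>x. \<bar>1 - \<eta> x\<bar>)" by (rule square_integrable_L1[OF s\<eta> finite_measure_axioms])
    show "(norm \<bar>1 - \<eta> x\<bar>)\<^sup>2 \<le> \<bar>1 - \<eta> x\<bar>" for x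
      using mult_left_le_one_le[of "\<bar>1 - \<eta> x\<bar>" "\<bar>1 - \<eta> x\<bar>"] \<eta>(2)[of x] by (simp add: power2_eq_square)
  qed
  then have sm: "(\<integral>x. (norm \<bar>1 - \<eta> x\<bar>)\<^sup>2 \<partial>\<mu>) \<le> \<epsilon>\<^sup>2 / (B + 1)" using small by simp
  have "(\<integral>x. \<bar>1 - \<eta> x\<bar> * norm (D k x) \<partial>\<mu>) \<le> \<epsilon>" for k
  proof -
    have "(\<integral>x. \<bar>1 - \<eta> x\<bar> * norm (D k x) \<partial>\<mu>)\<^sup>2 \<le> (\<integral>x. (norm \<bar>1 - \<eta> x\<bar>)\<^sup>2 \<partial>\<mu>) * (\<integral>x. (norm (D k x))\<^sup>2 \<partial>\<mu>)"
      using Cauchy_Schwarz_integral[OF s\<eta> C1c_square_integrable(2)[OF C[of k]]] by simp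
    also have "\<dots> \<le> \<epsilon>\<^sup>2 / (B + 1) * (B + 1)"
      using sm B[of k] B0 by (intro mult_mono) (auto intro!: integral_nonneg_AE)
    also have "\<dots> = \<epsilon>\<^sup>2" using B0 by simp
    finally show ?thesis by (rule power2_le_imp_le) (use \<epsilon> in simp)
  qed
  then show "\<exists>\<eta> E. C1c \<Omega> \<eta> E \<and> (\<forall>\<^sub>F k in sequentially. (\<integral>x. \<bar>1 - \<eta> x\<bar> * norm (D k x) \<partial>\<mu>) \<le> \<epsilon>)"
    using \<eta>(1) by (intro exI[of _ \<eta>] exI[of _ E] conjI always_eventually allI)
qed

text \<open>Here the gradients converge in \<open>L\<^sup>1\<close>, so their mass near the boundary is controlled by that of the
  limit.\<close>

lemma one_not_in_W110:
  assumes W: "W1p0 1 \<Omega> v H" and one: "AE x in \<mu>. v x = 1"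
  shows "measure \<mu> \<Omega> = 0"
proof -
  obtain \<phi> D where C: "\<And>k::nat. C1c \<Omega> (\<phi> k) (D k)"
    and l1: "(\<lambda>k. \<integral>x. \<bar>\<phi> k x - v x\<bar> powr 1 \<partial>\<mu>) \<longlonglongrightarrow> 0"
    and l2: "(\<lambda>k. \<integral>x. norm (D k x - H x) powr 1 \<partial>\<mu>) \<longlonglongrightarrow> 0"
    using W unfolding W1p0_def by auto
  have [measurable]: "H \<in> borel_measurable \<mu>" "v \<in> borel_measurable \<mu>"
    using W unfolding W1p0_def W1p_def in_Lp_def by auto
  have [measurable]: "\<phi> k \<in> borel_measurable \<mu>" "D k \<in> borel_measurable \<mu>" for k
    by (auto intro!: borel_imp_measurable_domain C1c_measurable[OF C])
  have iH: "integrable \<mu> (\<lambda>x. norm (H x))" using W unfolding W1p0_def W1p_def in_Lp_def by simp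
  then have iH': "integrable \<mu> H" by (simp add: integrable_norm_iff)
  have iD: "integrable \<mu> (D k)" for k by (rule square_integrable_L1[OF C1c_square_integrable(2)[OF C] finite_measure_axioms])
  have lim1: "(\<lambda>k. \<integral>x. \<bar>\<phi> k x - 1\<bar> \<partial>\<mu>) \<longlonglongrightarrow> 0"
  proof -
    have "(\<integral>x. \<bar>\<phi> k x - v x\<bar> powr 1 \<partial>\<mu>) = (\<integral>x. \<bar>\<phi> k x - 1\<bar> \<partial>\<mu>)" for k
      by (rule integral_cong_AE) (use one in auto)
    then show ?thesis using l1 by simp
  qed
  show ?thesis
  proof (rule no_approximation_of_one[OF C lim1])
    fix \<epsilon> :: real assume \<epsilon>: "\<epsilon> > 0"
    have "\<epsilon> / 2 > 0" using \<epsilon> by simp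
    from cutoff_tail_small[OF iH' this] obtain \<eta> E where \<eta>: "C1c \<Omega> \<eta> E" "\<And>x. \<bar>1 - \<eta> x\<bar> \<le> 1"
      and tail: "(\<integral>x. \<bar>1 - \<eta> x\<bar> * norm (H x) \<partial>\<mu>) < \<epsilon> / 2" by blast
    have [measurable]: "\<eta> \<in> borel_measurable \<mu>" by (rule borel_imp_measurable_domain C1c_measurable[OF \<eta>(1)])+
    have "\<forall>\<^sub>F k in sequentially. (\<integral>x. norm (D k x - H x) powr 1 \<partial>\<mu>) < \<epsilon> / 2"
      using \<epsilon> by (intro order_tendstoD(2)[OF l2]) auto
    then have "\<forall>\<^sub>F k in sequentially. (\<integral>x. \<bar>1 - \<eta> x\<bar> * norm (D k x) \<partial>\<mu>) \<le> \<epsilon>"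
    proof eventually_elim
      case (elim k)
      have i\<eta>: "integrable \<mu> (\<lambda>x. \<bar>1 - \<eta> x\<bar> * norm (G x))" if "integrable \<mu> G" for G :: "real^'n \<Rightarrow> real^'n"
      proof (rule Bochner_Integration.integrable_bound[OF that])
        show "(\<lambda>x. \<bar>1 - \<eta> x\<bar> * norm (G x)) \<in> borel_measurable \<mu>" using that by measurable
        show "AE x in \<mu>. norm (\<bar>1 - \<eta> x\<bar> * norm (G x)) \<le> norm (G x)"
          using \<eta>(2) by (auto simp: abs_mult intro!: mult_left_le_one_le)
      qed
      have iDH: "integrable \<mu> (\<lambda>x. D k x - H x)" using iD iH' by auto
      have "(\<integral>x. \<bar>1 - \<eta> x\<bar> * norm (D k x) \<partial>\<mu>) \<le> (\<integral>x. norm (D k x - H x) + \<bar>1 - \<eta> x\<bar> * norm (H x) \<partial>\<mu>)"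
      proof (rule integral_mono[OF i\<eta>[OF iD]])
        show "integrable \<mu> (\<lambda>x. norm (D k x - H x) + \<bar>1 - \<eta> x\<bar> * norm (H x))"
          using iDH i\<eta>[OF iH'] by auto
        fix x
        have "norm (D k x) \<le> norm (D k x - H x) + norm (H x)" by (metis diff_add_cancel norm_triangle_ineq)
        then have "\<bar>1 - \<eta> x\<bar> * norm (D k x) \<le> \<bar>1 - \<eta> x\<bar> * norm (D k x - H x) + \<bar>1 - \<eta> x\<bar> * norm (H x)"
          by (metis abs_ge_zero distrib_left mult_left_mono)
        moreover have "\<bar>1 - \<eta> x\<bar> * norm (D k x - H x) \<le> norm (D k x - H x)"
          using \<eta>(2) by (intro mult_left_le_one_le) auto
        ultimately show "\<bar>1 - \<eta> x\<bar> * norm (D k x) \<le> norm (D k x - H x) + \<bar>1 - \<eta> x\<bar> * norm (H x)" by linarith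
      qed
      also have "\<dots> = (\<integral>x. norm (D k x - H x) \<partial>\<mu>) + (\<integral>x. \<bar>1 - \<eta> x\<bar> * norm (H x) \<partial>\<mu>)"
        using iDH i\<eta>[OF iH'] by simp
      finally show ?case using tail elim by simp
    qed
    then show "\<exists>\<eta> E. C1c \<Omega> \<eta> E \<and> (\<forall>\<^sub>F k in sequentially. (\<integral>x. \<bar>1 - \<eta> x\<bar> * norm (D k x) \<partial>\<mu>) \<le> \<epsilon>)"
      using \<eta>(1) by blast
  qed
qed

end

section \<open>The singular problem for a fixed exponent\<close>

locale elliptic_domain = bounded_open \<Omega> for \<Omega> :: "(real ^ 'n) set" +
  fixes M :: "real ^ 'n \<Rightarrow> real ^ 'n ^ 'n" and \<alpha> \<beta> :: real
  assumes elliptic: "elliptic_matrix \<Omega> \<alpha> \<beta> M"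
begin

lemma alpha_pos: "\<alpha> > 0" and beta_pos: "\<beta> > 0"
  using elliptic unfolding elliptic_matrix_def by auto

lemma coercive: "AE x in \<mu>. \<forall>\<xi>. \<alpha> * (norm \<xi>)\<^sup>2 \<le> (M x *v \<xi>) \<bullet> \<xi>"
  using elliptic unfolding elliptic_matrix_def by auto

lemma flux_bound: "AE x in \<mu>. \<forall>\<xi>. norm (M x *v \<xi>) \<le> \<beta> * norm \<xi>"
proof -
  have "AE x in \<mu>. onorm (\<lambda>\<xi>. M x *v \<xi>) \<le> \<beta>" using elliptic unfolding elliptic_matrix_def by auto
  then show ?thesis
  proof eventually_elim
    case (elim x)
    show ?case
    proof
      fix \<xi>
      have "norm (M x *v \<xi>) \<le> onorm (\<lambda>\<xi>. M x *v \<xi>) * norm \<xi>" by (rule onorm) simp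
      also have "\<dots> \<le> \<beta> * norm \<xi>" using elim by (rule mult_right_mono) simp
      finally show "norm (M x *v \<xi>) \<le> \<beta> * norm \<xi>" .
    qed
  qed
qed

lemma flux_square_integrable:
  assumes "square_integrable \<mu> G"
  shows "square_integrable \<mu> (\<lambda>x. M x *v G x)"
proof (rule square_integrable_bound[OF _ assms, where C=\<beta>])
  have "M \<in> borel_measurable \<mu>" using elliptic unfolding elliptic_matrix_def by auto
  then show "(\<lambda>x. M x *v G x) \<in> borel_measurable \<mu>"
    using square_integrable_measurable[OF assms]
    by (rule borel_measurable_continuous_Pair)
       (auto simp: matrix_vector_mult_def intro!: continuous_intros continuous_on_vec_lambda)
  show "AE x in \<mu>. norm (M x *v G x) \<le> \<beta> * norm (G x)" using flux_bound by eventually_elim auto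
qed

lemma approximate_solution_weak_solution:
  assumes app: "approximate_solution \<Omega> M h (real n) m v" and m: "m \<ge> 1" and h: "in_Linf \<Omega> h"
  obtains G where "weak_solution \<Omega> v G (\<lambda>x. M x *v G x) (\<lambda>x. h x / (v x + 1 / real m) ^ n)"
    "AE x in \<mu>. v x > 0"
proof -
  have pos: "AE x in \<mu>. v x > 0" using app unfolding approximate_solution_def by auto
  obtain G where W: "W1p0 2 \<Omega> v G"
    and eq: "\<And>\<phi> D. C1c \<Omega> \<phi> D \<Longrightarrow> (\<integral>x. (M x *v G x) \<bullet> D x \<partial>\<mu>) = (\<integral>x. h x * \<phi> x / (v x + 1 / real m) powr (real n) \<partial>\<mu>)"
    using app unfolding approximate_solution_def by auto
  have H: "H10 \<Omega> v G" by (rule W1p0_2_imp_H10[OF W])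
  have [measurable]: "v \<in> borel_measurable \<mu>" using H10_square_integrable(1)[OF H] by (rule square_integrable_measurable)
  obtain B where [measurable]: "h \<in> borel_measurable \<mu>" and B: "AE x in \<mu>. \<bar>h x\<bar> \<le> B"
    using h unfolding in_Linf_def ess_bounded_by_def by auto
  have sh: "square_integrable \<mu> (\<lambda>x. h x / (v x + 1 / real m) ^ n)"
  proof (rule square_integrable_bounded)
    show "AE x in \<mu>. norm (h x / (v x + 1 / real m) ^ n) \<le> B / (1 / real m) ^ n"
      using pos B
    proof eventually_elim
      case (elim x)
      have "norm (h x / (v x + 1 / real m) ^ n) = \<bar>h x\<bar> / (v x + 1 / real m) ^ n"
        using elim m by (simp add: abs_of_pos add_pos_pos)
      also have "\<dots> \<le> B / (1 / real m) ^ n"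
        using elim m by (intro frac_le power_mono) auto
      finally show ?case .
    qed
  qed measurable
  have sA: "square_integrable \<mu> (\<lambda>x. M x *v G x)" by (rule flux_square_integrable[OF H10_square_integrable(2)[OF H]])
  have weak: "(\<integral>x. (M x *v G x) \<bullet> D x \<partial>\<mu>) = (\<integral>x. h x / (v x + 1 / real m) ^ n * \<phi> x \<partial>\<mu>)" if C: "C1c \<Omega> \<phi> D" for \<phi> D
  proof -
    have [measurable]: "\<phi> \<in> borel_measurable \<mu>" by (rule borel_imp_measurable_domain[OF C1c_measurable(1)[OF C]])
    have "(\<integral>x. h x * \<phi> x / (v x + 1 / real m) powr (real n) \<partial>\<mu>) = (\<integral>x. h x / (v x + 1 / real m) ^ n * \<phi> x \<partial>\<mu>)"
    proof (rule integral_cong_AE)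
      show "AE x in \<mu>. h x * \<phi> x / (v x + 1 / real m) powr (real n) = h x / (v x + 1 / real m) ^ n * \<phi> x"
        using pos
      proof eventually_elim
        case (elim x)
        then have "v x + 1 / real m > 0" using m by (simp add: add_pos_nonneg)
        then show ?case by (simp add: powr_realpow)
      qed
    qed measurable
    then show ?thesis using eq[OF C] by simp
  qed
  show ?thesis
    using that[of G] pos H sA sh weak_formulation_H10[OF weak sA sh] unfolding weak_solution_def by blast
qed

text \<open>The functions \<open>v m + 1/m\<close> solve the unregularised equation with boundary value \<open>1/m\<close>, and the
  right-hand side decreases in the unknown; by comparison they decrease in \<open>m\<close>.  Hence \<open>u\<close> lies
  between \<open>v m\<close> and \<open>v m + 1/m\<close>.  The upper half bounds the regularised right-hand side by
  \<open>h/u\<^sup>n\<close>, which monotone convergence of \<open>v m\<close> alone would not give.\<close>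

lemma limit_of_approximations_sandwich:
  assumes lim: "limit_of_approximations \<Omega> M h (real n) u" and h: "in_Linf \<Omega> h" "AE x in \<mu>. 0 \<le> h x"
  shows "\<exists>v G. (\<forall>m\<ge>1. weak_solution \<Omega> (v m) (G m) (\<lambda>x. M x *v G m x) (\<lambda>x. h x / (v m x + 1 / real m) ^ n)) \<and>
    (\<forall>m\<ge>1. AE x in \<mu>. 0 < v m x \<and> v m x \<le> u x \<and> u x \<le> v m x + 1 / real m) \<and>
    (AE x in \<mu>. (\<lambda>m. v m x) \<longlonglongrightarrow> u x)"
proof -
  obtain v where app: "\<And>m. m \<ge> 1 \<Longrightarrow> approximate_solution \<Omega> M h (real n) m (v m)"
    and mono: "AE x in \<mu>. (\<forall>m\<ge>1. v m x \<le> v (Suc m) x) \<and> (\<lambda>m. v m x) \<longlonglongrightarrow> u x"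
    using lim unfolding limit_of_approximations_def by auto
  have "\<exists>G. weak_solution \<Omega> (v m) G (\<lambda>x. M x *v G x) (\<lambda>x. h x / (v m x + 1 / real m) ^ n)
     \<and> (AE x in \<mu>. v m x > 0)" if m: "m \<ge> 1" for m
    by (rule approximate_solution_weak_solution[OF app[OF m] m h(1)]) blast
  then have "\<forall>m. \<exists>G. m \<ge> 1 \<longrightarrow> weak_solution \<Omega> (v m) G (\<lambda>x. M x *v G x) (\<lambda>x. h x / (v m x + 1 / real m) ^ n)
     \<and> (AE x in \<mu>. v m x > 0)" by blast
  from choice[OF this] obtain G where G: "\<forall>m. m \<ge> 1 \<longrightarrow> weak_solution \<Omega> (v m) (G m) (\<lambda>x. M x *v G m x) (\<lambda>x. h x / (v m x + 1 / real m) ^ n)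
     \<and> (AE x in \<mu>. v m x > 0)" by (elim exE)
  have sol: "weak_solution \<Omega> (v m) (G m) (\<lambda>x. M x *v G m x) (\<lambda>x. h x / (v m x + 1 / real m) ^ n)"
    and pos: "AE x in \<mu>. v m x > 0" if "m \<ge> 1" for m
    using G that by auto
  have dec: "AE x in \<mu>. v k x - v m x \<le> 1 / real m - 1 / real k" if m: "m \<ge> 1" "m \<le> k" for m k
  proof (rule comparison[OF alpha_pos sol sol])
    show "m \<ge> 1" "k \<ge> 1" using m by auto
    show "AE x in \<mu>. \<alpha> * (norm (G k x - G m x))\<^sup>2 \<le> (M x *v G k x - M x *v G m x) \<bullet> (G k x - G m x)"
      using coercive by eventually_elim (metis matrix_vector_mult_diff_distrib)
    show "0 \<le> 1 / real m - 1 / real k" using m by (simp add: frac_le)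
    show "AE x in \<mu>. 1 / real m - 1 / real k < v k x - v m x \<longrightarrow>
        h x / (v k x + 1 / real k) ^ n \<le> h x / (v m x + 1 / real m) ^ n"
      using pos[OF m(1)] h(2)
    proof eventually_elim
      case (elim x)
      show ?case
      proof
        assume "1 / real m - 1 / real k < v k x - v m x"
        then have "v m x + 1 / real m \<le> v k x + 1 / real k" by linarith
        moreover have "0 < v m x + 1 / real m" using elim m by (simp add: add_pos_nonneg)
        ultimately show "h x / (v k x + 1 / real k) ^ n \<le> h x / (v m x + 1 / real m) ^ n"
          using elim by (intro divide_left_mono power_mono mult_pos_pos zero_less_power) auto
      qed
    qed
  qed
  show ?thesis
  proof (intro exI[of _ v] exI[of _ G] conjI allI impI)
    show "AE x in \<mu>. (\<lambda>m. v m x) \<longlonglongrightarrow> u x" using mono by auto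
    show "weak_solution \<Omega> (v m) (G m) (\<lambda>x. M x *v G m x) (\<lambda>x. h x / (v m x + 1 / real m) ^ n)" if "m \<ge> 1" for m
      using that by (rule sol)
    fix m :: nat assume m: "m \<ge> 1"
    have "AE x in \<mu>. \<forall>k. m \<le> k \<longrightarrow> v k x - v m x \<le> 1 / real m - 1 / real k"
      using dec[OF m] by (subst AE_all_countable) auto
    then show "AE x in \<mu>. 0 < v m x \<and> v m x \<le> u x \<and> u x \<le> v m x + 1 / real m"
      using mono pos[OF m]
    proof eventually_elim
      case (elim x)
      have inc: "v m x \<le> v k x" if "m \<le> k" for k
        using that
      proof (induction k rule: dec_induct)
        case (step j)
        have "v j x \<le> v (Suc j) x" using elim(2) m step(1) le_trans by blast
        then show ?case using step by linarith
      qed simp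
      have lim: "(\<lambda>m. v m x) \<longlonglongrightarrow> u x" using elim by auto
      have "v m x \<le> u x"
        by (rule LIMSEQ_le_const[OF lim]) (use inc in auto)
      moreover have "u x \<le> v m x + 1 / real m"
      proof (rule LIMSEQ_le_const2[OF lim])
        have "v k x \<le> v m x + 1 / real m" if "k \<ge> m" for k
        proof -
          have "v k x - v m x \<le> 1 / real m - 1 / real k" using elim(1) that by blast
          moreover have "0 \<le> 1 / real k" by simp
          ultimately show ?thesis by linarith
        qed
        then show "\<exists>N. \<forall>k\<ge>N. v k x \<le> v m x + 1 / real m" by blast
      qed
      ultimately show ?case using elim(3) by auto
    qed
  qed
qed

lemma limit_solution_measurable:
  assumes "limit_of_approximations \<Omega> M h (real n) u" "in_Linf \<Omega> h" "AE x in \<mu>. 0 \<le> h x"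
  shows "u \<in> borel_measurable \<mu>"
proof -
  obtain v G where sol: "\<forall>m\<ge>1. weak_solution \<Omega> (v m) (G m) (\<lambda>x. M x *v G m x) (\<lambda>x. h x / (v m x + 1 / real m) ^ n)"
    and sand: "\<forall>m\<ge>1. AE x in \<mu>. 0 < v m x \<and> v m x \<le> u x \<and> u x \<le> v m x + 1 / real m"
    and conv: "AE x in \<mu>. (\<lambda>m. v m x) \<longlonglongrightarrow> u x"
    using limit_of_approximations_sandwich[OF assms] by (elim exE conjE) (rule that)
  note sol = sol[rule_format] and sand = sand[rule_format]
  show ?thesis
  proof (rule measurable_domain_AE_limit)
    show "v (Suc m) \<in> borel_measurable \<mu>" for m
    proof -
      have "H10 \<Omega> (v (Suc m)) (G (Suc m))" using sol[of "Suc m"] unfolding weak_solution_def by simp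
      then show ?thesis by (rule square_integrable_measurable[OF H10_square_integrable(1)])
    qed
    show "AE x in \<mu>. (\<lambda>m. v (Suc m) x) \<longlonglongrightarrow> u x"
      using conv by eventually_elim (rule LIMSEQ_Suc)
  qed
qed

text \<open>Above the level \<open>t\<close> the right-hand side is at most \<open>F/t\<^sup>n\<close>.  For \<open>t > 1\<close> this tends to \<open>0\<close> with growing
  \<open>n\<close>, while \<open>C\<close> does not change.\<close>

lemma singular_sup_bound:
  obtains C where "C > 0" "\<And>h n u F t. limit_of_approximations \<Omega> M h (real n) u \<Longrightarrow> in_Linf \<Omega> h \<Longrightarrow>
     AE x in \<mu>. 0 \<le> h x \<and> h x \<le> F \<Longrightarrow> 0 < F \<Longrightarrow> 0 < t \<Longrightarrow>
     AE x in \<mu>. u x \<le> t + C * (F / t ^ n)"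
proof -
  obtain C where C: "C > 0" "\<And>v G A h k0 F. weak_solution \<Omega> v G A h \<Longrightarrow>
     AE x in \<mu>. \<alpha> * (norm (G x))\<^sup>2 \<le> A x \<bullet> G x \<Longrightarrow> 0 \<le> k0 \<Longrightarrow> 0 < F \<Longrightarrow>
     AE x in \<mu>. v x > k0 \<longrightarrow> h x \<le> F \<Longrightarrow> AE x in \<mu>. v x \<le> k0 + C * F"
    using sup_bound[OF alpha_pos] by blast
  show ?thesis
  proof (rule that[OF C(1)])
    fix h u and n :: nat and F t :: real
    assume lim: "limit_of_approximations \<Omega> M h (real n) u" and h: "in_Linf \<Omega> h"
      and hF: "AE x in \<mu>. 0 \<le> h x \<and> h x \<le> F" and F: "0 < F" and t: "0 < t"
    have h0: "AE x in \<mu>. 0 \<le> h x" using hF by auto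
    obtain v G where sol: "\<forall>m\<ge>1. weak_solution \<Omega> (v m) (G m) (\<lambda>x. M x *v G m x) (\<lambda>x. h x / (v m x + 1 / real m) ^ n)"
      and sand: "\<forall>m\<ge>1. AE x in \<mu>. 0 < v m x \<and> v m x \<le> u x \<and> u x \<le> v m x + 1 / real m"
      and conv: "AE x in \<mu>. (\<lambda>m. v m x) \<longlonglongrightarrow> u x"
      using limit_of_approximations_sandwich[OF lim h h0] by (elim exE conjE) (rule that)
    note sol = sol[rule_format] and sand = sand[rule_format]
    have "AE x in \<mu>. v (Suc m) x \<le> t + C * (F / t ^ n)" for m
    proof (rule C(2)[OF sol])
      show "AE x in \<mu>. \<alpha> * (norm (G (Suc m) x))\<^sup>2 \<le> (M x *v G (Suc m) x) \<bullet> G (Suc m) x"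
        using coercive by eventually_elim auto
      show "AE x in \<mu>. t < v (Suc m) x \<longrightarrow> h x / (v (Suc m) x + 1 / real (Suc m)) ^ n \<le> F / t ^ n"
        using hF
      proof eventually_elim
        case (elim x)
        show ?case
        proof
          assume tv: "t < v (Suc m) x"
          have "0 \<le> 1 / real (Suc m)" by simp
          then have "t \<le> v (Suc m) x + 1 / real (Suc m)" using tv by linarith
          then show "h x / (v (Suc m) x + 1 / real (Suc m)) ^ n \<le> F / t ^ n"
            using elim t by (intro frac_le power_mono) auto
        qed
      qed
    qed (use t F in auto)
    then have "AE x in \<mu>. \<forall>m. v (Suc m) x \<le> t + C * (F / t ^ n)" by (simp add: AE_all_countable)
    then show "AE x in \<mu>. u x \<le> t + C * (F / t ^ n)"
      using conv
    proof eventually_elim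
      case (elim x)
      show ?case by (rule LIMSEQ_le_const2[OF LIMSEQ_Suc[OF elim(2)]]) (use elim(1) in auto)
    qed
  qed
qed

text \<open>On \<open>{u < 1 - \<delta>}\<close> the regularised right-hand side is at least \<open>h(1 - \<delta>/2)\<^sup>-\<^sup>n\<close> once \<open>1/m \<le> \<delta>/2\<close>,
  whereas its local mass is bounded independently of \<open>n\<close>.  So the datum has a mass on this set
  that decays geometrically in \<open>n\<close>.\<close>

lemma singular_sublevel_mass:
  assumes lim: "limit_of_approximations \<Omega> M h (real n) u" and h: "in_Linf \<Omega> h" "AE x in \<mu>. 0 \<le> h x"
    and K: "AE x in \<mu>. u x \<le> K" and \<phi>: "C1c \<Omega> \<phi> D" and \<delta>: "0 < \<delta>" "\<delta> < 1"
  shows "(\<integral>x. h x * (\<phi> x)\<^sup>2 * indicator {x. u x < 1 - \<delta>} x \<partial>\<mu>)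
    \<le> \<beta> * (4 * \<beta>\<^sup>2 * K\<^sup>2 / \<alpha>\<^sup>2 + 1) * (\<integral>x. (norm (D x))\<^sup>2 \<partial>\<mu>) * (1 - \<delta> / 2) ^ n"
proof -
  define J where "J = \<beta> * (4 * \<beta>\<^sup>2 * K\<^sup>2 / \<alpha>\<^sup>2 + 1) * (\<integral>x. (norm (D x))\<^sup>2 \<partial>\<mu>)"
  obtain v G where sol: "\<forall>m\<ge>1. weak_solution \<Omega> (v m) (G m) (\<lambda>x. M x *v G m x) (\<lambda>x. h x / (v m x + 1 / real m) ^ n)"
    and sand: "\<forall>m\<ge>1. AE x in \<mu>. 0 < v m x \<and> v m x \<le> u x \<and> u x \<le> v m x + 1 / real m"
    and conv: "AE x in \<mu>. (\<lambda>m. v m x) \<longlonglongrightarrow> u x"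
    using limit_of_approximations_sandwich[OF lim h] by (elim exE conjE) (rule that)
  note sol = sol[rule_format] and sand = sand[rule_format]
  obtain m :: nat where m: "2 / \<delta> < real m" using reals_Archimedean2 by blast
  have m1: "m \<ge> 1" using m \<delta> by (cases m) (auto simp: divide_less_0_iff)
  have m2: "1 / real m \<le> \<delta> / 2" using m m1 \<delta> by (simp add: field_simps)
  let ?h = "\<lambda>x. h x / (v m x + 1 / real m) ^ n"
  have J: "(\<integral>x. ?h x * (\<phi> x)\<^sup>2 \<partial>\<mu>) \<le> J" unfolding J_def
  proof (rule local_mass_bound[OF alpha_pos beta_pos sol[OF m1] _ _ _ _ \<phi>])
    show "AE x in \<mu>. \<alpha> * (norm (G m x))\<^sup>2 \<le> (M x *v G m x) \<bullet> G m x" using coercive by eventually_elim auto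
    show "AE x in \<mu>. norm (M x *v G m x) \<le> \<beta> * norm (G m x)" using flux_bound by eventually_elim auto
    show "AE x in \<mu>. 0 \<le> v m x \<and> v m x \<le> K" using sand[OF m1] K by eventually_elim auto
    show "AE x in \<mu>. 0 \<le> ?h x" using sand[OF m1] h(2) by eventually_elim (auto intro!: divide_nonneg_nonneg zero_le_power)
  qed
  have "(\<integral>x. h x * (\<phi> x)\<^sup>2 * indicator {x. u x < 1 - \<delta>} x \<partial>\<mu>) \<le> (\<integral>x. (1 - \<delta> / 2) ^ n * (?h x * (\<phi> x)\<^sup>2) \<partial>\<mu>)"
  proof (rule integral_mono_AE)
    have s: "square_integrable \<mu> (\<lambda>x. \<phi> x * \<phi> x)" by (rule H10_square_integrable(1)[OF H10_mult_C1c[OF \<phi> H10_C1c[OF \<phi>]]])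
    have sh: "square_integrable \<mu> ?h" using sol[OF m1] by (simp add: weak_solution_def)
    show "integrable \<mu> (\<lambda>x. (1 - \<delta> / 2) ^ n * (?h x * (\<phi> x)\<^sup>2))"
      using integrable_inner[OF sh s] by (intro integrable_mult_right) (simp add: power2_eq_square)
    obtain B where [measurable]: "h \<in> borel_measurable \<mu>" and B: "AE x in \<mu>. \<bar>h x\<bar> \<le> B"
      using h unfolding in_Linf_def ess_bounded_by_def by auto
    have [measurable]: "u \<in> borel_measurable \<mu>" by (rule limit_solution_measurable[OF lim h])
    have [measurable]: "\<phi> \<in> borel_measurable \<mu>" by (rule borel_imp_measurable_domain[OF C1c_measurable(1)[OF \<phi>]])
    have [measurable]: "(\<lambda>x. indicator {x. u x < 1 - \<delta>} x :: real) \<in> borel_measurable \<mu>"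
      unfolding indicator_def by measurable
    have i2: "integrable \<mu> (\<lambda>x. B * (\<phi> x)\<^sup>2)"
      using square_integrable_L1[OF s finite_measure_axioms] by (simp add: power2_eq_square)
    show "integrable \<mu> (\<lambda>x. h x * (\<phi> x)\<^sup>2 * indicator {x. u x < 1 - \<delta>} x)"
    proof (rule Bochner_Integration.integrable_bound[OF i2])
      show "AE x in \<mu>. norm (h x * (\<phi> x)\<^sup>2 * indicator {x. u x < 1 - \<delta>} x) \<le> norm (B * (\<phi> x)\<^sup>2)"
        using B by eventually_elim (auto simp: indicator_def abs_mult intro!: mult_right_mono)
    qed measurable
    show "AE x in \<mu>. h x * (\<phi> x)\<^sup>2 * indicator {x. u x < 1 - \<delta>} x \<le> (1 - \<delta> / 2) ^ n * (?h x * (\<phi> x)\<^sup>2)"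
      using sand[OF m1] h(2)
    proof eventually_elim
      case (elim x)
      have p: "0 < v m x + 1 / real m" using elim by (simp add: add_pos_nonneg)
      have rhs: "0 \<le> (1 - \<delta> / 2) ^ n * (?h x * (\<phi> x)\<^sup>2)" using elim p \<delta> by simp
      show ?case
      proof (cases "u x < 1 - \<delta>")
        case True
        then have "v m x + 1 / real m \<le> 1 - \<delta> / 2" using elim m2 by simp
        then have "(v m x + 1 / real m) ^ n \<le> (1 - \<delta> / 2) ^ n" using p by (intro power_mono) auto
        then have "h x * (v m x + 1 / real m) ^ n \<le> h x * (1 - \<delta> / 2) ^ n" using elim by (intro mult_left_mono) auto
        then have "h x \<le> (1 - \<delta> / 2) ^ n * ?h x" using p by (simp add: field_simps)
        then have "h x * (\<phi> x)\<^sup>2 \<le> (1 - \<delta> / 2) ^ n * ?h x * (\<phi> x)\<^sup>2" by (rule mult_right_mono) simp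
        then show ?thesis using True by (simp add: mult.assoc)
      qed (use rhs in simp)
    qed
  qed
  also have "\<dots> = (1 - \<delta> / 2) ^ n * (\<integral>x. ?h x * (\<phi> x)\<^sup>2 \<partial>\<mu>)"
    by (rule Bochner_Integration.integral_mult_right_zero)
  also have "\<dots> \<le> (1 - \<delta> / 2) ^ n * J" using \<delta> by (intro mult_left_mono J) auto
  finally show ?thesis unfolding J_def by (simp add: mult.commute)
qed

text \<open>Testing the regularised equation with its own solution, which is at most \<open>K\<close>, bounds the energy of the
  approximations up to the boundary in terms of the \<open>L\<^sup>1\<close> norm of \<open>h/u\<^sup>n\<close>.\<close>

lemma singular_C1c_approximation:
  assumes lim: "limit_of_approximations \<Omega> M h (real n) u" and h: "in_Linf \<Omega> h" "AE x in \<mu>. 0 \<le> h x"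
    and u: "AE x in \<mu>. 0 < u x \<and> u x \<le> K" and i: "integrable \<mu> (\<lambda>x. h x / u x ^ n)"
    and \<epsilon>: "\<epsilon> > 0"
  obtains \<psi> D where "C1c \<Omega> \<psi> D" "(\<integral>x. \<bar>\<psi> x - u x\<bar> \<partial>\<mu>) < \<epsilon>"
    "(\<integral>x. (norm (D x))\<^sup>2 \<partial>\<mu>) < K * (\<integral>x. h x / u x ^ n \<partial>\<mu>) / \<alpha> + 1"
proof -
  obtain v G where sol: "\<forall>m\<ge>1. weak_solution \<Omega> (v m) (G m) (\<lambda>x. M x *v G m x) (\<lambda>x. h x / (v m x + 1 / real m) ^ n)"
    and sand: "\<forall>m\<ge>1. AE x in \<mu>. 0 < v m x \<and> v m x \<le> u x \<and> u x \<le> v m x + 1 / real m"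
    and conv: "AE x in \<mu>. (\<lambda>m. v m x) \<longlonglongrightarrow> u x"
    using limit_of_approximations_sandwich[OF lim h] by (elim exE conjE) (rule that)
  note sol = sol[rule_format] and sand = sand[rule_format]
  have [measurable]: "u \<in> borel_measurable \<mu>" by (rule limit_solution_measurable[OF lim h])
  obtain m :: nat where m: "2 * (measure \<mu> \<Omega> + 1) / \<epsilon> < real m" using reals_Archimedean2 by blast
  have V: "0 \<le> measure \<mu> \<Omega>" by simp
  have "0 < 2 * (measure \<mu> \<Omega> + 1) / \<epsilon>" using \<epsilon> by (intro divide_pos_pos mult_pos_pos add_nonneg_pos V) auto
  then have m1: "m \<ge> 1" using m by (cases m) auto
  have m2: "measure \<mu> \<Omega> / real m < \<epsilon> / 2" using m m1 \<epsilon> V by (simp add: field_simps)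
  let ?h = "\<lambda>x. h x / (v m x + 1 / real m) ^ n"
  have H: "H10 \<Omega> (v m) (G m)" and sh: "square_integrable \<mu> ?h" using sol[OF m1] by (auto simp: weak_solution_def)
  have iv: "integrable \<mu> (v m)" by (rule square_integrable_L1[OF H10_square_integrable(1)[OF H] finite_measure_axioms])
  have [measurable]: "v m \<in> borel_measurable \<mu>" using iv by auto
  have iu: "integrable \<mu> u"
    by (rule integrable_const_bound[of _ K]) (use u in auto)
  have "\<alpha> * (\<integral>x. (norm (G m x))\<^sup>2 \<partial>\<mu>) \<le> (\<integral>x. ?h x * v m x \<partial>\<mu>)"
    by (rule energy_estimate[OF sol[OF m1]]) (use coercive in auto)
  also have "\<dots> \<le> (\<integral>x. K * (h x / u x ^ n) \<partial>\<mu>)"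
  proof (rule integral_mono_AE)
    show "integrable \<mu> (\<lambda>x. ?h x * v m x)" using integrable_inner[OF sh H10_square_integrable(1)[OF H]] by simp
    show "integrable \<mu> (\<lambda>x. K * (h x / u x ^ n))" using i by (rule integrable_mult_right)
    show "AE x in \<mu>. ?h x * v m x \<le> K * (h x / u x ^ n)"
      using sand[OF m1] h(2) u
    proof eventually_elim
      case (elim x)
      have "?h x \<le> h x / u x ^ n" using elim by (intro divide_left_mono power_mono mult_pos_pos zero_less_power) auto
      then have "?h x * v m x \<le> (h x / u x ^ n) * K" using elim by (intro mult_mono) auto
      then show ?case by (simp add: mult.commute)
    qed
  qed
  also have "\<dots> = K * (\<integral>x. h x / u x ^ n \<partial>\<mu>)" by (rule Bochner_Integration.integral_mult_right_zero)
  finally have E: "(\<integral>x. (norm (G m x))\<^sup>2 \<partial>\<mu>) \<le> K * (\<integral>x. h x / u x ^ n \<partial>\<mu>) / \<alpha>"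
    using alpha_pos by (simp add: pos_le_divide_eq mult.commute)
  have d: "(\<integral>x. \<bar>v m x - u x\<bar> \<partial>\<mu>) < \<epsilon> / 2"
  proof -
    have "(\<integral>x. \<bar>v m x - u x\<bar> \<partial>\<mu>) \<le> (\<integral>x. 1 / real m \<partial>\<mu>)"
    proof (rule integral_mono_AE)
      show "AE x in \<mu>. \<bar>v m x - u x\<bar> \<le> 1 / real m" using sand[OF m1] by eventually_elim auto
    qed (use iv iu in auto)
    also have "\<dots> = measure \<mu> \<Omega> / real m" by simp
    finally show ?thesis using m2 by linarith
  qed
  obtain \<phi> D where \<phi>: "\<And>k. C1c \<Omega> (\<phi> k) (D k)" "L2_converges \<mu> \<phi> (v m)" "L2_converges \<mu> D (G m)"
    using H10_sequence[OF H] by metis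
  have "\<forall>\<^sub>F k in sequentially. (\<integral>x. norm (\<phi> k x - v m x) \<partial>\<mu>) < \<epsilon> / 2"
    by (rule order_tendstoD(2)[OF L2_converges_L1[OF \<phi>(2) finite_measure_axioms]]) (use \<epsilon> in simp)
  moreover have "\<forall>\<^sub>F k in sequentially. (\<integral>x. (norm (D k x))\<^sup>2 \<partial>\<mu>) < K * (\<integral>x. h x / u x ^ n \<partial>\<mu>) / \<alpha> + 1"
    using E by (intro order_tendstoD(2)[OF L2_converges_norm[OF \<phi>(3)]]) linarith
  ultimately have "\<forall>\<^sub>F k in sequentially. (\<integral>x. norm (\<phi> k x - v m x) \<partial>\<mu>) < \<epsilon> / 2 \<and>
      (\<integral>x. (norm (D k x))\<^sup>2 \<partial>\<mu>) < K * (\<integral>x. h x / u x ^ n \<partial>\<mu>) / \<alpha> + 1"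
    by (rule eventually_conj)
  then obtain k where k: "(\<integral>x. norm (\<phi> k x - v m x) \<partial>\<mu>) < \<epsilon> / 2"
      "(\<integral>x. (norm (D k x))\<^sup>2 \<partial>\<mu>) < K * (\<integral>x. h x / u x ^ n \<partial>\<mu>) / \<alpha> + 1"
    unfolding eventually_sequentially by blast
  have i\<phi>: "integrable \<mu> (\<phi> k)" by (rule square_integrable_L1[OF C1c_square_integrable(1)[OF \<phi>(1)] finite_measure_axioms])
  have "(\<integral>x. \<bar>\<phi> k x - u x\<bar> \<partial>\<mu>) \<le> (\<integral>x. norm (\<phi> k x - v m x) + \<bar>v m x - u x\<bar> \<partial>\<mu>)"
    by (rule integral_mono) (use i\<phi> iv iu in auto)
  also have "\<dots> = (\<integral>x. norm (\<phi> k x - v m x) \<partial>\<mu>) + (\<integral>x. \<bar>v m x - u x\<bar> \<partial>\<mu>)"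
    using i\<phi> iv iu by simp
  finally have "(\<integral>x. \<bar>\<phi> k x - u x\<bar> \<partial>\<mu>) < \<epsilon>" using d k(1) by linarith
  then show ?thesis using that[OF \<phi>(1) _ k(2)] by blast
qed

end

section \<open>The sequence of singular problems\<close>

locale singular_sequence = elliptic_domain \<Omega> M \<alpha> \<beta>
  for \<Omega> :: "(real ^ 'n) set" and M \<alpha> \<beta> +
  fixes f :: "real ^ 'n \<Rightarrow> real" and \<omega> :: "nat \<Rightarrow> (real ^ 'n) set" and u :: "nat \<Rightarrow> real ^ 'n \<Rightarrow> real"
  assumes f_Linf: "in_Linf \<Omega> f"
    and f_lower: "\<And>A. A \<subset>\<subset> \<Omega> \<Longrightarrow> \<exists>c>0. AE x in lebesgue_on \<Omega>. x \<in> A \<longrightarrow> f x \<ge> c"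
    and \<omega>_sets: "\<And>n. n \<ge> 1 \<Longrightarrow> \<omega> n \<in> sets lebesgue"
    and \<omega>_compact: "\<And>n. n \<ge> 1 \<Longrightarrow> \<omega> n \<subset>\<subset> \<Omega>"
    and \<omega>_mono: "\<And>n. n \<ge> 1 \<Longrightarrow> \<omega> n \<subseteq> \<omega> (Suc n)"
    and \<omega>_exhaust: "(\<Union>n\<in>{1..}. \<omega> n) = \<Omega>"
    and solution: "\<And>n. n \<ge> 1 \<Longrightarrow> singular_solution \<Omega> M (\<lambda>x. f x * indicator (\<omega> n) x) (real n) (u n)"
begin

definition datum :: "nat \<Rightarrow> real^'n \<Rightarrow> real" where
  "datum n = (\<lambda>x. f x * indicator (\<omega> n) x)"

lemma solution_facts:
  assumes "n \<ge> 1"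
  shows "limit_of_approximations \<Omega> M (datum n) (real n) (u n)"
    and "in_Linf \<Omega> (datum n)" "AE x in \<mu>. 0 \<le> datum n x"
    and "AE x in \<mu>. 0 < u n x"
    and "\<exists>c>0. AE x in \<mu>. x \<in> \<omega> n \<longrightarrow> u n x \<ge> c"
    and "\<not> (AE x in \<mu>. datum n x = 0)"
  using solution[OF assms] assms \<omega>_compact[OF assms]
  unfolding singular_solution_def distributional_solution_def admissible_datum_def datum_def by auto

lemma u_measurable: "n \<ge> 1 \<Longrightarrow> u n \<in> borel_measurable \<mu>"
  using limit_solution_measurable solution_facts(1-3) by blast

lemma domain_not_null: "measure \<mu> \<Omega> \<noteq> 0"
proof
  assume "measure \<mu> \<Omega> = 0"
  then have "\<Omega> \<in> null_sets \<mu>" by (intro null_setsI) (auto simp: emeasure_eq_measure)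
  then have "AE x in \<mu>. datum 1 x = 0" by (rule AE_I') auto
  then show False using solution_facts(6)[of 1] by simp
qed

lemma f_upper: obtains F where "F > 0" "AE x in \<mu>. \<bar>f x\<bar> \<le> F"
proof -
  obtain B where "AE x in \<mu>. \<bar>f x\<bar> \<le> B" using f_Linf unfolding in_Linf_def ess_bounded_by_def by auto
  then have "AE x in \<mu>. \<bar>f x\<bar> \<le> \<bar>B\<bar> + 1" by eventually_elim auto
  then show ?thesis using that[of "\<bar>B\<bar> + 1"] by simp
qed

lemma upper_bound:
  obtains C where "C > 0" "\<And>n t. n \<ge> 1 \<Longrightarrow> 0 < t \<Longrightarrow> AE x in \<mu>. u n x \<le> t + C / t ^ n"
proof -
  obtain F where F: "F > 0" "AE x in \<mu>. \<bar>f x\<bar> \<le> F" by (rule f_upper)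
  obtain C where C: "C > 0" "\<And>h n u F t. limit_of_approximations \<Omega> M h (real n) u \<Longrightarrow> in_Linf \<Omega> h \<Longrightarrow>
     AE x in \<mu>. 0 \<le> h x \<and> h x \<le> F \<Longrightarrow> 0 < F \<Longrightarrow> 0 < t \<Longrightarrow>
     AE x in \<mu>. u x \<le> t + C * (F / t ^ n)"
    using singular_sup_bound by blast
  show ?thesis
  proof (rule that[of "C * F"])
    fix n :: nat and t :: real assume n: "n \<ge> 1" and t: "0 < t"
    have "AE x in \<mu>. 0 \<le> datum n x \<and> datum n x \<le> F"
      using solution_facts(3)[OF n] F(2) by eventually_elim (use F(1) in \<open>auto simp: datum_def indicator_def\<close>)
    from C(2)[OF solution_facts(1,2)[OF n] this F(1) t]
    show "AE x in \<mu>. u n x \<le> t + C * F / t ^ n" by simp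
  qed (use C F in simp)
qed

lemma uniform_bound: obtains K where "K > 0" "\<And>n. n \<ge> 1 \<Longrightarrow> AE x in \<mu>. 0 < u n x \<and> u n x \<le> K"
proof -
  obtain C where C: "C > 0" "\<And>n t. n \<ge> 1 \<Longrightarrow> 0 < t \<Longrightarrow> AE x in \<mu>. u n x \<le> t + C / t ^ n"
    using upper_bound by blast
  show ?thesis
  proof (rule that[of "1 + C"])
    fix n :: nat assume n: "n \<ge> 1"
    \<comment> \<open>The level \<open>t = 1\<close>, at which the powers of \<open>t\<close> do not depend on \<open>n\<close>.\<close>
    show "AE x in \<mu>. 0 < u n x \<and> u n x \<le> 1 + C"
      using solution_facts(4)[OF n] C(2)[OF n zero_less_one] by eventually_elim auto
  qed (use C in simp)
qed

text \<open>On the support of the cutoff \<open>\<eta>\<close> the function \<open>f\<close> is bounded below, so the geometric decay of the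
  mass of the datum is one of the measure of \<open>{u\<^sub>n < 1 - \<delta>}\<close>, and Borel-Cantelli applies.\<close>

lemma eventually_above:
  assumes \<eta>: "C1c \<Omega> \<eta> E" and \<delta>: "0 < \<delta>" "\<delta> < 1"
  shows "AE x in \<mu>. \<forall>\<^sub>F k in sequentially. x \<in> \<omega> (Suc k) \<longrightarrow> \<eta> x > 1 / 2 \<longrightarrow> 1 - \<delta> \<le> u (Suc k) x"
proof -
  obtain K where K: "K > 0" "\<And>n. n \<ge> 1 \<Longrightarrow> AE x in \<mu>. 0 < u n x \<and> u n x \<le> K" using uniform_bound by blast
  obtain S where S: "compact S" "S \<subseteq> \<Omega>" "\<And>x. x \<notin> S \<Longrightarrow> \<eta> x = 0" using C1c_support[OF \<eta>] by metis
  have "closure S = S" by (rule closure_closed[OF compact_imp_closed[OF S(1)]])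
  then have "S \<subset>\<subset> \<Omega>" unfolding compactly_contained_def using S by simp
  then obtain c where c: "c > 0" "AE x in \<mu>. x \<in> S \<longrightarrow> f x \<ge> c" using f_lower by blast
  define J where "J = \<beta> * (4 * \<beta>\<^sup>2 * K\<^sup>2 / \<alpha>\<^sup>2 + 1) * (\<integral>x. (norm (E x))\<^sup>2 \<partial>\<mu>)"
  define A where "A = (\<lambda>k. {x \<in> space \<mu>. x \<in> \<omega> (Suc k) \<and> \<eta> x > 1 / 2 \<and> u (Suc k) x < 1 - \<delta>})"
  have [measurable]: "u (Suc k) \<in> borel_measurable \<mu>" for k by (rule u_measurable) simp
  have [measurable]: "\<eta> \<in> borel_measurable \<mu>" by (rule borel_imp_measurable_domain[OF C1c_measurable(1)[OF \<eta>]])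
  have \<omega>sub: "\<omega> (Suc k) \<subseteq> \<Omega>" for k using \<omega>_exhaust by force
  have [measurable]: "\<omega> (Suc k) \<in> sets \<mu>" for k
    using \<omega>_sets[of "Suc k"] \<omega>sub[of k] by (simp add: sets_restrict_space_iff)
  have Asets [measurable]: "A k \<in> sets \<mu>" for k unfolding A_def by measurable
  have bound: "measure \<mu> (A k) \<le> (4 * J / c) * (1 - \<delta> / 2) ^ Suc k" for k
  proof -
    have n1: "Suc k \<ge> 1" by simp
    let ?g = "\<lambda>x. datum (Suc k) x * (\<eta> x)\<^sup>2 * indicator {x. u (Suc k) x < 1 - \<delta>} x"
    have "c / 4 * measure \<mu> (A k) = (\<integral>x. c / 4 * indicator (A k) x \<partial>\<mu>)"
      using sets.sets_into_space[OF Asets[of k]] by (simp add: Int_absorb2)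
    also have "\<dots> \<le> (\<integral>x. ?g x \<partial>\<mu>)"
    proof (rule integral_mono_AE)
      show "integrable \<mu> (\<lambda>x. c / 4 * indicator (A k) x)"
        by (intro integrable_mult_right integrable_real_indicator Asets) (simp add: less_top[symmetric])
      obtain B where B: "\<And>x. \<bar>\<eta> x\<bar> \<le> B" using C1c_bounded[OF \<eta>] by metis
      obtain F where [measurable]: "datum (Suc k) \<in> borel_measurable \<mu>" and F: "AE x in \<mu>. \<bar>datum (Suc k) x\<bar> \<le> F"
        using solution_facts(2)[OF n1] unfolding in_Linf_def ess_bounded_by_def by auto
      have [measurable]: "(\<lambda>x. indicator {x. u (Suc k) x < 1 - \<delta>} x :: real) \<in> borel_measurable \<mu>"
        unfolding indicator_def by measurable
      show "integrable \<mu> ?g"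
      proof (rule integrable_const_bound)
        show "AE x in \<mu>. norm (?g x) \<le> F * B\<^sup>2"
          using F
        proof eventually_elim
          case (elim x)
          have "(\<eta> x)\<^sup>2 \<le> B\<^sup>2" using B[of x] by (metis abs_ge_zero power2_abs power_mono)
          then have "\<bar>datum (Suc k) x\<bar> * (\<eta> x)\<^sup>2 \<le> F * B\<^sup>2" using elim by (intro mult_mono) auto
          moreover have "0 \<le> F * B\<^sup>2" using elim by (intro mult_nonneg_nonneg) auto
          ultimately show ?case by (auto simp: indicator_def abs_mult)
        qed
      qed measurable
      show "AE x in \<mu>. c / 4 * indicator (A k) x \<le> ?g x"
        using c(2) solution_facts(3)[OF n1]
      proof eventually_elim
        case (elim x)
        show ?case
        proof (cases "x \<in> A k")
          case True
          then have x: "x \<in> \<omega> (Suc k)" "\<eta> x > 1 / 2" "u (Suc k) x < 1 - \<delta>" unfolding A_def by auto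
          then have "x \<in> S" using S(3)[of x] by (cases "x \<in> S") auto
          then have "c \<le> datum (Suc k) x" using elim x by (simp add: datum_def)
          moreover have "(1/2)\<^sup>2 \<le> (\<eta> x)\<^sup>2" using x by (intro power_mono) auto
          ultimately have "c * (1/2)\<^sup>2 \<le> datum (Suc k) x * (\<eta> x)\<^sup>2" using c by (intro mult_mono) auto
          then show ?thesis using True x by (simp add: power2_eq_square)
        qed (use elim in auto)
      qed
    qed
    also have "\<dots> \<le> J * (1 - \<delta> / 2) ^ Suc k" unfolding J_def
      by (rule singular_sublevel_mass[OF solution_facts(1-3)[OF n1] _ \<eta> \<delta>]) (use K(2)[OF n1] in auto)
    finally show ?thesis using c by (simp add: field_simps)
  qed
  have "AE x in \<mu>. \<forall>\<^sub>F k in sequentially. x \<in> space \<mu> - A k"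
  proof (rule borel_cantelli_AE1[OF Asets])
    show "emeasure \<mu> (A k) < \<infinity>" for k by (simp add: less_top[symmetric])
    have "summable (\<lambda>k. (4 * J / c * (1 - \<delta> / 2)) * (1 - \<delta> / 2) ^ k)"
      using \<delta> by (intro summable_mult summable_geometric) auto
    then show "summable (\<lambda>k. measure \<mu> (A k))"
      by (rule summable_comparison_test'[where N=0]) (use bound in \<open>simp add: mult.assoc\<close>)
  qed
  then show ?thesis
  proof (eventually_elim)
    case (elim x)
    then show ?case by (rule eventually_mono) (auto simp: A_def not_less)
  qed
qed

lemma solutions_tendsto_one: "AE x in \<mu>. (\<lambda>n. u n x) \<longlonglongrightarrow> 1"
proof -
  obtain C where C: "C > 0" "\<And>n t. n \<ge> 1 \<Longrightarrow> 0 < t \<Longrightarrow> AE x in \<mu>. u n x \<le> t + C / t ^ n"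
    using upper_bound by blast
  obtain \<eta> :: "nat \<Rightarrow> real^'n \<Rightarrow> real" and E where \<eta>: "\<And>j. C1c \<Omega> (\<eta> j) (E j)" "\<And>j x. 0 \<le> \<eta> j x" "\<And>j x. \<eta> j x \<le> 1"
    "\<And>x. x \<in> \<Omega> \<Longrightarrow> (\<lambda>j. \<eta> j x) \<longlonglongrightarrow> 1" using cutoff_sequence[OF open_domain] by metis
  let ?d = "\<lambda>j. inverse (real (Suc (Suc j)))"
  let ?t = "\<lambda>l. 1 + inverse (real (Suc l))"
  have d: "0 < ?d j" "?d j < 1" for j by (auto simp: field_simps)
  have low: "AE x in \<mu>. \<forall>i j. \<forall>\<^sub>F k in sequentially. x \<in> \<omega> (Suc k) \<longrightarrow> \<eta> i x > 1 / 2 \<longrightarrow> 1 - ?d j \<le> u (Suc k) x"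
    using eventually_above[OF \<eta>(1) d] by (simp add: AE_all_countable del: of_nat_Suc)
  have up: "AE x in \<mu>. \<forall>l k. u (Suc k) x \<le> ?t l + C / ?t l ^ Suc k"
    using C(2) by (simp add: AE_all_countable add_pos_pos del: of_nat_Suc power_Suc)
  have "AE x in \<mu>. x \<in> \<Omega>" by (rule AE_I2) simp
  then show ?thesis using low up
  proof eventually_elim
    case (elim x)
    note upx = elim(3)
    obtain n0 where n0: "n0 \<ge> 1" "x \<in> \<omega> n0" using elim(1) \<omega>_exhaust by auto
    have in\<omega>: "x \<in> \<omega> n" if "n \<ge> n0" for n
      using that
    proof (induction n rule: dec_induct)
      case (step m)
      then show ?case using \<omega>_mono[of m] n0(1) by auto
    qed (use n0 in simp)
    have "\<forall>\<^sub>F i in sequentially. 1 / 2 < \<eta> i x" by (rule order_tendstoD(1)[OF \<eta>(4)[OF elim(1)]]) simp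
    then obtain i where i: "1 / 2 < \<eta> i x" unfolding eventually_sequentially by blast
    have "(\<lambda>k. u (Suc k) x) \<longlonglongrightarrow> 1"
    proof (rule order_tendstoI)
      fix a :: real assume "a < 1"
      then obtain j where j: "inverse (real (Suc j)) < 1 - a" using reals_Archimedean[of "1 - a"] by auto
      have "?d j \<le> inverse (real (Suc j))" by (simp add: field_simps)
      then have a: "a < 1 - ?d j" using j by linarith
      have "\<forall>\<^sub>F k in sequentially. x \<in> \<omega> (Suc k) \<longrightarrow> \<eta> i x > 1 / 2 \<longrightarrow> 1 - ?d j \<le> u (Suc k) x" using elim(2) by blast
      then show "\<forall>\<^sub>F k in sequentially. a < u (Suc k) x"
        using eventually_ge_at_top[of n0]
      proof eventually_elim
        case (elim k)
        have "x \<in> \<omega> (Suc k)" using elim(2) by (intro in\<omega>) simp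
        then have "1 - ?d j \<le> u (Suc k) x" using elim(1) i by blast
        then show ?case using a by linarith
      qed
    next
      fix a :: real assume "1 < a"
      then obtain l where l: "inverse (real (Suc l)) < a - 1" using reals_Archimedean[of "a - 1"] by auto
      have t1: "1 < ?t l" by simp
      have "(\<lambda>k. inverse (?t l) ^ Suc k) \<longlonglongrightarrow> 0"
        using t1 by (intro LIMSEQ_Suc LIMSEQ_power_zero) (simp add: inverse_less_1_iff)
      then have "(\<lambda>k. C * inverse (?t l) ^ Suc k) \<longlonglongrightarrow> C * 0" by (intro tendsto_intros)
      then have "(\<lambda>k. C / ?t l ^ Suc k) \<longlonglongrightarrow> 0" by (simp add: divide_inverse power_inverse)
      then have "(\<lambda>k. ?t l + C / ?t l ^ Suc k) \<longlonglongrightarrow> ?t l + 0" by (intro tendsto_add tendsto_const)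
      moreover have "?t l + 0 < a" using l by linarith
      ultimately have "\<forall>\<^sub>F k in sequentially. ?t l + C / ?t l ^ Suc k < a" by (rule order_tendstoD(2))
      then show "\<forall>\<^sub>F k in sequentially. u (Suc k) x < a"
      proof eventually_elim
        case (elim k)
        moreover have "u (Suc k) x \<le> ?t l + C / ?t l ^ Suc k" using upx by blast
        ultimately show ?case by linarith
      qed
    qed
    then show ?case by (rule LIMSEQ_imp_Suc)
  qed
qed

lemma rhs_integrable:
  assumes n: "n \<ge> 1"
  shows "integrable \<mu> (\<lambda>x. datum n x / u n x ^ n)"
proof -
  have [measurable]: "u n \<in> borel_measurable \<mu>" by (rule u_measurable[OF n])
  obtain F where [measurable]: "datum n \<in> borel_measurable \<mu>" and F: "AE x in \<mu>. \<bar>datum n x\<bar> \<le> F"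
    using solution_facts(2)[OF n] unfolding in_Linf_def ess_bounded_by_def by auto
  obtain c where c: "c > 0" "AE x in \<mu>. x \<in> \<omega> n \<longrightarrow> u n x \<ge> c" using solution_facts(5)[OF n] by auto
  show ?thesis
  proof (rule integrable_const_bound)
    show "AE x in \<mu>. norm (datum n x / u n x ^ n) \<le> F / c ^ n"
      using F c(2)
    proof eventually_elim
      case (elim x)
      have F0: "0 \<le> F" using elim by linarith
      show ?case
      proof (cases "x \<in> \<omega> n")
        case True
        then have u: "c \<le> u n x" using elim by simp
        have "norm (datum n x / u n x ^ n) = \<bar>datum n x\<bar> / u n x ^ n" using u c by simp
        also have "\<dots> \<le> F / c ^ n" using elim u c F0 by (intro frac_le power_mono) auto
        finally show ?thesis .
      next
        case False
        then show ?thesis using F0 c by (simp add: datum_def)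
      qed
    qed
  qed measurable
qed

text \<open>A bound in \<open>L\<^sup>1\<close> would yield functions of class \<open>C\<^sup>1\<^sub>c\<close>, with gradients bounded in \<open>L\<^sup>2\<close>, that follow
  \<open>u\<^sub>n\<close> to its limit \<open>1\<close>.\<close>

lemma rhs_unbounded: "\<not> (\<exists>C. \<forall>n\<ge>1. (\<integral>x. \<bar>datum n x / u n x ^ n\<bar> \<partial>\<mu>) \<le> C)"
proof
  assume "\<exists>C. \<forall>n\<ge>1. (\<integral>x. \<bar>datum n x / u n x ^ n\<bar> \<partial>\<mu>) \<le> C"
  then obtain C where C: "\<And>n. n \<ge> 1 \<Longrightarrow> (\<integral>x. \<bar>datum n x / u n x ^ n\<bar> \<partial>\<mu>) \<le> C" by blast
  obtain K where K: "K > 0" "\<And>n. n \<ge> 1 \<Longrightarrow> AE x in \<mu>. 0 < u n x \<and> u n x \<le> K" using uniform_bound by blast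
  have "\<exists>\<psi> D. C1c \<Omega> \<psi> D \<and> (\<integral>x. \<bar>\<psi> x - u (Suc k) x\<bar> \<partial>\<mu>) < inverse (real (Suc k)) \<and>
    (\<integral>x. (norm (D x))\<^sup>2 \<partial>\<mu>) \<le> K * C / \<alpha> + 1" for k
  proof -
    have n1: "Suc k \<ge> 1" by simp
    have "(\<integral>x. datum (Suc k) x / u (Suc k) x ^ Suc k \<partial>\<mu>) \<le> (\<integral>x. \<bar>datum (Suc k) x / u (Suc k) x ^ Suc k\<bar> \<partial>\<mu>)"
      by (intro integral_mono integrable_abs rhs_integrable[OF n1] abs_ge_self)
    also have "\<dots> \<le> C" by (rule C[OF n1])
    finally have le: "K * (\<integral>x. datum (Suc k) x / u (Suc k) x ^ Suc k \<partial>\<mu>) / \<alpha> \<le> K * C / \<alpha>"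
      using K alpha_pos by (intro divide_right_mono mult_left_mono) auto
    obtain \<psi> D where "C1c \<Omega> \<psi> D" "(\<integral>x. \<bar>\<psi> x - u (Suc k) x\<bar> \<partial>\<mu>) < inverse (real (Suc k))"
      "(\<integral>x. (norm (D x))\<^sup>2 \<partial>\<mu>) < K * (\<integral>x. datum (Suc k) x / u (Suc k) x ^ Suc k \<partial>\<mu>) / \<alpha> + 1"
      by (rule singular_C1c_approximation[OF solution_facts(1-3)[OF n1] K(2)[OF n1] rhs_integrable[OF n1], of "inverse (real (Suc k))"]) auto
    then show ?thesis using le by (intro exI[of _ \<psi>] exI[of _ D]) auto
  qed
  then have "\<forall>k. \<exists>\<psi> D. C1c \<Omega> \<psi> D \<and> (\<integral>x. \<bar>\<psi> x - u (Suc k) x\<bar> \<partial>\<mu>) < inverse (real (Suc k)) \<and>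
    (\<integral>x. (norm (D x))\<^sup>2 \<partial>\<mu>) \<le> K * C / \<alpha> + 1" by blast
  from choice[OF this] obtain \<psi> where "\<forall>k. \<exists>D. C1c \<Omega> (\<psi> k) D \<and> (\<integral>x. \<bar>\<psi> k x - u (Suc k) x\<bar> \<partial>\<mu>) < inverse (real (Suc k)) \<and>
    (\<integral>x. (norm (D x))\<^sup>2 \<partial>\<mu>) \<le> K * C / \<alpha> + 1" by (elim exE)
  from choice[OF this] obtain D where D: "\<forall>k. C1c \<Omega> (\<psi> k) (D k) \<and> (\<integral>x. \<bar>\<psi> k x - u (Suc k) x\<bar> \<partial>\<mu>) < inverse (real (Suc k)) \<and>
    (\<integral>x. (norm (D k x))\<^sup>2 \<partial>\<mu>) \<le> K * C / \<alpha> + 1" by (elim exE)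
  have [measurable]: "u (Suc k) \<in> borel_measurable \<mu>" for k by (rule u_measurable) simp
  have iu: "integrable \<mu> (u (Suc k))" for k
    by (rule integrable_const_bound[of _ K]) (use K(2)[of "Suc k"] in auto)
  have "(\<lambda>k. \<integral>x. \<bar>u (Suc k) x - 1\<bar> \<partial>\<mu>) \<longlonglongrightarrow> (\<integral>x. 0 \<partial>\<mu>)"
  proof (rule integral_dominated_convergence[where w="\<lambda>x. K + 1"])
    show "AE x in \<mu>. (\<lambda>k. \<bar>u (Suc k) x - 1\<bar>) \<longlonglongrightarrow> 0"
      using solutions_tendsto_one
    proof eventually_elim
      case (elim x)
      have "(\<lambda>k. \<bar>u (Suc k) x - 1\<bar>) \<longlonglongrightarrow> \<bar>1 - 1\<bar>" by (intro tendsto_intros LIMSEQ_Suc[OF elim])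
      then show ?case by simp
    qed
    show "AE x in \<mu>. norm \<bar>u (Suc k) x - 1\<bar> \<le> K + 1" for k
    proof -
      have "1 \<le> Suc k" by simp
      from K(2)[OF this] show ?thesis by eventually_elim auto
    qed
  qed auto
  then have l1: "(\<lambda>k. \<integral>x. \<bar>u (Suc k) x - 1\<bar> \<partial>\<mu>) \<longlonglongrightarrow> 0" by simp
  have "(\<lambda>k. \<integral>x. \<bar>\<psi> k x - 1\<bar> \<partial>\<mu>) \<longlonglongrightarrow> 0"
  proof (rule null_sequence_bound2[OF _ _ LIMSEQ_inverse_real_of_nat l1])
    fix k
    have i\<psi>: "integrable \<mu> (\<psi> k)" using D square_integrable_L1[OF C1c_square_integrable(1) finite_measure_axioms] by blast
    have "(\<integral>x. \<bar>\<psi> k x - 1\<bar> \<partial>\<mu>) \<le> (\<integral>x. \<bar>\<psi> k x - u (Suc k) x\<bar> + \<bar>u (Suc k) x - 1\<bar> \<partial>\<mu>)"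
      by (rule integral_mono) (use i\<psi> iu in auto)
    also have "\<dots> = (\<integral>x. \<bar>\<psi> k x - u (Suc k) x\<bar> \<partial>\<mu>) + (\<integral>x. \<bar>u (Suc k) x - 1\<bar> \<partial>\<mu>)" using i\<psi> iu by simp
    also have "(\<integral>x. \<bar>\<psi> k x - u (Suc k) x\<bar> \<partial>\<mu>) \<le> inverse (real (Suc k))" using D less_imp_le by blast
    finally show "(\<integral>x. \<bar>\<psi> k x - 1\<bar> \<partial>\<mu>) \<le> 1 * inverse (real (Suc k)) + 1 * (\<integral>x. \<bar>u (Suc k) x - 1\<bar> \<partial>\<mu>)" by simp
  qed (auto intro!: integral_nonneg_AE)
  then have "measure \<mu> \<Omega> = 0"
    using D by (intro no_bounded_energy_approximation_of_one[of \<psi> D]) blast+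
  then show False using domain_not_null by simp
qed

text \<open>The constant \<open>1\<close> satisfies an equation in the interior; what fails is the boundary condition, which
  would put \<open>1\<close> into \<open>W\<^sup>1\<^sup>,\<^sup>1\<^sub>0(\<Omega>)\<close>.\<close>

lemma no_limit_equation:
  assumes "AE x in \<mu>. v x = 1"
  shows "\<not> limit_equation \<Omega> M g T v"
proof
  assume "limit_equation \<Omega> M g T v"
  then obtain p H where "W1p0 1 \<Omega> (\<lambda>x. \<bar>v x\<bar> powr p) H"
    unfolding limit_equation_def dirichlet_problem_def by blast
  moreover have "AE x in \<mu>. \<bar>v x\<bar> powr p = 1" using assms by eventually_elim simp
  ultimately show False using one_not_in_W110 domain_not_null by blast
qed

end

theorem theorem2p3:
  fixes \<Omega> :: "(real ^ 'n) set"
    and M :: "real ^ 'n \<Rightarrow> real ^ 'n ^ 'n"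
    and \<alpha> \<beta> :: real
    and f :: "real ^ 'n \<Rightarrow> real"
    and \<omega> :: "nat \<Rightarrow> (real ^ 'n) set"
    and u :: "nat \<Rightarrow> real ^ 'n \<Rightarrow> real"
    and g :: "nat \<Rightarrow> real ^ 'n \<Rightarrow> real"
  assumes "open \<Omega>" and "bounded \<Omega>"
    and "elliptic_matrix \<Omega> \<alpha> \<beta> M"
    and "in_Linf \<Omega> f"
    and "\<And>A. A \<subset>\<subset> \<Omega> \<Longrightarrow> \<exists>c>0. AE x in lebesgue_on \<Omega>. x \<in> A \<longrightarrow> f x \<ge> c"
    and "\<And>n. n \<ge> 1 \<Longrightarrow> \<omega> n \<in> sets lebesgue"
    and "\<And>n. n \<ge> 1 \<Longrightarrow> \<omega> n \<subset>\<subset> \<Omega>"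
    and "\<And>n. n \<ge> 1 \<Longrightarrow> \<omega> n \<subseteq> \<omega> (Suc n)"
    and "(\<Union>n\<in>{1..}. \<omega> n) = \<Omega>"
    and "\<And>n. n \<ge> 1 \<Longrightarrow>
           singular_solution \<Omega> M (\<lambda>x. f x * indicator (\<omega> n) x) (real n) (u n)"
  defines "g \<equiv> \<lambda>n x. f x * indicator (\<omega> n) x / u n x ^ n"
  shows "(\<exists>C. \<forall>n\<ge>1. ess_bounded_by \<Omega> C (u n)) \<and>
         (\<exists>r v. strict_mono r \<and> in_Linf \<Omega> v \<and>
            (AE x in lebesgue_on \<Omega>. (\<lambda>k. u (r k) x) \<longlonglongrightarrow> v x)) \<and>
         (\<forall>n\<ge>1. integrable (lebesgue_on \<Omega>) (g n)) \<and>
         \<not> (\<exists>C. \<forall>n\<ge>1. (\<integral>x. \<bar>g n x\<bar> \<partial>lebesgue_on \<Omega>) \<le> C) \<and>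
         (\<forall>r v. strict_mono r \<and> (AE x in lebesgue_on \<Omega>. (\<lambda>k. u (r k) x) \<longlonglongrightarrow> v x) \<longrightarrow>
            (AE x in lebesgue_on \<Omega>. v x = 1) \<and>
            \<not> (\<exists>T. limit_equation \<Omega> M (\<lambda>k. g (r k)) T v))"
proof -
  interpret singular_sequence \<Omega> M \<alpha> \<beta> f \<omega> u
    using assms(1-10) by unfold_locales
  let ?\<mu> = "lebesgue_on \<Omega>"
  have g: "g n = (\<lambda>x. datum n x / u n x ^ n)" for n unfolding g_def datum_def by simp
  show ?thesis
  proof (intro conjI allI impI)
    obtain K where K: "K > 0" "\<And>n. n \<ge> 1 \<Longrightarrow> AE x in ?\<mu>. 0 < u n x \<and> u n x \<le> K" using uniform_bound by blast
    have "ess_bounded_by \<Omega> K (u n)" if n: "n \<ge> 1" for n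
      unfolding ess_bounded_by_def using u_measurable[OF n] K(2)[OF n] by auto
    then show "\<exists>C. \<forall>n\<ge>1. ess_bounded_by \<Omega> C (u n)" by blast
    have "strict_mono (\<lambda>k::nat. k)" by (simp add: strict_mono_def)
    moreover have "in_Linf \<Omega> (\<lambda>x. 1)" unfolding in_Linf_def ess_bounded_by_def by auto
    ultimately show "\<exists>r v. strict_mono r \<and> in_Linf \<Omega> v \<and> (AE x in ?\<mu>. (\<lambda>k. u (r k) x) \<longlonglongrightarrow> v x)"
      using solutions_tendsto_one by blast
    show "integrable ?\<mu> (g n)" if "1 \<le> n" for n unfolding g using rhs_integrable[OF that] .
    show "\<not> (\<exists>C. \<forall>n\<ge>1. (\<integral>x. \<bar>g n x\<bar> \<partial>?\<mu>) \<le> C)" unfolding g by (rule rhs_unbounded)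
    fix r v assume rv: "strict_mono r \<and> (AE x in ?\<mu>. (\<lambda>k. u (r k) x) \<longlonglongrightarrow> v x)"
    then have "AE x in ?\<mu>. (\<lambda>k. u (r k) x) \<longlonglongrightarrow> v x" by blast
    then show one: "AE x in ?\<mu>. v x = 1"
      using solutions_tendsto_one
    proof eventually_elim
      case (elim x)
      have "(\<lambda>k. u (r k) x) \<longlonglongrightarrow> 1"
        using LIMSEQ_subseq_LIMSEQ[OF elim(2)] rv by (auto simp: comp_def)
      with elim(1) show ?case by (rule LIMSEQ_unique)
    qed
    show "\<not> (\<exists>T. limit_equation \<Omega> M (\<lambda>k. g (r k)) T v)" using no_limit_equation[OF one] by blast
  qed
qed

end
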